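(* For any finitely generated discrete quantum group $(\Gamma,u)$ with $n^2$ generators, we have $$m_k(\Gamma,u)\ge 2^{k/2}\,C_{k/2}\ \text{ if } k \text{ is even},\qquad m_k(\Gamma,u)\ge 0\ \text{ if } k\text{ is odd},$$ where $C_m=\frac{1}{m+1}\binom{2m}{m}$ denotes the $m$-th Catalan number. In addition, if equality holds in these inequalities for all $k\in\mathbb{N}$, then $\Gamma$ is isomorphic to the unitary free quantum group $\mathbb{F}U(Q)$ for some invertible matrix $Q\in M_n(\mathbb{C})$.
   Context: An (algebraic) compact quantum group $\mathbb{G}$ is a Hopf $*$-algebra $\mathrm{Pol}(\mathbb{G})$ over $\mathbb{C}$ with comultiplication $\Delta$ which admits a unital positive linear functional $h:\mathrm{Pol}(\mathbb{G})\to\mathbb{C}$ (the Haar state; it is unique and faithful) with $(h\otimes\mathrm{id})\Delta=h(\cdot)1=(\mathrm{id}\otimes h)\Delta$. It is a compact matrix quantum group with fundamental representation $u=(u_{ij})_{i,j=1}^n\in M_n(\mathrm{Pol}(\mathbb{G}))$ if $u$ is unitary, $\Delta(u_{ij})=\sum_{k=1}^n u_{ik}\otimes u_{kj}$ for all $i,j$, the entries $u_{ij}$ generate $\mathrm{Pol}(\mathbb{G})$ as a unital $*$-algebra, and $u^c=(u_{ij}^* )_{i,j=1}^n$ is invertible in $M_n(\mathrm{Pol}(\mathbb{G}))$. A finitely generated discrete quantum group $(\Gamma,u)$ with $n^2$ generators is by definition the Pontryagin dual of a compact matrix quantum group $\mathbb{G}$ with fundamental representation $u\in M_n(\mathrm{Pol}(\mathbb{G}))$;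 all data about $(\Gamma,u)$ are expressed in terms of $(\mathrm{Pol}(\mathbb{G}),\Delta,u)$. Two such objects with fundamental representations $u,v$ of the same size $n$ are isomorphic if there is a $*$-isomorphism between the polynomial algebras sending $v_{ij}$ to $u_{ij}$ for all $i,j$. The main character is $\chi_{\Gamma,u}=\sum_{i=1}^n u_{ii}$ and the moments are $m_k(\Gamma,u)=h\big((\chi_{\Gamma,u}+\chi_{\Gamma,u}^* )^k\big)$ for natural numbers $k$, where $h$ is the Haar state on the dual compact matrix quantum group $\mathbb{G}$. For invertible $Q\in M_n(\mathbb{C})$, the unitary free quantum group $\mathbb{F}U(Q)$ is the dual of the compact matrix quantum group $U_Q^+$, where $\mathrm{Pol}(U_Q^+)$ is the universal unital $*$-algebra generated by elements $u_{ij}$ ($1\le i,j\le n$) such that $u=(u_{ij})$ and $(Q\otimes 1)u^c(Q^{-1}\otimes 1)$ are unitary, with $\Delta(u_{ij})=\sum_k u_{ik}\otimes u_{kj}$ and fundamental representation $u$.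
   Formalization: The formal theorem assumes n ≥ 2; for n = 1 the stated inequality fails (e.g. Γ = ℤ with u = z has m_4 = 6 < 8 = 2²·C_2, and every n = 1 case fails for large even k), and for n = 0 one has m_2 = 0 < 2. *)

theory Defs
  imports
    "HOL-Analysis.Finite_Cartesian_Product"
    "HOL-Algebra.QuotRing"
    "HOL-Algebra.Module"
    "HOL-Library.Poly_Mapping"
    "HOL-Library.Complex_Order"
begin


section \<open>Unital star-algebras over the complex numbers\<close>

record 'a star_alg = "(complex, 'a) module" +
  star :: "'a \<Rightarrow> 'a"

definition complex_ring :: "complex ring" where
  "complex_ring = \<lparr>carrier = UNIV, monoid.mult = (*), one = 1, zero = 0, add = (+)\<rparr>"

locale star_algebra = module complex_ring A + A?: ring A for A :: "'a star_alg" (structure) +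
  assumes smult_mult_left: "\<lbrakk>x \<in> carrier A; y \<in> carrier A\<rbrakk> \<Longrightarrow> (c \<odot> x) \<otimes> y = c \<odot> (x \<otimes> y)"
    and smult_mult_right: "\<lbrakk>x \<in> carrier A; y \<in> carrier A\<rbrakk> \<Longrightarrow> x \<otimes> (c \<odot> y) = c \<odot> (x \<otimes> y)"
    and star_closed: "x \<in> carrier A \<Longrightarrow> star A x \<in> carrier A"
    and star_star: "x \<in> carrier A \<Longrightarrow> star A (star A x) = x"
    and star_add: "\<lbrakk>x \<in> carrier A; y \<in> carrier A\<rbrakk> \<Longrightarrow> star A (x \<oplus> y) = star A x \<oplus> star A y"
    and star_smult: "x \<in> carrier A \<Longrightarrow> star A (c \<odot> x) = cnj c \<odot> star A x"
    and star_mult: "\<lbrakk>x \<in> carrier A; y \<in> carrier A\<rbrakk> \<Longrightarrow> star A (x \<otimes> y) = star A y \<otimes> star A x"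

definition linear_maps :: "'a star_alg \<Rightarrow> 'b star_alg \<Rightarrow> ('a \<Rightarrow> 'b) set" where
  "linear_maps A B = {f \<in> carrier A \<rightarrow> carrier B.
     (\<forall>x\<in>carrier A. \<forall>y\<in>carrier A. f (x \<oplus>\<^bsub>A\<^esub> y) = f x \<oplus>\<^bsub>B\<^esub> f y) \<and>
     (\<forall>c. \<forall>x\<in>carrier A. f (c \<odot>\<^bsub>A\<^esub> x) = c \<odot>\<^bsub>B\<^esub> f x)}"

definition star_hom :: "'a star_alg \<Rightarrow> 'b star_alg \<Rightarrow> ('a \<Rightarrow> 'b) set" where
  "star_hom A B = {f \<in> ring_hom A B \<inter> linear_maps A B.
     \<forall>x\<in>carrier A. f (star A x) = star B (f x)}"

definition star_iso :: "'a star_alg \<Rightarrow> 'b star_alg \<Rightarrow> ('a \<Rightarrow> 'b) set" where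
  "star_iso A B = {f \<in> star_hom A B. bij_betw f (carrier A) (carrier B)}"

definition complex_alg :: "complex star_alg" where
  "complex_alg = \<lparr>carrier = UNIV, monoid.mult = (*), one = 1, zero = 0, add = (+),
     smult = (*), star = cnj\<rparr>"

inductive_set star_generated :: "'a star_alg \<Rightarrow> 'a set \<Rightarrow> 'a set" for A S where
  gen: "x \<in> S \<Longrightarrow> x \<in> star_generated A S"
| one: "\<one>\<^bsub>A\<^esub> \<in> star_generated A S"
| add: "\<lbrakk>x \<in> star_generated A S; y \<in> star_generated A S\<rbrakk> \<Longrightarrow> x \<oplus>\<^bsub>A\<^esub> y \<in> star_generated A S"
| smult: "x \<in> star_generated A S \<Longrightarrow> c \<odot>\<^bsub>A\<^esub> x \<in> star_generated A S"
| mult: "\<lbrakk>x \<in> star_generated A S; y \<in> star_generated A S\<rbrakk> \<Longrightarrow> x \<otimes>\<^bsub>A\<^esub> y \<in> star_generated A S"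
| star: "x \<in> star_generated A S \<Longrightarrow> star A x \<in> star_generated A S"

text \<open>The star-algebra quotient, extending the quotient ring \<open>A Quot I\<close>; it is meaningful for a
  two-sided ideal \<open>I\<close> that is closed under \<open>star A\<close>.\<close>

definition star_quot :: "'a star_alg \<Rightarrow> 'a set \<Rightarrow> 'a set star_alg" where
  "star_quot A I = \<lparr>carrier = carrier (A Quot I), monoid.mult = monoid.mult (A Quot I),
     one = \<one>\<^bsub>A Quot I\<^esub>, zero = \<zero>\<^bsub>A Quot I\<^esub>, add = add (A Quot I),
     smult = (\<lambda>c X. \<Union>x\<in>X. I +>\<^bsub>A\<^esub> (c \<odot>\<^bsub>A\<^esub> x)),
     star = (\<lambda>X. \<Union>x\<in>X. I +>\<^bsub>A\<^esub> star A x)\<rparr>"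

text \<open>The complex monoid algebra of a monoid \<open>M\<close>, with the involution that extends an involutive
  anti-automorphism \<open>\<sigma>\<close> of \<open>M\<close> conjugate-linearly. Only the underlying vector space is available
  from \<open>Poly_Mapping\<close>, whose product presupposes a type-class monoid of keys.\<close>

definition monoid_alg ::
    "('m, 'e) monoid_scheme \<Rightarrow> ('m \<Rightarrow> 'm) \<Rightarrow> ('m \<Rightarrow>\<^sub>0 complex) star_alg" where
  "monoid_alg M \<sigma> = \<lparr>carrier = {f. Poly_Mapping.keys f \<subseteq> carrier M},
     monoid.mult = (\<lambda>f g. \<Sum>p\<in>Poly_Mapping.keys f. \<Sum>q\<in>Poly_Mapping.keys g.
        Poly_Mapping.single (p \<otimes>\<^bsub>M\<^esub> q) (Poly_Mapping.lookup f p * Poly_Mapping.lookup g q)),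
     one = Poly_Mapping.single \<one>\<^bsub>M\<^esub> 1, zero = 0, add = (+),
     smult = (\<lambda>c. Poly_Mapping.map ((*) c)),
     star = (\<lambda>f. \<Sum>p\<in>Poly_Mapping.keys f.
        Poly_Mapping.single (\<sigma> p) (cnj (Poly_Mapping.lookup f p)))\<rparr>"


section \<open>Algebraic tensor products\<close>

text \<open>The free vector space on \<open>carrier A \<times> carrier B\<close> carries the star-algebra structure with
  \<open>(a, b) (a', b') = (a a', b b')\<close> and \<open>(a, b)\<^sup>* = (a\<^sup>*, b\<^sup>*)\<close>.
  Multiplying a bilinearity relator below by a basis element, or applying the star to it, gives
  another relator. Hence the ideal they generate is their linear span and is star-closed, and the
  quotient by it is the usual algebraic tensor product \<open>A \<otimes> B\<close>.\<close>

definition free_prod_alg :: "'a star_alg \<Rightarrow> 'b star_alg \<Rightarrow> ('a \<times> 'b \<Rightarrow>\<^sub>0 complex) star_alg" where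
  "free_prod_alg A B = monoid_alg (A \<times>\<times> B) (map_prod (star A) (star B))"

definition bilinear_relators :: "'a star_alg \<Rightarrow> 'b star_alg \<Rightarrow> ('a \<times> 'b \<Rightarrow>\<^sub>0 complex) set" where
  "bilinear_relators A B =
     {Poly_Mapping.single (x \<oplus>\<^bsub>A\<^esub> x', y) 1 - Poly_Mapping.single (x, y) 1
        - Poly_Mapping.single (x', y) 1
      | x x' y. x \<in> carrier A \<and> x' \<in> carrier A \<and> y \<in> carrier B} \<union>
     {Poly_Mapping.single (x, y \<oplus>\<^bsub>B\<^esub> y') 1 - Poly_Mapping.single (x, y) 1
        - Poly_Mapping.single (x, y') 1
      | x y y'. x \<in> carrier A \<and> y \<in> carrier B \<and> y' \<in> carrier B} \<union>
     {Poly_Mapping.single (c \<odot>\<^bsub>A\<^esub> x, y) 1 - Poly_Mapping.single (x, y) c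
      | c x y. x \<in> carrier A \<and> y \<in> carrier B} \<union>
     {Poly_Mapping.single (x, c \<odot>\<^bsub>B\<^esub> y) 1 - Poly_Mapping.single (x, y) c
      | c x y. x \<in> carrier A \<and> y \<in> carrier B}"

definition tensor_ideal :: "'a star_alg \<Rightarrow> 'b star_alg \<Rightarrow> ('a \<times> 'b \<Rightarrow>\<^sub>0 complex) set" where
  "tensor_ideal A B = Idl\<^bsub>free_prod_alg A B\<^esub> (bilinear_relators A B)"

type_synonym ('a, 'b) tensor = "('a \<times> 'b \<Rightarrow>\<^sub>0 complex) set"

definition tensor_alg :: "'a star_alg \<Rightarrow> 'b star_alg \<Rightarrow> ('a, 'b) tensor star_alg" where
  "tensor_alg A B = star_quot (free_prod_alg A B) (tensor_ideal A B)"

definition tensor_elt :: "'a star_alg \<Rightarrow> 'b star_alg \<Rightarrow> 'a \<Rightarrow> 'b \<Rightarrow> ('a, 'b) tensor" where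
  "tensor_elt A B x y =
     tensor_ideal A B +>\<^bsub>free_prod_alg A B\<^esub> Poly_Mapping.single (x, y) 1"

text \<open>The linear map \<open>A \<otimes> B \<rightarrow> V\<close> induced by a bilinear map \<open>\<beta>\<close>: bilinearity of \<open>\<beta>\<close> makes the
  sum independent of the chosen representative \<open>f\<close> of \<open>X\<close>.\<close>

definition tensor_lift :: "'v star_alg \<Rightarrow> ('a \<Rightarrow> 'b \<Rightarrow> 'v) \<Rightarrow> ('a, 'b) tensor \<Rightarrow> 'v" where
  "tensor_lift V \<beta> X = (THE v. \<exists>f\<in>X. v =
     (\<Oplus>\<^bsub>V\<^esub>p\<in>Poly_Mapping.keys f. Poly_Mapping.lookup f p \<odot>\<^bsub>V\<^esub> \<beta> (fst p) (snd p)))"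

definition tensor_map :: "'c star_alg \<Rightarrow> 'd star_alg \<Rightarrow> ('a \<Rightarrow> 'c) \<Rightarrow> ('b \<Rightarrow> 'd) \<Rightarrow>
    ('a, 'b) tensor \<Rightarrow> ('c, 'd) tensor" where
  "tensor_map C D f g = tensor_lift (tensor_alg C D) (\<lambda>x y. tensor_elt C D (f x) (g y))"

text \<open>The canonical map \<open>(A \<otimes> B) \<otimes> C \<rightarrow> A \<otimes> (B \<otimes> C)\<close>.\<close>

definition tensor_assoc :: "'a star_alg \<Rightarrow> 'b star_alg \<Rightarrow> 'c star_alg \<Rightarrow>
    (('a, 'b) tensor, 'c) tensor \<Rightarrow> ('a, ('b, 'c) tensor) tensor" where
  "tensor_assoc A B C = tensor_lift (tensor_alg A (tensor_alg B C))
     (\<lambda>X z. tensor_lift (tensor_alg A (tensor_alg B C))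
        (\<lambda>x y. tensor_elt A (tensor_alg B C) x (tensor_elt B C y z)) X)"


section \<open>Hopf star-algebras and compact quantum groups\<close>

text \<open>Tensor factors \<open>\<complex> \<otimes> A\<close> and \<open>A \<otimes> \<complex>\<close> are identified with \<open>A\<close> throughout.\<close>

definition is_counit :: "'a star_alg \<Rightarrow> ('a \<Rightarrow> ('a, 'a) tensor) \<Rightarrow> ('a \<Rightarrow> complex) \<Rightarrow> bool" where
  "is_counit A \<Delta> \<epsilon> \<longleftrightarrow> \<epsilon> \<in> ring_hom A complex_alg \<inter> linear_maps A complex_alg \<and>
     (\<forall>a\<in>carrier A. tensor_lift A (\<lambda>x y. \<epsilon> x \<odot>\<^bsub>A\<^esub> y) (\<Delta> a) = a \<and>
                    tensor_lift A (\<lambda>x y. \<epsilon> y \<odot>\<^bsub>A\<^esub> x) (\<Delta> a) = a)"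

definition is_antipode :: "'a star_alg \<Rightarrow> ('a \<Rightarrow> ('a, 'a) tensor) \<Rightarrow> ('a \<Rightarrow> complex) \<Rightarrow>
    ('a \<Rightarrow> 'a) \<Rightarrow> bool" where
  "is_antipode A \<Delta> \<epsilon> S \<longleftrightarrow> S \<in> linear_maps A A \<and>
     (\<forall>a\<in>carrier A. tensor_lift A (\<lambda>x y. S x \<otimes>\<^bsub>A\<^esub> y) (\<Delta> a) = \<epsilon> a \<odot>\<^bsub>A\<^esub> \<one>\<^bsub>A\<^esub> \<and>
                    tensor_lift A (\<lambda>x y. x \<otimes>\<^bsub>A\<^esub> S y) (\<Delta> a) = \<epsilon> a \<odot>\<^bsub>A\<^esub> \<one>\<^bsub>A\<^esub>)"

definition hopf_star_algebra :: "'a star_alg \<Rightarrow> ('a \<Rightarrow> ('a, 'a) tensor) \<Rightarrow> bool" where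
  "hopf_star_algebra A \<Delta> \<longleftrightarrow> star_algebra A \<and> \<Delta> \<in> star_hom A (tensor_alg A A) \<and>
     (\<forall>a\<in>carrier A. tensor_assoc A A A (tensor_map (tensor_alg A A) A \<Delta> (\<lambda>x. x) (\<Delta> a)) =
                    tensor_map A (tensor_alg A A) (\<lambda>x. x) \<Delta> (\<Delta> a)) \<and>
     (\<exists>\<epsilon> S. is_counit A \<Delta> \<epsilon> \<and> is_antipode A \<Delta> \<epsilon> S)"

text \<open>The order on \<^typ>\<open>complex\<close> is that of \<^theory>\<open>HOL-Library.Complex_Order\<close>: \<open>0 \<le> z\<close> says that
  \<open>z\<close> is real and nonnegative.\<close>

definition is_haar_state :: "'a star_alg \<Rightarrow> ('a \<Rightarrow> ('a, 'a) tensor) \<Rightarrow> ('a \<Rightarrow> complex) \<Rightarrow> bool" where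
  "is_haar_state A \<Delta> h \<longleftrightarrow> h \<in> linear_maps A complex_alg \<and> h \<one>\<^bsub>A\<^esub> = 1 \<and>
     (\<forall>a\<in>carrier A. 0 \<le> h (star A a \<otimes>\<^bsub>A\<^esub> a)) \<and>
     (\<forall>a\<in>carrier A. tensor_lift A (\<lambda>x y. h x \<odot>\<^bsub>A\<^esub> y) (\<Delta> a) = h a \<odot>\<^bsub>A\<^esub> \<one>\<^bsub>A\<^esub> \<and>
                    tensor_lift A (\<lambda>x y. h y \<odot>\<^bsub>A\<^esub> x) (\<Delta> a) = h a \<odot>\<^bsub>A\<^esub> \<one>\<^bsub>A\<^esub>)"

definition compact_quantum_group :: "'a star_alg \<Rightarrow> ('a \<Rightarrow> ('a, 'a) tensor) \<Rightarrow> bool" where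
  "compact_quantum_group A \<Delta> \<longleftrightarrow> hopf_star_algebra A \<Delta> \<and> (\<exists>h. is_haar_state A \<Delta> h)"

text \<open>The Haar state is unique on \<open>carrier A\<close>, so all choices agree there.\<close>

definition haar_state :: "'a star_alg \<Rightarrow> ('a \<Rightarrow> ('a, 'a) tensor) \<Rightarrow> 'a \<Rightarrow> complex" where
  "haar_state A \<Delta> = (SOME h. is_haar_state A \<Delta> h)"


section \<open>Matrices over a star-algebra\<close>

definition mat_carrier :: "'a star_alg \<Rightarrow> ('a^'n^'n) set" where
  "mat_carrier A = {X. \<forall>i j. X $ i $ j \<in> carrier A}"

definition mat_mult :: "'a star_alg \<Rightarrow> 'a^'n^'n \<Rightarrow> 'a^'n^'n \<Rightarrow> 'a^'n^'n" where
  "mat_mult A X Y = (\<chi> i j. \<Oplus>\<^bsub>A\<^esub>k\<in>UNIV. X $ i $ k \<otimes>\<^bsub>A\<^esub> Y $ k $ j)"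

definition mat_one :: "'a star_alg \<Rightarrow> 'a^'n^'n" where
  "mat_one A = (\<chi> i j. if i = j then \<one>\<^bsub>A\<^esub> else \<zero>\<^bsub>A\<^esub>)"

definition mat_adj :: "'a star_alg \<Rightarrow> 'a^'n^'n \<Rightarrow> 'a^'n^'n" where
  "mat_adj A X = (\<chi> i j. star A (X $ j $ i))"

definition mat_conj :: "'a star_alg \<Rightarrow> 'a^'n^'n \<Rightarrow> 'a^'n^'n" where
  "mat_conj A X = (\<chi> i j. star A (X $ i $ j))"

text \<open>\<open>Q \<otimes> 1 \<in> M\<^sub>n(\<complex>) \<otimes> A = M\<^sub>n(A)\<close>.\<close>

definition mat_scalar :: "'a star_alg \<Rightarrow> complex^'n^'n \<Rightarrow> 'a^'n^'n" where
  "mat_scalar A Q = (\<chi> i j. Q $ i $ j \<odot>\<^bsub>A\<^esub> \<one>\<^bsub>A\<^esub>)"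

definition mat_unitary :: "'a star_alg \<Rightarrow> 'a^'n^'n \<Rightarrow> bool" where
  "mat_unitary A X \<longleftrightarrow> X \<in> mat_carrier A \<and>
     mat_mult A X (mat_adj A X) = mat_one A \<and> mat_mult A (mat_adj A X) X = mat_one A"

definition mat_invertible :: "'a star_alg \<Rightarrow> 'a^'n^'n \<Rightarrow> bool" where
  "mat_invertible A X \<longleftrightarrow> X \<in> mat_carrier A \<and>
     (\<exists>Y\<in>mat_carrier A. mat_mult A X Y = mat_one A \<and> mat_mult A Y X = mat_one A)"


section \<open>Finitely generated discrete quantum groups\<close>

text \<open>A finitely generated discrete quantum group is given by the data of the dual compact matrix
  quantum group: polynomial algebra, comultiplication and fundamental representation, the latter
  with rows and columns indexed by the finite type \<open>'n\<close>.\<close>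

record ('a, 'n) qgroup =
  pol :: "'a star_alg"
  comult :: "'a \<Rightarrow> ('a, 'a) tensor"
  fund :: "'a^'n^'n"

definition fg_discrete_quantum_group :: "('a, 'n::finite) qgroup \<Rightarrow> bool" where
  "fg_discrete_quantum_group \<Gamma> \<longleftrightarrow>
     compact_quantum_group (pol \<Gamma>) (comult \<Gamma>) \<and>
     mat_unitary (pol \<Gamma>) (fund \<Gamma>) \<and>
     (\<forall>i j. comult \<Gamma> (fund \<Gamma> $ i $ j) =
        (\<Oplus>\<^bsub>tensor_alg (pol \<Gamma>) (pol \<Gamma>)\<^esub>k\<in>UNIV.
           tensor_elt (pol \<Gamma>) (pol \<Gamma>) (fund \<Gamma> $ i $ k) (fund \<Gamma> $ k $ j))) \<and>
     star_generated (pol \<Gamma>) {fund \<Gamma> $ i $ j | i j. True} = carrier (pol \<Gamma>) \<and>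
     mat_invertible (pol \<Gamma>) (mat_conj (pol \<Gamma>) (fund \<Gamma>))"

definition qgroup_isomorphic :: "('a, 'n::finite) qgroup \<Rightarrow> ('b, 'n) qgroup \<Rightarrow> bool" where
  "qgroup_isomorphic \<Gamma> \<Lambda> \<longleftrightarrow>
     (\<exists>\<phi>\<in>star_iso (pol \<Lambda>) (pol \<Gamma>). \<forall>i j. \<phi> (fund \<Lambda> $ i $ j) = fund \<Gamma> $ i $ j)"

definition main_character :: "('a, 'n::finite) qgroup \<Rightarrow> 'a" where
  "main_character \<Gamma> = (\<Oplus>\<^bsub>pol \<Gamma>\<^esub>i\<in>UNIV. fund \<Gamma> $ i $ i)"

definition moment :: "('a, 'n::finite) qgroup \<Rightarrow> nat \<Rightarrow> complex" where
  "moment \<Gamma> k = haar_state (pol \<Gamma>) (comult \<Gamma>)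
     ((main_character \<Gamma> \<oplus>\<^bsub>pol \<Gamma>\<^esub> star (pol \<Gamma>) (main_character \<Gamma>)) [^]\<^bsub>pol \<Gamma>\<^esub> k)"


section \<open>Unitary free quantum groups\<close>

text \<open>The free unital star-algebra on generators \<open>u\<^sub>i\<^sub>j\<close>: the letter \<open>(i, j, False)\<close> stands
  for \<open>u\<^sub>i\<^sub>j\<close> and \<open>(i, j, True)\<close> for its adjoint.\<close>

type_synonym 'n free_elt = "('n \<times> 'n \<times> bool) list \<Rightarrow>\<^sub>0 complex"

definition word_monoid :: "('n \<times> 'n \<times> bool) list monoid" where
  "word_monoid = \<lparr>carrier = UNIV, monoid.mult = (@), one = []\<rparr>"

definition free_star_alg :: "'n free_elt star_alg" where
  "free_star_alg = monoid_alg word_monoid (\<lambda>w. rev (map (\<lambda>(i, j, b). (i, j, \<not> b)) w))"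

definition free_gen :: "('n free_elt)^'n^'n" where
  "free_gen = (\<chi> i j. Poly_Mapping.single [(i, j, False)] 1)"

definition unitarity_relators :: "'a star_alg \<Rightarrow> 'a^'n^'n \<Rightarrow> 'a set" where
  "unitarity_relators A X =
     {mat_mult A X (mat_adj A X) $ i $ j \<ominus>\<^bsub>A\<^esub> mat_one A $ i $ j | i j. True} \<union>
     {mat_mult A (mat_adj A X) X $ i $ j \<ominus>\<^bsub>A\<^esub> mat_one A $ i $ j | i j. True}"

definition twisted_conj :: "complex^'n^'n \<Rightarrow> ('n free_elt)^'n^'n" where
  "twisted_conj Q = mat_mult free_star_alg
     (mat_mult free_star_alg (mat_scalar free_star_alg Q) (mat_conj free_star_alg free_gen))
     (mat_scalar free_star_alg (matrix_inv Q))"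

text \<open>The star permutes the relators, so the two-sided ideal generated by them is star-closed.\<close>

definition free_unitary_ideal :: "complex^'n^'n \<Rightarrow> 'n free_elt set" where
  "free_unitary_ideal Q = Idl\<^bsub>free_star_alg\<^esub>
     (unitarity_relators free_star_alg free_gen \<union>
      unitarity_relators free_star_alg (twisted_conj Q))"

definition free_unitary_alg :: "complex^'n^'n \<Rightarrow> 'n free_elt set star_alg" where
  "free_unitary_alg Q = star_quot free_star_alg (free_unitary_ideal Q)"

definition free_unitary_fund :: "complex^'n^'n \<Rightarrow> ('n free_elt set)^'n^'n" where
  "free_unitary_fund Q =
     (\<chi> i j. free_unitary_ideal Q +>\<^bsub>free_star_alg\<^esub> free_gen $ i $ j)"

text \<open>By the universal property there is exactly one star-homomorphism with the prescribed values
  on the generators.\<close>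

definition free_unitary_comult ::
    "complex^'n^'n \<Rightarrow> 'n free_elt set \<Rightarrow> ('n free_elt set, 'n free_elt set) tensor" where
  "free_unitary_comult Q = (let A = free_unitary_alg Q; u = free_unitary_fund Q in
     SOME \<Delta>. \<Delta> \<in> star_hom A (tensor_alg A A) \<and>
       (\<forall>i j. \<Delta> (u $ i $ j) =
          (\<Oplus>\<^bsub>tensor_alg A A\<^esub>k\<in>UNIV. tensor_elt A A (u $ i $ k) (u $ k $ j))))"

definition FU :: "complex^'n^'n \<Rightarrow> ('n free_elt set, 'n::finite) qgroup" where
  "FU Q = \<lparr>pol = free_unitary_alg Q, comult = free_unitary_comult Q, fund = free_unitary_fund Q\<rparr>"


definition catalan :: "nat \<Rightarrow> complex" where
  "catalan m = of_nat ((2 * m) choose m) / of_nat (m + 1)"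

end

theory Submission
  imports Defs "HOL-Analysis.Analysis"
begin

text \<open>Since \<open>u\<^sup>c\<close> is invertible, averaging with the Haar state \<open>h\<close> yields a positive definite matrix
  \<open>M = h(u\<^sup>c u\<^sup>T)\<close> with \<open>u\<^sup>c M u\<^sup>T = M\<close>; writing \<open>M = Q\<^sup>-\<^sup>1 (Q\<^sup>-\<^sup>1)\<^sup>*\<close> makes \<open>Q u\<^sup>c Q\<^sup>-\<^sup>1\<close> unitary, so that
  \<open>Pol\<close> is a quotient of the algebra of the unitary free quantum group of \<open>Q\<close>.

  Expanding the \<open>k\<close>-th moment over words \<open>\<epsilon>\<close> of length \<open>k\<close> in \<open>u\<close> and \<open>u\<^sup>c\<close> gives the sum of the
  traces of the idempotents \<open>h(u\<^sup>\<epsilon>)\<close>, i.e. of the dimensions of the spaces of fixed vectors of \<open>u\<^sup>\<epsilon>\<close>.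
  These contain the vectors of the noncrossing pairings of \<open>\<epsilon>\<close>, which are linearly independent in
  dimension at least two, and there are \<open>2\<^sup>m C\<^sub>m\<close> noncrossing pairings of all words of length \<open>2m\<close>.

  If equality holds, every fixed vector comes from noncrossing pairings, hence is already fixed modulo
  the defining ideal \<open>I\<close> of the free quantum group. So for \<open>x\<close> in the kernel of the evaluation in \<open>Pol\<close>
  and every \<open>y\<close>, the element \<open>x\<^sub>(\<^sub>1\<^sub>) h(x\<^sub>(\<^sub>2\<^sub>) y)\<close> lies in \<open>I\<close>. Therefore \<open>a \<otimes> b \<mapsto> a\<^sub>(\<^sub>1\<^sub>) h(a\<^sub>(\<^sub>2\<^sub>) S(b))\<close> is
  well defined on \<open>Pol \<otimes> Pol\<close> modulo \<open>I\<close>; on \<open>\<Delta>(x)\<close> it takes the value \<open>x\<close>, and \<open>\<Delta>(x)\<close> vanishes in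
  \<open>Pol \<otimes> Pol\<close> for \<open>x\<close> in the kernel. Hence the kernel is contained in \<open>I\<close>.\<close>

section \<open>Monoid algebras\<close>

text \<open>Dimension at least two is essential: for the one-dimensional generator of the integers
  the fourth moment is 6, below 2^2 C_2 = 8. Accordingly the independence of the noncrossing vectors
  rests on two covectors whose pairing kills both kinds of cups.

  All computations take place in the free star-algebra, as congruences modulo an ideal. A quantum
  group enters only through the kernel of its evaluation map. Thus fixed vectors for
  \<open>\<Gamma>\<close> and for the free quantum group are compared on the same matrices of words,
  and neither a Haar state nor a representation theory of the latter has to be built.

  Why \<open>x_1 h(x_2 y)\<close> lies in \<open>I\<close>: if \<open>x\<close> and \<open>y\<close>
  are coefficients of \<open>u^\<epsilon>\<close> and \<open>u^\<delta>\<close>, the numbers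
  \<open>h(x_2 y)\<close> are part of a fixed vector of the concatenated word. That vector is fixed
  modulo \<open>I\<close> too, so the missing factor \<open>u^\<delta>\<close> can be inserted,
  summed away, and paid for by a matrix inverse of \<open>u^\<delta>\<close> modulo
  \<open>I\<close>. After this exchange \<open>x\<close> occurs only inside \<open>h\<close>,
  multiplied by coefficients, and \<open>h\<close> vanishes on the kernel, which is an
  ideal.\<close>

abbreviation (input) "pkeys \<equiv> Poly_Mapping.keys"
abbreviation (input) "plookup \<equiv> Poly_Mapping.lookup"
abbreviation (input) "psingle \<equiv> Poly_Mapping.single"

abbreviation (input) "scl c \<equiv> Poly_Mapping.map ((*) (c :: complex))"

text \<open>The coefficient is handed to \<open>\<phi>\<close> and not multiplied in afterwards, so
  that maps that are merely additive in it, such as the conjugate-linear star, are covered as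
  well.\<close>

definition lin :: "('p \<Rightarrow> complex \<Rightarrow> 'b::comm_monoid_add) \<Rightarrow> ('p \<Rightarrow>\<^sub>0 complex) \<Rightarrow> 'b" where
  "lin \<phi> f = (\<Sum>p\<in>pkeys f. \<phi> p (plookup f p))"

lemma lin_0 [simp]: "lin \<phi> 0 = 0"
  by (simp add: lin_def)

lemma lin_single: "\<phi> p 0 = 0 \<Longrightarrow> lin \<phi> (psingle p c) = \<phi> p c"
  by (simp add: lin_def lookup_single)

lemma lin_add:
  assumes "\<And>p. \<phi> p 0 = 0" "\<And>p a b. \<phi> p (a + b) = \<phi> p a + \<phi> p b"
  shows "lin \<phi> (f + g) = lin \<phi> f + lin \<phi> g"
  unfolding lin_def by (rule setsum_keys_plus_distrib) (use assms in auto)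

lemma lin_sum:
  assumes "\<And>p. \<phi> p 0 = 0" "\<And>p a b. \<phi> p (a + b) = \<phi> p a + \<phi> p b"
  shows "lin \<phi> (\<Sum>i\<in>S. f i) = (\<Sum>i\<in>S. lin \<phi> (f i))"
  by (induction S rule: infinite_finite_induct) (simp_all add: lin_add[OF assms])

lemma lin_minus:
  fixes \<phi> :: "'p \<Rightarrow> complex \<Rightarrow> 'b::ab_group_add"
  assumes "\<And>p. \<phi> p 0 = 0" "\<And>p a b. \<phi> p (a + b) = \<phi> p a + \<phi> p b"
  shows "lin \<phi> (f - g) = lin \<phi> f - lin \<phi> g"
proof -
  have "lin \<phi> (f - g + g) = lin \<phi> (f - g) + lin \<phi> g"
    by (rule lin_add) (use assms in auto)
  then show ?thesis by simp
qed

lemma lin_fun_add: "lin (\<lambda>p c. \<phi> p c + \<psi> p c) f = lin \<phi> f + lin \<psi> f"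
  by (simp add: lin_def sum.distrib)

lemma poly_mapping_sum_singles: "(\<Sum>p\<in>pkeys f. psingle p (plookup f p)) = f"
  for f :: "'p \<Rightarrow>\<^sub>0 complex"
  by (rule poly_mapping_eqI)
    (simp add: lookup_sum lookup_single when_def in_keys_iff)

lemma keys_add_single_induct [consumes 1, case_names zero single add]:
  fixes f :: "'p \<Rightarrow>\<^sub>0 complex"
  assumes "pkeys f \<subseteq> S" "P 0" "\<And>p c. p \<in> S \<Longrightarrow> P (psingle p c)"
    and add: "\<And>f g. \<lbrakk>pkeys f \<subseteq> S; pkeys g \<subseteq> S; P f; P g\<rbrakk> \<Longrightarrow> P (f + g)"
  shows "P f"
proof -
  have "pkeys (\<Sum>p\<in>T. psingle p (plookup f p)) \<subseteq> S \<and> P (\<Sum>p\<in>T. psingle p (plookup f p))"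
    if "finite T" "T \<subseteq> pkeys f" for T
    using that
  proof (induction T)
    case (insert p T)
    let ?s = "psingle p (plookup f p)" and ?r = "\<Sum>p\<in>T. psingle p (plookup f p)"
    have "pkeys ?s \<subseteq> S" "P ?s" "pkeys ?r \<subseteq> S" "P ?r"
      using insert assms by auto
    moreover from this have "pkeys (?s + ?r) \<subseteq> S"
      using Poly_Mapping.keys_add[of ?s ?r] by blast
    ultimately show ?case using insert(1,2) add by simp
  qed (simp add: assms)
  from this[of "pkeys f"] show ?thesis
    by (simp add: poly_mapping_sum_singles)
qed

lemma lookup_scale: "plookup (scl c f) p = c * plookup f p" for c :: complex
  by (simp add: Poly_Mapping.map.rep_eq when_def)

lemma scale_single: "scl c (psingle p a) = psingle p (c * a)" for c :: complex
  by (rule poly_mapping_eqI) (simp add: lookup_scale lookup_single when_def)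

lemma scale_add: "scl c (f + g) = scl c f + scl c g"
  for c :: complex
  by (rule poly_mapping_eqI) (simp add: lookup_scale lookup_add algebra_simps)

lemma scale_0 [simp]: "scl c 0 = 0" for c :: complex
  by (rule poly_mapping_eqI) (simp add: lookup_scale)

lemma keys_scale: "pkeys (scl c f) \<subseteq> pkeys f" for c :: complex
  by (auto simp: in_keys_iff lookup_scale)

lemma cring_complex_ring: "cring complex_ring"
proof (intro cringI abelian_groupI comm_monoidI)
  fix x assume "x \<in> carrier complex_ring"
  then show "\<exists>y\<in>carrier complex_ring. y \<oplus>\<^bsub>complex_ring\<^esub> x = \<zero>\<^bsub>complex_ring\<^esub>"
    by (intro bexI[of _ "- x"]) (simp_all add: complex_ring_def)
qed (simp_all add: complex_ring_def algebra_simps)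

lemma complex_ring_simps [simp]: "carrier complex_ring = UNIV"
  "x \<otimes>\<^bsub>complex_ring\<^esub> y = x * y" "x \<oplus>\<^bsub>complex_ring\<^esub> y = x + y"
  "\<one>\<^bsub>complex_ring\<^esub> = 1" "\<zero>\<^bsub>complex_ring\<^esub> = 0"
  by (simp_all add: complex_ring_def)

locale star_monoid = monoid M for M (structure) +
  fixes \<sigma> :: "'a \<Rightarrow> 'a"
  assumes \<sigma>_closed: "p \<in> carrier M \<Longrightarrow> \<sigma> p \<in> carrier M"
    and \<sigma>_invol: "p \<in> carrier M \<Longrightarrow> \<sigma> (\<sigma> p) = p"
    and \<sigma>_mult: "\<lbrakk>p \<in> carrier M; q \<in> carrier M\<rbrakk> \<Longrightarrow> \<sigma> (p \<otimes> q) = \<sigma> q \<otimes> \<sigma> p"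
begin

abbreviation "R \<equiv> monoid_alg M \<sigma>"

lemma carrier_R: "carrier R = {f. pkeys f \<subseteq> carrier M}"
  by (simp add: monoid_alg_def)

lemma mult_R: "f \<otimes>\<^bsub>R\<^esub> g = lin (\<lambda>p a. lin (\<lambda>q b. psingle (p \<otimes> q) (a * b)) g) f"
  by (simp add: monoid_alg_def lin_def)

lemma star_R: "star R f = lin (\<lambda>p a. psingle (\<sigma> p) (cnj a)) f"
  by (simp add: monoid_alg_def lin_def)

lemma simps_R: "\<one>\<^bsub>R\<^esub> = psingle \<one> 1" "\<zero>\<^bsub>R\<^esub> = 0" "f \<oplus>\<^bsub>R\<^esub> g = f + g"
  "c \<odot>\<^bsub>R\<^esub> f = scl c f"
  by (simp_all add: monoid_alg_def)

lemma mult_add_left: "(f + g) \<otimes>\<^bsub>R\<^esub> k = f \<otimes>\<^bsub>R\<^esub> k + g \<otimes>\<^bsub>R\<^esub> k"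
  unfolding mult_R by (subst lin_add) (simp_all add: lin_def distrib_right single_add sum.distrib)

lemma mult_add_right: "k \<otimes>\<^bsub>R\<^esub> (f + g) = k \<otimes>\<^bsub>R\<^esub> f + k \<otimes>\<^bsub>R\<^esub> g"
  unfolding mult_R by (subst lin_add) (simp_all add: distrib_left single_add lin_fun_add)

lemma mult_single: "psingle p a \<otimes>\<^bsub>R\<^esub> psingle q b = psingle (p \<otimes> q) (a * b)"
  unfolding mult_R by (subst lin_single; simp add: lin_single)+

lemma mult_0_left: "0 \<otimes>\<^bsub>R\<^esub> k = 0" and mult_0_right: "k \<otimes>\<^bsub>R\<^esub> 0 = 0"
  by (simp_all add: mult_R lin_def)

lemma star_add: "star R (f + g) = star R f + star R g"
  unfolding star_R by (rule lin_add) (simp_all add: single_add)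

lemma star_single: "star R (psingle p a) = psingle (\<sigma> p) (cnj a)"
  unfolding star_R by (simp add: lin_single)

lemma star_0: "star R 0 = 0"
  by (simp add: star_R)

lemmas R_simps = mult_add_left mult_add_right mult_single mult_0_left mult_0_right
  star_add star_single star_0 simps_R scale_add scale_single

lemma R_induct [consumes 1, case_names zero single add]:
  assumes "f \<in> carrier R" "P 0" "\<And>p c. p \<in> carrier M \<Longrightarrow> P (psingle p c)"
    "\<And>f g. \<lbrakk>f \<in> carrier R; g \<in> carrier R; P f; P g\<rbrakk> \<Longrightarrow> P (f + g)"
  shows "P f"
  using assms keys_add_single_induct[of f "carrier M" P] by (simp add: carrier_R)

lemma single_in_R: "p \<in> carrier M \<Longrightarrow> psingle p a \<in> carrier R"
  by (simp add: carrier_R)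

lemma add_in_R: "\<lbrakk>f \<in> carrier R; g \<in> carrier R\<rbrakk> \<Longrightarrow> f + g \<in> carrier R"
  using Poly_Mapping.keys_add[of f g] by (auto simp: carrier_R)

lemma zero_in_R: "0 \<in> carrier R"
  by (simp add: carrier_R)

lemma mult_in_R: assumes "f \<in> carrier R" "g \<in> carrier R" shows "f \<otimes>\<^bsub>R\<^esub> g \<in> carrier R"
  using assms
proof (induction f rule: R_induct)
  case (single p c)
  from \<open>g \<in> carrier R\<close> show ?case
    by (induction g rule: R_induct) (use single in \<open>simp_all add: R_simps zero_in_R single_in_R add_in_R\<close>)
qed (simp_all add: R_simps zero_in_R add_in_R)

lemma star_in_R: assumes "f \<in> carrier R" shows "star R f \<in> carrier R"
  using assms
  by (induction f rule: R_induct) (simp_all add: R_simps zero_in_R add_in_R single_in_R \<sigma>_closed)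

lemma scale_in_R:
  fixes c :: complex
  assumes "f \<in> carrier R" shows "scl c f \<in> carrier R"
  using assms keys_scale[of c f] by (auto simp: carrier_R)

lemma mult_assoc_R:
  assumes "f \<in> carrier R" "g \<in> carrier R" "k \<in> carrier R"
  shows "(f \<otimes>\<^bsub>R\<^esub> g) \<otimes>\<^bsub>R\<^esub> k = f \<otimes>\<^bsub>R\<^esub> (g \<otimes>\<^bsub>R\<^esub> k)"
  using assms
proof (induction f rule: R_induct)
  case (single p a)
  note p = this
  from \<open>g \<in> carrier R\<close> show ?case
  proof (induction g rule: R_induct)
    case (single q b)
    from \<open>k \<in> carrier R\<close> show ?case
      by (induction k rule: R_induct) (use single p in \<open>simp_all add: R_simps m_assoc mult.assoc\<close>)
  qed (simp_all add: R_simps)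
qed (simp_all add: R_simps)

lemma one_R: assumes "f \<in> carrier R"
  shows "\<one>\<^bsub>R\<^esub> \<otimes>\<^bsub>R\<^esub> f = f" "f \<otimes>\<^bsub>R\<^esub> \<one>\<^bsub>R\<^esub> = f"
  using assms by (induction f rule: R_induct) (simp_all add: R_simps)

lemma scale_mult_R:
  fixes c :: complex
  assumes "f \<in> carrier R" "g \<in> carrier R"
  shows "scl c f \<otimes>\<^bsub>R\<^esub> g = scl c (f \<otimes>\<^bsub>R\<^esub> g)"
    and "f \<otimes>\<^bsub>R\<^esub> scl c g = scl c (f \<otimes>\<^bsub>R\<^esub> g)"
proof -
  have "scl c f \<otimes>\<^bsub>R\<^esub> g = scl c (f \<otimes>\<^bsub>R\<^esub> g)
    \<and> f \<otimes>\<^bsub>R\<^esub> scl c g = scl c (f \<otimes>\<^bsub>R\<^esub> g)"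
    using assms
  proof (induction f rule: R_induct)
    case (single p a)
    from \<open>g \<in> carrier R\<close> show ?case
      by (induction g rule: R_induct) (use single in \<open>simp_all add: R_simps mult.left_commute mult.assoc\<close>)
  qed (simp_all add: R_simps)
  then show "scl c f \<otimes>\<^bsub>R\<^esub> g = scl c (f \<otimes>\<^bsub>R\<^esub> g)"
    "f \<otimes>\<^bsub>R\<^esub> scl c g = scl c (f \<otimes>\<^bsub>R\<^esub> g)" by auto
qed

lemma star_mult_R:
  assumes "f \<in> carrier R" "g \<in> carrier R"
  shows "star R (f \<otimes>\<^bsub>R\<^esub> g) = star R g \<otimes>\<^bsub>R\<^esub> star R f"
  using assms
proof (induction f rule: R_induct)
  case (single p a)
  from \<open>g \<in> carrier R\<close> show ?case
    by (induction g rule: R_induct) (use single in \<open>simp_all add: R_simps \<sigma>_mult mult.commute\<close>)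
qed (simp_all add: R_simps)

lemma star_star_R: assumes "f \<in> carrier R" shows "star R (star R f) = f"
  using assms by (induction f rule: R_induct) (simp_all add: R_simps \<sigma>_invol)

lemma star_scale_R:
  assumes "f \<in> carrier R"
  shows "star R (scl c f) = scl (cnj c) (star R f)"
  using assms
by (induction f rule: R_induct) (simp_all add: R_simps)

lemma abelian_group_R: "abelian_group R"
proof (rule abelian_groupI)
  fix f assume "f \<in> carrier R"
  then have "- f \<in> carrier R \<and> (- f) \<oplus>\<^bsub>R\<^esub> f = \<zero>\<^bsub>R\<^esub>"
    by (simp add: carrier_R simps_R in_keys_iff subset_iff)
  then show "\<exists>y\<in>carrier R. y \<oplus>\<^bsub>R\<^esub> f = \<zero>\<^bsub>R\<^esub>" by blast
qed (simp_all add: simps_R add_in_R zero_in_R add.assoc add.commute)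

lemma ring_R: "ring R"
proof (rule ringI[OF abelian_group_R])
  show "monoid R"
    by (rule monoidI) (simp_all add: mult_in_R mult_assoc_R one_R, simp add: simps_R single_in_R)
qed (simp_all add: R_simps)

lemma star_algebra_R: "star_algebra R"
proof -
  have "Module.module complex_ring R"
    by (rule moduleI[OF cring_complex_ring abelian_group_R])
      (simp_all add: simps_R scale_in_R,
       simp_all add: poly_mapping_eq_iff fun_eq_iff lookup_scale lookup_add algebra_simps)
  then show ?thesis
    by (intro star_algebra.intro ring_R star_algebra_axioms.intro)
      (simp_all only: simps_R scale_mult_R star_in_R star_star_R star_add star_scale_R star_mult_R)
qed

end

section \<open>Quotients and tensor products\<close>

locale star_quotient = star_algebra A + ideal I A for I and A (structure)
begin

abbreviation "T \<equiv> star_quot A I"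
abbreviation "cl x \<equiv> I +> x"

lemma T_simps: "carrier T = {cl x | x. x \<in> carrier A}"
  "\<one>\<^bsub>T\<^esub> = cl \<one>" "\<zero>\<^bsub>T\<^esub> = I"
  by (auto simp: star_quot_def FactRing_simps)

lemma cl_eq_iff: "\<lbrakk>x \<in> carrier A; y \<in> carrier A\<rbrakk> \<Longrightarrow> cl x = cl y \<longleftrightarrow> x \<ominus> y \<in> I"
  using quotient_eq_iff_same_a_r_cos[OF is_ideal] by simp

lemma cl_in_T: "x \<in> carrier A \<Longrightarrow> cl x \<in> carrier T"
  by (auto simp: T_simps)

lemma cl_zero: "cl \<zero> = I"
  using a_rcos_zero[OF is_ideal, of \<zero>] by simp

lemma cl_mult: "\<lbrakk>x \<in> carrier A; y \<in> carrier A\<rbrakk> \<Longrightarrow> cl x \<otimes>\<^bsub>T\<^esub> cl y = cl (x \<otimes> y)"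
  by (simp add: star_quot_def FactRing_simps(1) rcoset_mult_add)

lemma cl_add: "\<lbrakk>x \<in> carrier A; y \<in> carrier A\<rbrakk> \<Longrightarrow> cl x \<oplus>\<^bsub>T\<^esub> cl y = cl (x \<oplus> y)"
  by (simp add: star_quot_def FactRing_simps(1) a_rcos_sum)

lemma ring_T: "ring T"
proof -
  interpret Q: ring "A Quot I" by (rule quotient_is_ring)
  have sel: "carrier T = carrier (A Quot I)" "monoid.mult T = monoid.mult (A Quot I)"
    "\<one>\<^bsub>T\<^esub> = \<one>\<^bsub>A Quot I\<^esub>" "\<zero>\<^bsub>T\<^esub> = \<zero>\<^bsub>A Quot I\<^esub>" "add T = add (A Quot I)"
    by (simp_all add: star_quot_def)
  show ?thesis
    by (intro ringI abelian_groupI monoidI; unfold sel)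
      (simp_all add: Q.a_assoc Q.m_assoc Q.l_distr Q.r_distr Q.add.l_inv_ex[simplified],
        simp add: Q.a_comm)
qed

lemma in_cl: "\<lbrakk>x \<in> carrier A; y \<in> cl x\<rbrakk> \<Longrightarrow> y \<in> carrier A \<and> y \<ominus> x \<in> I"
  using a_elemrcos_carrier[of x y] a_repr_independence'[of y x] cl_eq_iff[of y x] by auto

lemma self_in_cl: "x \<in> carrier A \<Longrightarrow> x \<in> cl x"
  by (simp add: a_rcos_self)

lemma smult_in_I: assumes "x \<in> I" shows "c \<odot> x \<in> I"
proof -
  have "x \<in> carrier A" using assms by simp
  then have "c \<odot> x = (c \<odot> \<one>) \<otimes> x"
    by (simp add: smult_mult_left)
  then show ?thesis using assms by (simp add: I_l_closed)
qed

lemma smult_minus: "\<lbrakk>x \<in> carrier A; y \<in> carrier A\<rbrakk> \<Longrightarrow> c \<odot> x \<ominus> c \<odot> y = c \<odot> (x \<ominus> y)"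
  by (metis (no_types, lifting) smult_r_distr smult_r_minus complex_ring_simps(1) UNIV_I a_minus_def
      M.a_inv_closed)

lemma UN_const: "X \<noteq> {} \<Longrightarrow> (\<And>x. x \<in> X \<Longrightarrow> f x = Y) \<Longrightarrow> (\<Union>x\<in>X. f x) = Y"
  by auto

lemma cl_smult: assumes x: "x \<in> carrier A" shows "c \<odot>\<^bsub>T\<^esub> cl x = cl (c \<odot> x)"
proof -
  have "(\<Union>y\<in>cl x. cl (c \<odot> y)) = cl (c \<odot> x)"
  proof (rule UN_const)
    show "cl x \<noteq> {}" using self_in_cl[OF x] by blast
    fix y assume "y \<in> cl x"
    then show "cl (c \<odot> y) = cl (c \<odot> x)"
      using in_cl[OF x, of y] x smult_in_I by (subst cl_eq_iff) (auto simp: smult_minus)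
  qed
  then show ?thesis by (simp add: star_quot_def)
qed

lemma star_a_inv: assumes "x \<in> carrier A" shows "star A (\<ominus> x) = \<ominus> (star A x)"
proof -
  have z: "star A \<zero> = \<zero>"
    by (metis M.zero_closed M.r_zero M.add.r_cancel_one' star_add star_closed)
  have "star A x \<oplus> star A (\<ominus> x) = \<zero>"
    using assms by (simp add: star_add[symmetric] M.r_neg z)
  then show ?thesis using assms
    by (metis M.a_inv_closed M.minus_equality M.a_comm star_closed)
qed

lemma cl_star:
  assumes "x \<in> carrier A" and I: "\<And>y. y \<in> I \<Longrightarrow> star A y \<in> I"
  shows "star T (cl x) = cl (star A x)"
proof -
  have "(\<Union>y\<in>cl x. cl (star A y)) = cl (star A x)"
  proof (rule UN_const)
    show "cl x \<noteq> {}" using self_in_cl[OF assms(1)] by blast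
    fix y assume "y \<in> cl x"
    then have y: "y \<in> carrier A" "star A (y \<ominus> x) \<in> I"
      using in_cl[OF assms(1), of y] assms by auto
    then have "star A y \<ominus> star A x \<in> I"
      using assms by (simp add: a_minus_def star_add star_a_inv)
    then show "cl (star A y) = cl (star A x)"
      using assms y by (subst cl_eq_iff) (auto simp: star_closed)
  qed
  then show ?thesis by (simp add: star_quot_def)
qed

lemma cl_finsum:
  assumes "finite S" "f \<in> S \<rightarrow> carrier A"
  shows "(\<Oplus>\<^bsub>T\<^esub>i\<in>S. cl (f i)) = cl (\<Oplus>i\<in>S. f i)"
proof -
  interpret T: ring T by (rule ring_T)
  show ?thesis using assms
  proof (induction S)
    case empty
    then show ?case by (simp add: cl_zero T_simps)
  next
    case (insert i S)
    then have "(\<Oplus>\<^bsub>T\<^esub>i\<in>insert i S. cl (f i)) = cl (f i) \<oplus>\<^bsub>T\<^esub> (\<Oplus>\<^bsub>T\<^esub>i\<in>S. cl (f i))"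
      by (intro T.finsum_insert) (auto intro!: cl_in_T)
    also have "\<dots> = cl (\<Oplus>i\<in>insert i S. f i)"
      using insert by (simp add: cl_add Pi_iff)
    finally show ?case .
  qed
qed

end

text \<open>The elements whose star falls into the generated ideal form an ideal themselves: the
  star reverses products, and the generated ideal absorbs factors on both sides.\<close>

lemma (in star_algebra) star_genideal:
  assumes S: "S \<subseteq> carrier A" "\<And>x. x \<in> S \<Longrightarrow> star A x \<in> Idl S" and "x \<in> Idl S"
  shows "star A x \<in> Idl S"
proof -
  interpret I: ideal "Idl S" A by (rule genideal_ideal[OF S(1)])
  interpret Q: star_quotient "Idl S" A by unfold_locales
  let ?J = "{x \<in> carrier A. star A x \<in> Idl S}"
  have "ideal ?J A"
  proof (rule idealI)
    show "ring A" by (rule A.ring_axioms)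
    show "subgroup ?J (add_monoid A)"
    proof (rule M.add.subgroupI)
      have "star A \<zero> = \<zero>"
        by (metis M.zero_closed M.r_zero M.add.r_cancel_one' star_add star_closed)
      then have "\<zero> \<in> ?J" by simp
      then show "?J \<noteq> {}" by blast
    qed (auto simp: star_add Q.star_a_inv)
  qed (auto simp: star_mult star_closed I.I_l_closed I.I_r_closed)
  then have "Idl S \<subseteq> ?J"
    using S unfolding genideal_def by auto
  then show ?thesis using assms(3) by auto
qed

context star_monoid begin

lemma a_inv_R: "f \<in> carrier R \<Longrightarrow> \<ominus>\<^bsub>R\<^esub> f = - f"
  using ring_R abelian_group.minus_equality[of R "- f" f]
  by (simp add: ring.is_abelian_group simps_R carrier_R in_keys_iff subset_iff)

lemma a_minus_R: "\<lbrakk>f \<in> carrier R; g \<in> carrier R\<rbrakk> \<Longrightarrow> f \<ominus>\<^bsub>R\<^esub> g = f - g"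
  by (simp add: a_minus_def a_inv_R simps_R)

end

section \<open>Tensor products as quotients of the monoid algebra of pairs\<close>

locale tensor_pair = A: star_algebra A + B: star_algebra B for A :: "'a star_alg" and B :: "'b star_alg"
begin

lemma star_monoid_prod: "star_monoid (A \<times>\<times> B) (map_prod (star A) (star B))"
  by (intro star_monoid.intro DirProd_monoid A.A.monoid_axioms B.A.monoid_axioms star_monoid_axioms.intro)
    (auto simp: A.star_closed B.star_closed A.star_star B.star_star A.star_mult B.star_mult)

sublocale P: star_monoid "A \<times>\<times> B" "map_prod (star A) (star B)"
  by (rule star_monoid_prod)

lemma free_prod_alg_eq: "free_prod_alg A B = P.R"
  by (simp add: free_prod_alg_def)

sublocale PA: star_algebra P.R
  by (rule P.star_algebra_R)

lemma single_pair_in_R: "\<lbrakk>x \<in> carrier A; y \<in> carrier B\<rbrakk> \<Longrightarrow> psingle (x, y) c \<in> carrier P.R"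
  by (rule P.single_in_R) simp

lemma diff_in_R: "\<lbrakk>f \<in> carrier P.R; g \<in> carrier P.R\<rbrakk> \<Longrightarrow> f - g \<in> carrier P.R"
  using PA.minus_closed P.a_minus_R by metis

lemma relators_in_R: "bilinear_relators A B \<subseteq> carrier P.R"
  unfolding bilinear_relators_def by (auto intro!: single_pair_in_R diff_in_R)

lemma star_diff_R: "\<lbrakk>f \<in> carrier P.R; g \<in> carrier P.R\<rbrakk> \<Longrightarrow> star P.R (f - g) = star P.R f - star P.R g"
  by (metis add_diff_cancel_right' diff_add_cancel P.star_add)

sublocale TI: ideal "tensor_ideal A B" P.R
  unfolding tensor_ideal_def free_prod_alg_eq by (rule PA.genideal_ideal[OF relators_in_R])

sublocale TQ: star_quotient "tensor_ideal A B" P.R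
  by unfold_locales

lemma tensor_alg_eq: "tensor_alg A B = TQ.T"
  by (simp add: tensor_alg_def free_prod_alg_eq)

lemma star_relator: assumes "f \<in> bilinear_relators A B" shows "star P.R f \<in> bilinear_relators A B"
proof -
  note st = star_diff_R single_pair_in_R diff_in_R P.star_single A.star_add B.star_add A.star_smult B.star_smult
  from assms consider
      x x' y where "f = psingle (x \<oplus>\<^bsub>A\<^esub> x', y) 1 - psingle (x, y) 1 - psingle (x', y) 1"
        "x \<in> carrier A" "x' \<in> carrier A" "y \<in> carrier B"
    | x y y' where "f = psingle (x, y \<oplus>\<^bsub>B\<^esub> y') 1 - psingle (x, y) 1 - psingle (x, y') 1"
        "x \<in> carrier A" "y \<in> carrier B" "y' \<in> carrier B"
    | c x y where "f = psingle (c \<odot>\<^bsub>A\<^esub> x, y) 1 - psingle (x, y) c" "x \<in> carrier A" "y \<in> carrier B"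
    | c x y where "f = psingle (x, c \<odot>\<^bsub>B\<^esub> y) 1 - psingle (x, y) c" "x \<in> carrier A" "y \<in> carrier B"
    unfolding bilinear_relators_def by blast
  then show ?thesis
  proof cases
    case 1
    then have "star P.R f = psingle (star A x \<oplus>\<^bsub>A\<^esub> star A x', star B y) 1
        - psingle (star A x, star B y) 1 - psingle (star A x', star B y) 1"
      by (simp add: st)
    with 1 A.star_closed B.star_closed show ?thesis unfolding bilinear_relators_def by blast
  next
    case 2
    then have "star P.R f = psingle (star A x, star B y \<oplus>\<^bsub>B\<^esub> star B y') 1
        - psingle (star A x, star B y) 1 - psingle (star A x, star B y') 1"
      by (simp add: st)
    with 2 A.star_closed B.star_closed show ?thesis unfolding bilinear_relators_def by blast
  next
    case 3
    then have "star P.R f = psingle (cnj c \<odot>\<^bsub>A\<^esub> star A x, star B y) 1 - psingle (star A x, star B y) (cnj c)"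
      by (simp add: st)
    with 3 A.star_closed B.star_closed show ?thesis unfolding bilinear_relators_def by blast
  next
    case 4
    then have "star P.R f = psingle (star A x, cnj c \<odot>\<^bsub>B\<^esub> star B y) 1 - psingle (star A x, star B y) (cnj c)"
      by (simp add: st)
    with 4 A.star_closed B.star_closed show ?thesis unfolding bilinear_relators_def by blast
  qed
qed

lemma star_tensor_ideal: assumes "f \<in> tensor_ideal A B" shows "star P.R f \<in> tensor_ideal A B"
  using assms unfolding tensor_ideal_def free_prod_alg_eq
  by (rule PA.star_genideal[OF relators_in_R, rotated])
    (use star_relator PA.genideal_self[OF relators_in_R] in blast)

lemma tensor_elt_eq: "tensor_elt A B x y = TQ.cl (psingle (x, y) 1)"
  by (simp add: tensor_elt_def free_prod_alg_eq)

text \<open>\<open>\<phi> (x, y) c\<close> plays the part of \<open>c\<close> times the value of a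
  bilinear map at \<open>(x, y)\<close>. Bilinearity is asked only up to \<open>W\<close>, because
  the maps in use choose representatives in the free algebra and are linear only modulo an
  ideal.\<close>

definition bilinear_mod :: "'v::ab_group_add set \<Rightarrow> ('a \<times> 'b \<Rightarrow> complex \<Rightarrow> 'v) \<Rightarrow> bool" where
  "bilinear_mod W \<phi> \<longleftrightarrow> (\<forall>p. \<phi> p 0 = 0) \<and> (\<forall>p a b. \<phi> p (a + b) = \<phi> p a + \<phi> p b) \<and>
    (\<forall>x\<in>carrier A. \<forall>x'\<in>carrier A. \<forall>y\<in>carrier B. \<forall>c.
       \<phi> (x \<oplus>\<^bsub>A\<^esub> x', y) c - \<phi> (x, y) c - \<phi> (x', y) c \<in> W) \<and>
    (\<forall>x\<in>carrier A. \<forall>y\<in>carrier B. \<forall>y'\<in>carrier B. \<forall>c.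
       \<phi> (x, y \<oplus>\<^bsub>B\<^esub> y') c - \<phi> (x, y) c - \<phi> (x, y') c \<in> W) \<and>
    (\<forall>x\<in>carrier A. \<forall>y\<in>carrier B. \<forall>c d. \<phi> (d \<odot>\<^bsub>A\<^esub> x, y) c - \<phi> (x, y) (c * d) \<in> W) \<and>
    (\<forall>x\<in>carrier A. \<forall>y\<in>carrier B. \<forall>c d. \<phi> (x, d \<odot>\<^bsub>B\<^esub> y) c - \<phi> (x, y) (c * d) \<in> W)"

lemma bilinear_mod_mult_left:
  assumes "bilinear_mod W \<phi>" "a \<in> carrier A" "b \<in> carrier B"
  shows "bilinear_mod W (\<lambda>p c. \<phi> ((a, b) \<otimes>\<^bsub>A \<times>\<times> B\<^esub> p) (d * c))"
  using assms unfolding bilinear_mod_def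
  by (simp add: A.r_distr B.r_distr A.smult_mult_right B.smult_mult_right distrib_left mult.assoc[symmetric])

lemma bilinear_mod_mult_right:
  assumes "bilinear_mod W \<phi>" "a \<in> carrier A" "b \<in> carrier B"
  shows "bilinear_mod W (\<lambda>p c. \<phi> (p \<otimes>\<^bsub>A \<times>\<times> B\<^esub> (a, b)) (d * c))"
  using assms unfolding bilinear_mod_def
  by (simp add: A.l_distr B.l_distr A.smult_mult_left B.smult_mult_left distrib_left mult.assoc[symmetric])

lemma lin_mult_left:
  assumes "\<And>p. \<phi> p 0 = 0" "\<And>p a b. \<phi> p (a + b) = \<phi> p a + \<phi> p b" and f: "f \<in> carrier P.R"
  shows "lin \<phi> (psingle q d \<otimes>\<^bsub>P.R\<^esub> f) = lin (\<lambda>p c. \<phi> (q \<otimes>\<^bsub>A \<times>\<times> B\<^esub> p) (d * c)) f"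
  using f
proof (induction f rule: P.R_induct)
  case (add f g)
  have "lin (\<lambda>p c. \<phi> (q \<otimes>\<^bsub>A \<times>\<times> B\<^esub> p) (d * c)) (f + g)
      = lin (\<lambda>p c. \<phi> (q \<otimes>\<^bsub>A \<times>\<times> B\<^esub> p) (d * c)) f + lin (\<lambda>p c. \<phi> (q \<otimes>\<^bsub>A \<times>\<times> B\<^esub> p) (d * c)) g"
    by (rule lin_add) (simp_all add: assms distrib_left)
  then show ?case using add by (simp add: P.R_simps lin_add[of \<phi>] assms)
qed (simp_all add: P.R_simps lin_single assms)

lemma lin_mult_right:
  assumes "\<And>p. \<phi> p 0 = 0" "\<And>p a b. \<phi> p (a + b) = \<phi> p a + \<phi> p b" and f: "f \<in> carrier P.R"
  shows "lin \<phi> (f \<otimes>\<^bsub>P.R\<^esub> psingle q d) = lin (\<lambda>p c. \<phi> (p \<otimes>\<^bsub>A \<times>\<times> B\<^esub> q) (d * c)) f"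
  using f
proof (induction f rule: P.R_induct)
  case (add f g)
  have "lin (\<lambda>p c. \<phi> (p \<otimes>\<^bsub>A \<times>\<times> B\<^esub> q) (d * c)) (f + g)
      = lin (\<lambda>p c. \<phi> (p \<otimes>\<^bsub>A \<times>\<times> B\<^esub> q) (d * c)) f + lin (\<lambda>p c. \<phi> (p \<otimes>\<^bsub>A \<times>\<times> B\<^esub> q) (d * c)) g"
    by (rule lin_add) (simp_all add: assms distrib_left)
  then show ?case using add by (simp add: P.R_simps lin_add[of \<phi>] assms)
qed (simp_all add: P.R_simps lin_single assms mult.commute)

text \<open>Quantifying over all bilinear maps makes the vanishing condition an ideal.\<close>

lemma tensor_ideal_lin:
  fixes \<phi> :: "'a \<times> 'b \<Rightarrow> complex \<Rightarrow> 'v::ab_group_add"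
  assumes W: "0 \<in> W" "\<And>x y. x \<in> W \<Longrightarrow> y \<in> W \<Longrightarrow> x + y \<in> W" "\<And>x. x \<in> W \<Longrightarrow> - x \<in> W"
    and \<phi>: "bilinear_mod W \<phi>" and f: "f \<in> tensor_ideal A B"
  shows "lin \<phi> f \<in> W"
proof -
  define J where "J = {f \<in> carrier P.R. \<forall>\<phi>. bilinear_mod W \<phi> \<longrightarrow> lin \<phi> f \<in> W}"
  have 0: "bilinear_mod W \<psi> \<Longrightarrow> \<psi> p 0 = 0" "bilinear_mod W \<psi> \<Longrightarrow> \<psi> p (a + b) = \<psi> p a + \<psi> p b" for \<psi> p a b
    by (simp_all add: bilinear_mod_def del: split_paired_All)
  have lin_a: "bilinear_mod W \<psi> \<Longrightarrow> lin \<psi> (f + g) = lin \<psi> f + lin \<psi> g" for \<psi> f g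
    by (rule lin_add) (auto simp: 0)
  have lin_m: "bilinear_mod W \<psi> \<Longrightarrow> lin \<psi> (f - g) = lin \<psi> f - lin \<psi> g" for \<psi> f g
    by (rule lin_minus) (auto simp: 0)
  have lin_s: "bilinear_mod W \<psi> \<Longrightarrow> lin \<psi> (psingle p c) = \<psi> p c" for \<psi> p c
    by (rule lin_single) (auto simp: 0)
  have "ideal J P.R"
  proof (rule idealI)
    show "ring P.R" by (rule P.ring_R)
    show "subgroup J (add_monoid P.R)"
    proof (rule PA.M.add.subgroupI)
      have "0 \<in> J" using W by (simp add: J_def P.zero_in_R)
      then show "J \<noteq> {}" by blast
      fix f assume f: "f \<in> J"
      have "lin \<psi> (- f) = - lin \<psi> f" if "bilinear_mod W \<psi>" for \<psi>
        using lin_m[OF that, of 0 f] by simp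
      then show "\<ominus>\<^bsub>P.R\<^esub> f \<in> J"
        using f W(3) PA.M.a_inv_closed[of f] by (simp add: J_def P.a_inv_R)
    qed (auto simp: J_def P.simps_R lin_a W P.add_in_R)
  next
    fix f g assume f: "f \<in> J" and g: "g \<in> carrier P.R"
    have "lin \<psi> (g \<otimes>\<^bsub>P.R\<^esub> f) \<in> W" if \<psi>: "bilinear_mod W \<psi>" for \<psi>
      using g
    proof (induction g rule: P.R_induct)
      case (single p d)
      then have "bilinear_mod W (\<lambda>q c. \<psi> (p \<otimes>\<^bsub>A \<times>\<times> B\<^esub> q) (d * c))"
        using bilinear_mod_mult_left[OF \<psi>] by (cases p) auto
      moreover have "lin \<psi> (psingle p d \<otimes>\<^bsub>P.R\<^esub> f) = lin (\<lambda>q c. \<psi> (p \<otimes>\<^bsub>A \<times>\<times> B\<^esub> q) (d * c)) f"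
        by (rule lin_mult_left) (use 0 \<psi> f in \<open>auto simp: J_def\<close>)
      ultimately show ?case using f by (auto simp: J_def)
    qed (auto simp: P.R_simps W lin_a[OF \<psi>])
    then show "g \<otimes>\<^bsub>P.R\<^esub> f \<in> J"
      using f g by (auto simp: J_def P.mult_in_R)
    have "lin \<psi> (f \<otimes>\<^bsub>P.R\<^esub> g) \<in> W" if \<psi>: "bilinear_mod W \<psi>" for \<psi>
      using g
    proof (induction g rule: P.R_induct)
      case (single p d)
      then have "bilinear_mod W (\<lambda>q c. \<psi> (q \<otimes>\<^bsub>A \<times>\<times> B\<^esub> p) (d * c))"
        using bilinear_mod_mult_right[OF \<psi>] by (cases p) auto
      moreover have "lin \<psi> (f \<otimes>\<^bsub>P.R\<^esub> psingle p d) = lin (\<lambda>q c. \<psi> (q \<otimes>\<^bsub>A \<times>\<times> B\<^esub> p) (d * c)) f"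
        by (rule lin_mult_right) (use 0 \<psi> f in \<open>auto simp: J_def\<close>)
      ultimately show ?case using f by (auto simp: J_def)
    qed (auto simp: P.R_simps W lin_a[OF \<psi>])
    then show "f \<otimes>\<^bsub>P.R\<^esub> g \<in> J"
      using f g by (auto simp: J_def P.mult_in_R)
  qed
  moreover have "bilinear_relators A B \<subseteq> J"
  proof
    fix f assume f: "f \<in> bilinear_relators A B"
    have "lin \<psi> f \<in> W" if \<psi>: "bilinear_mod W \<psi>" for \<psi>
    proof -
      have "\<psi> (d \<odot>\<^bsub>A\<^esub> x, y) 1 - \<psi> (x, y) d \<in> W" "\<psi> (x, d \<odot>\<^bsub>B\<^esub> y) 1 - \<psi> (x, y) d \<in> W"
        if "x \<in> carrier A" "y \<in> carrier B" for x y d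
        using \<psi> that unfolding bilinear_mod_def by (metis mult_1)+
      moreover have "\<psi> (x \<oplus>\<^bsub>A\<^esub> x', y) 1 - \<psi> (x, y) 1 - \<psi> (x', y) 1 \<in> W"
        if "x \<in> carrier A" "x' \<in> carrier A" "y \<in> carrier B" for x x' y
        using \<psi> that unfolding bilinear_mod_def by blast
      moreover have "\<psi> (x, y \<oplus>\<^bsub>B\<^esub> y') 1 - \<psi> (x, y) 1 - \<psi> (x, y') 1 \<in> W"
        if "x \<in> carrier A" "y \<in> carrier B" "y' \<in> carrier B" for x y y'
        using \<psi> that unfolding bilinear_mod_def by blast
      ultimately show ?thesis using f unfolding bilinear_relators_def
        by (auto simp: lin_m[OF \<psi>] lin_s[OF \<psi>])
    qed
    then show "f \<in> J" using f relators_in_R by (auto simp: J_def)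
  qed
  ultimately have "tensor_ideal A B \<subseteq> J"
    unfolding tensor_ideal_def free_prod_alg_eq genideal_def by auto
  then show ?thesis using f \<phi> by (auto simp: J_def)
qed

end

section \<open>The free algebra as a ring in the type class sense\<close>

text \<open>With concatenation as addition of keys, \<open>Poly_Mapping\<close> supplies the ring structure.\<close>

instantiation list :: (type) monoid_add
begin
definition zero_list :: "'a list" where "zero_list = []"
definition plus_list :: "'a list \<Rightarrow> 'a list \<Rightarrow> 'a list" where "plus_list xs ys = xs @ ys"
instance by standard (auto simp: zero_list_def plus_list_def)
end

definition C :: "complex \<Rightarrow> 'w::monoid_add \<Rightarrow>\<^sub>0 complex" where
  "C c = psingle 0 c"

lemma C_simps: "C 0 = 0" "C 1 = 1" "C (a + b) = C a + C b" "C (a * b) = C a * C b"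
  "C (- a) = - C a" "C (a - b) = C a - C b"
  by (simp_all add: C_def single_add Poly_Mapping.mult_single single_uminus single_diff)

lemma C_sum: "C (\<Sum>i\<in>S. f i) = (\<Sum>i\<in>S. C (f i))"
  by (induction S rule: infinite_finite_induct) (simp_all add: C_simps)

lemma C_commute: "C c * x = x * C c"
  using subset_UNIV[of "pkeys x"]
  by (induction x rule: keys_add_single_induct)
    (simp_all add: C_def Poly_Mapping.mult_single algebra_simps)

lemma C_left_commute: "x * (C c * y) = C c * (x * y)"
  by (metis C_commute mult.assoc)

lemma scale_eq_C: "scl c x = C c * x"
  by (simp add: C_def mult_map_scale_conv_mult)

definition ext :: "('p \<Rightarrow> 'w::monoid_add \<Rightarrow>\<^sub>0 complex) \<Rightarrow> ('p \<Rightarrow>\<^sub>0 complex) \<Rightarrow> 'w \<Rightarrow>\<^sub>0 complex" where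
  "ext \<psi> = lin (\<lambda>p c. C c * \<psi> p)"

lemma ext_simps: "ext \<psi> 0 = 0" "ext \<psi> (f + g) = ext \<psi> f + ext \<psi> g"
  "ext \<psi> (psingle p c) = C c * \<psi> p" "ext \<psi> (f - g) = ext \<psi> f - ext \<psi> g"
  "ext \<psi> (\<Sum>i\<in>S. h i) = (\<Sum>i\<in>S. ext \<psi> (h i))"
  unfolding ext_def
  by (simp_all add: lin_add lin_minus lin_sum lin_single C_simps distrib_right)

lemma ext_scale: "ext \<psi> (C c * f) = C c * ext \<psi> f"
  using subset_UNIV[of "pkeys f"]
proof (induction f rule: keys_add_single_induct)
  case (single p a)
  have "C c * psingle p a = psingle p (c * a)"
    by (simp add: C_def Poly_Mapping.mult_single)
  then show ?case by (simp add: ext_simps C_simps mult.assoc)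
qed (simp_all add: ext_simps distrib_left)

lemma single_eq_C: "psingle w c = C c * psingle w 1"
  by (simp add: C_def Poly_Mapping.mult_single)

definition gen :: "'n \<Rightarrow> 'n \<Rightarrow> bool \<Rightarrow> 'n free_elt" where
  "gen i j b = psingle [(i, j, b)] 1"

text \<open>The matrix entry \<open>(I, J)\<close> of the tensor product
  \<open>u^\<epsilon>\<close>, in which the letter True stands for \<open>u^c\<close> and False for
  \<open>u\<close>.\<close>

definition co :: "bool list \<Rightarrow> 'n list \<Rightarrow> 'n list \<Rightarrow> 'n free_elt" where
  "co \<epsilon> I J = psingle (zip I (zip J \<epsilon>)) 1"

lemma co_Nil [simp]: "co [] [] [] = 1"
  unfolding co_def zip_Nil by (simp flip: zero_list_def)

lemma co_Cons [simp]: "co (b # \<epsilon>) (i # I) (j # J) = gen i j b * co \<epsilon> I J"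
  by (simp add: co_def gen_def Poly_Mapping.mult_single plus_list_def)

lemma co_append:
  "\<lbrakk>length I = length \<epsilon>; length J = length \<epsilon>\<rbrakk> \<Longrightarrow> co (\<epsilon> @ \<delta>) (I @ I') (J @ J') = co \<epsilon> I J * co \<delta> I' J'"
  by (simp add: co_def Poly_Mapping.mult_single plus_list_def)

text \<open>Every monomial is itself a matrix coefficient of a word, so what is proved for
  coefficients reaches the whole free algebra by linearity.\<close>

lemma single_eq_co: "psingle w 1 = co (map (snd \<circ> snd) w) (map fst w) (map (fst \<circ> snd) w)"
  unfolding co_def by (rule arg_cong[where f = "\<lambda>w. psingle w 1"], induction w) auto

subsection \<open>Sums over lists of fixed length\<close>

definition L :: "nat \<Rightarrow> 'n::finite list set" where
  "L k = {I. length I = k}"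

abbreviation (input) Lw :: "bool list \<Rightarrow> 'n::finite list set" where
  "Lw \<epsilon> \<equiv> L (length \<epsilon>)"

lemma in_L_iff: "I \<in> L k \<longleftrightarrow> length I = k"
  by (simp_all add: L_def)

lemma L_0 [simp]: "L 0 = {[]}"
  by (auto simp: L_def)

lemma finite_L [simp]: "finite (L k)"
  using finite_lists_length_eq[of "UNIV :: 'a set" k] by (simp add: L_def)

lemma sum_L_append: "(\<Sum>J\<in>L (a + b). f J) = (\<Sum>J\<in>L a. \<Sum>J'\<in>L b. f (J @ J'))"
proof -
  have "(\<Sum>p\<in>L a \<times> L b. f (fst p @ snd p)) = (\<Sum>J\<in>L (a + b). f J)"
    by (rule sum.reindex_bij_witness[of _ "\<lambda>J. (take a J, drop a J)" "\<lambda>p. fst p @ snd p"])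
      (auto simp: L_def)
  then show ?thesis by (simp add: sum.cartesian_product split_def)
qed

lemma sum_L_Suc: "(\<Sum>J\<in>L (Suc k). f J) = (\<Sum>j\<in>UNIV. \<Sum>J\<in>L k. f (j # J))"
proof -
  have "(\<Sum>p\<in>UNIV \<times> L k. f (fst p # snd p)) = (\<Sum>J\<in>L (Suc k). f J)"
    by (rule sum.reindex_bij_witness[of _ "\<lambda>J. (hd J, tl J)" "\<lambda>p. fst p # snd p"])
      (auto simp: L_def length_Suc_conv)
  then show ?thesis by (simp add: sum.cartesian_product split_def)
qed

lemma L_appendE:
  assumes "J \<in> L (a + b)"
  obtains J1 J2 where "J = J1 @ J2" "J1 \<in> L a" "J2 \<in> L b"
  using assms by (intro that[of "take a J" "drop a J"]) (auto simp: L_def)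

lemma L_SucE:
  assumes "J \<in> L (Suc k)"
  obtains j J' where "J = j # J'" "J' \<in> L k"
  using assms by (auto simp: L_def length_Suc_conv)

subsection \<open>Congruence modulo a two-sided ideal\<close>

locale alg_ideal =
  fixes K :: "'r::ring_1 set"
  assumes zero_in: "0 \<in> K" and add_in: "\<lbrakk>x \<in> K; y \<in> K\<rbrakk> \<Longrightarrow> x + y \<in> K"
    and left_in: "x \<in> K \<Longrightarrow> a * x \<in> K" and right_in: "x \<in> K \<Longrightarrow> x * a \<in> K"
begin

definition eqv :: "'r \<Rightarrow> 'r \<Rightarrow> bool" (infix "\<approx>\<^sub>I" 50) where
  "x \<approx>\<^sub>I y \<longleftrightarrow> x - y \<in> K"

lemma minus_in: "x \<in> K \<Longrightarrow> - x \<in> K"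
  using left_in[of x "-1"] by simp

lemma sum_in: "(\<And>i. i \<in> S \<Longrightarrow> f i \<in> K) \<Longrightarrow> (\<Sum>i\<in>S. f i) \<in> K"
  by (induction S rule: infinite_finite_induct) (auto simp: zero_in add_in)

lemma eqv_refl [simp]: "x \<approx>\<^sub>I x"
  by (simp add: eqv_def zero_in)

lemma eqv_sym: "x \<approx>\<^sub>I y \<Longrightarrow> y \<approx>\<^sub>I x"
  using minus_in[of "x - y"] by (simp add: eqv_def)

lemma eqv_trans [trans]: "\<lbrakk>x \<approx>\<^sub>I y; y \<approx>\<^sub>I z\<rbrakk> \<Longrightarrow> x \<approx>\<^sub>I z"
  using add_in[of "x - y" "y - z"] by (simp add: eqv_def)

lemma eqv_add: "\<lbrakk>x \<approx>\<^sub>I x'; y \<approx>\<^sub>I y'\<rbrakk> \<Longrightarrow> x + y \<approx>\<^sub>I x' + y'"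
  using add_in[of "x - x'" "y - y'"] by (simp add: eqv_def algebra_simps)

lemma eqv_mult: assumes "x \<approx>\<^sub>I y" "x' \<approx>\<^sub>I y'" shows "x * x' \<approx>\<^sub>I y * y'"
proof -
  have "x * x' - y * y' = (x - y) * x' + y * (x' - y')"
    by (simp add: algebra_simps)
  then show ?thesis using assms unfolding eqv_def by (simp only: add_in left_in right_in)
qed

lemma eqv_mult_left: "x \<approx>\<^sub>I y \<Longrightarrow> a * x \<approx>\<^sub>I a * y"
  by (rule eqv_mult) simp_all

lemma eqv_mult_right: "x \<approx>\<^sub>I y \<Longrightarrow> x * a \<approx>\<^sub>I y * a"
  by (rule eqv_mult) simp_all

lemma eqv_sum: "(\<And>i. i \<in> S \<Longrightarrow> f i \<approx>\<^sub>I g i) \<Longrightarrow> (\<Sum>i\<in>S. f i) \<approx>\<^sub>I (\<Sum>i\<in>S. g i)"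
  unfolding eqv_def by (simp add: sum_in flip: sum_subtractf)

lemma eqv_0: "x \<approx>\<^sub>I 0 \<longleftrightarrow> x \<in> K"
  by (simp add: eqv_def)

end

subsection \<open>The relations of a unitary matrix and of its twisted conjugate\<close>

text \<open>The last two relations say that \<open>u\<^sup>c M u\<^sup>T = M\<close> and \<open>u\<^sup>T M\<^sup>-\<^sup>1 u\<^sup>c = M\<^sup>-\<^sup>1\<close>, with \<open>N\<close> in the
  role of \<open>M\<^sup>-\<^sup>1\<close>.\<close>

locale rel_ideal = alg_ideal K for K :: "'n::finite free_elt set" +
  fixes M N :: "complex^'n^'n"
  assumes MN: "M ** N = mat 1" and NM: "N ** M = mat 1"
    and rel1: "(\<Sum>k\<in>UNIV. gen i k False * gen j k True) \<approx>\<^sub>I (if i = j then 1 else 0)"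
    and rel2: "(\<Sum>k\<in>UNIV. gen k i True * gen k j False) \<approx>\<^sub>I (if i = j then 1 else 0)"
    and rel3: "(\<Sum>k\<in>UNIV. \<Sum>l\<in>UNIV. gen i k True * gen j l False * C (M $ k $ l)) \<approx>\<^sub>I C (M $ i $ j)"
    and rel4: "(\<Sum>k\<in>UNIV. \<Sum>l\<in>UNIV. gen k i False * gen l j True * C (N $ k $ l)) \<approx>\<^sub>I C (N $ i $ j)"

text \<open>\<open>cup M False\<close> and \<open>cup M True\<close> are fixed vectors of \<open>u \<otimes> u\<^sup>c\<close> and of \<open>u\<^sup>c \<otimes> u\<close>.\<close>

definition cup :: "complex^'n^'n \<Rightarrow> bool \<Rightarrow> 'n \<Rightarrow> 'n \<Rightarrow> complex" where
  "cup M c i j = (if c then M $ i $ j else if i = j then 1 else 0)"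

text \<open>Insertion of a cup at the positions \<open>m\<close> and \<open>m + 1\<close>.\<close>

primrec ins :: "complex^'n^'n \<Rightarrow> bool \<Rightarrow> nat \<Rightarrow> ('n list \<Rightarrow> complex) \<Rightarrow> 'n list \<Rightarrow> complex" where
  "ins M c 0 \<xi> = (\<lambda>J. cup M c (J ! 0) (J ! 1) * \<xi> (drop 2 J))"
| "ins M c (Suc m) \<xi> = (\<lambda>J. ins M c m (\<lambda>J'. \<xi> (hd J # J')) (tl J))"

text \<open>The ideal is a parameter, so that one and the same vector can be tested in two quotients
  of the free algebra.\<close>

definition fixed_vec :: "'n::finite free_elt set \<Rightarrow> bool list \<Rightarrow> ('n list \<Rightarrow> complex) \<Rightarrow> bool" where
  "fixed_vec K \<epsilon> \<xi> \<longleftrightarrow> (\<forall>I\<in>Lw \<epsilon>.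
     alg_ideal.eqv K (\<Sum>J\<in>Lw \<epsilon>. co \<epsilon> I J * C (\<xi> J)) (C (\<xi> I)))"

abbreviation (in rel_ideal) "fixv \<equiv> fixed_vec K"

context rel_ideal begin

lemma cup_fixed:
  "(\<Sum>j\<in>UNIV. \<Sum>k\<in>UNIV. gen i j c * gen i' k (\<not> c) * C (cup M c j k)) \<approx>\<^sub>I C (cup M c i i')"
proof (cases c)
  case True
  then show ?thesis using rel3[of i i'] by (simp add: cup_def)
next
  case False
  have "(\<Sum>k\<in>UNIV. gen i j False * gen i' k True * C (cup M False j k)) = gen i j False * gen i' j True" for j
  proof -
    have "(\<Sum>k\<in>UNIV. gen i j False * gen i' k True * C (cup M False j k))
        = (\<Sum>k\<in>UNIV. if k = j then gen i j False * gen i' k True else 0)"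
      by (rule sum.cong) (auto simp: cup_def C_simps)
    then show ?thesis by simp
  qed
  then have "(\<Sum>j\<in>UNIV. \<Sum>k\<in>UNIV. gen i j c * gen i' k (\<not> c) * C (cup M c j k))
      = (\<Sum>j\<in>UNIV. gen i j False * gen i' j True)" using False by simp
  moreover have "(C (cup M c i i') :: 'n free_elt) = (if i = i' then 1 else 0)"
    using False by (simp add: cup_def C_simps)
  ultimately show ?thesis using rel1[of i i'] by simp
qed

text \<open>The letters in front of the cup only multiply from the left, so induction strips them
  until the cup stands first, where \<open>cup_fixed\<close> sums it out and leaves a central
  scalar.\<close>

lemma ins_fixed_aux:
  assumes "I1 \<in> Lw \<alpha>" "I2 \<in> Lw \<beta>"
  shows "(\<Sum>J\<in>L (length (\<alpha> @ [c, \<not> c] @ \<beta>)).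
        co (\<alpha> @ [c, \<not> c] @ \<beta>) (I1 @ [i, i'] @ I2) J * C (ins M c (length \<alpha>) \<xi> J))
     \<approx>\<^sub>I C (cup M c i i') * (\<Sum>J\<in>L (length (\<alpha> @ \<beta>)). co (\<alpha> @ \<beta>) (I1 @ I2) J * C (\<xi> J))"
  using assms(1)
proof (induction \<alpha> arbitrary: I1 \<xi>)
  case Nil
  have "(\<Sum>J\<in>L (length ([] @ [c, \<not> c] @ \<beta>)).
        co ([] @ [c, \<not> c] @ \<beta>) (I1 @ [i, i'] @ I2) J * C (ins M c (length []) \<xi> J))
     = (\<Sum>j\<in>UNIV. \<Sum>k\<in>UNIV. \<Sum>J\<in>Lw \<beta>.
          (gen i j c * gen i' k (\<not> c) * C (cup M c j k)) * (co \<beta> I2 J * C (\<xi> J)))"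
    using Nil by (simp add: sum_L_Suc C_simps mult.assoc C_left_commute[of "co _ _ _"] C_left_commute[of "gen _ _ _"])
  also have "\<dots> = (\<Sum>j\<in>UNIV. \<Sum>k\<in>UNIV. gen i j c * gen i' k (\<not> c) * C (cup M c j k))
      * (\<Sum>J\<in>Lw \<beta>. co \<beta> I2 J * C (\<xi> J))"
    by (simp only: sum_distrib_right) (simp only: sum_distrib_left)
  also have "\<dots> \<approx>\<^sub>I C (cup M c i i') * (\<Sum>J\<in>Lw \<beta>. co \<beta> I2 J * C (\<xi> J))"
    by (rule eqv_mult_right[OF cup_fixed])
  finally show ?case using Nil by simp
next
  case (Cons b \<alpha>)
  obtain k I1' where I1: "I1 = k # I1'" "I1' \<in> Lw \<alpha>"
    using Cons.prems by (auto elim: L_SucE)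
  have "(\<Sum>j\<in>UNIV. gen k j b * (\<Sum>J\<in>L (length (\<alpha> @ [c, \<not> c] @ \<beta>)).
          co (\<alpha> @ [c, \<not> c] @ \<beta>) (I1' @ [i, i'] @ I2) J * C (ins M c (length \<alpha>) (\<lambda>J'. \<xi> (j # J')) J)))
     \<approx>\<^sub>I (\<Sum>j\<in>UNIV. gen k j b * (C (cup M c i i') *
          (\<Sum>J\<in>L (length (\<alpha> @ \<beta>)). co (\<alpha> @ \<beta>) (I1' @ I2) J * C (\<xi> (j # J)))))"
    by (intro eqv_sum eqv_mult_left Cons.IH I1)
  moreover have "(\<Sum>j\<in>UNIV. gen k j b * (C (cup M c i i') * (\<Sum>J\<in>L (length (\<alpha> @ \<beta>)).
      co (\<alpha> @ \<beta>) (I1' @ I2) J * C (\<xi> (j # J)))))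
    = C (cup M c i i') * (\<Sum>j\<in>UNIV. \<Sum>J\<in>L (length (\<alpha> @ \<beta>)).
        gen k j b * (co (\<alpha> @ \<beta>) (I1' @ I2) J * C (\<xi> (j # J))))"
    unfolding C_left_commute[of "gen k _ b"] by (simp only: sum_distrib_left)
  moreover have "length ((b # \<alpha>) @ \<delta>) = Suc (length (\<alpha> @ \<delta>))" for \<delta> by simp
  ultimately show ?case
    unfolding I1(1) by (simp only: sum_L_Suc append_Cons co_Cons mult.assoc sum_distrib_left
      list.size(4) add_Suc_right add_0_right ins.simps list.sel)
qed

lemma ins_fixed:
  assumes "fixv (\<alpha> @ \<beta>) \<xi>"
  shows "fixv (\<alpha> @ [c, \<not> c] @ \<beta>) (ins M c (length \<alpha>) \<xi>)"
  unfolding fixed_vec_def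
proof
  have ins: "ins M c m \<xi> ((I1 :: 'n list) @ [i, i'] @ I2) = cup M c i i' * \<xi> (I1 @ I2)" if "I1 \<in> L m" for m I1 I2 i i' \<xi>
    using that by (induction m arbitrary: I1 \<xi>) (auto elim!: L_SucE)
  fix I :: "'n list" assume "I \<in> L (length (\<alpha> @ [c, \<not> c] @ \<beta>))"
  then have "I \<in> L (length \<alpha> + (Suc (Suc (length \<beta>))))"
    by simp
  then obtain I1 I3 where "I = I1 @ I3" "I1 \<in> Lw \<alpha>" "I3 \<in> L (Suc (Suc (length \<beta>)))"
    by (rule L_appendE)
  then obtain i i' I2 where I: "I = I1 @ [i, i'] @ I2" "I1 \<in> Lw \<alpha>" "I2 \<in> Lw \<beta>"
    by (auto elim!: L_SucE)
  have I': "I1 @ I2 \<in> L (length (\<alpha> @ \<beta>))"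
    using I by (simp add: in_L_iff)
  have "(\<Sum>J\<in>L (length (\<alpha> @ [c, \<not> c] @ \<beta>)). co (\<alpha> @ [c, \<not> c] @ \<beta>) I J * C (ins M c (length \<alpha>) \<xi> J))
     \<approx>\<^sub>I C (cup M c i i') * (\<Sum>J\<in>L (length (\<alpha> @ \<beta>)). co (\<alpha> @ \<beta>) (I1 @ I2) J * C (\<xi> J))"
    unfolding I(1) by (rule ins_fixed_aux[OF I(2,3)])
  also have "\<dots> \<approx>\<^sub>I C (cup M c i i') * C (\<xi> (I1 @ I2))"
    by (rule eqv_mult_left) (use assms I' in \<open>simp add: fixed_vec_def\<close>)
  also have "\<dots> = C (ins M c (length \<alpha>) \<xi> I)"
    unfolding I(1) by (simp only: ins[OF I(2)] C_simps)
  finally show "(\<Sum>J\<in>L (length (\<alpha> @ [c, \<not> c] @ \<beta>)). co (\<alpha> @ [c, \<not> c] @ \<beta>) I J * C (ins M c (length \<alpha>) \<xi> J))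
     \<approx>\<^sub>I C (ins M c (length \<alpha>) \<xi> I)" .
qed

text \<open>This is where the fourth relation enters.\<close>

lemma letter_right_inverse: "\<exists>W. \<forall>k m. (\<Sum>i\<in>UNIV. gen i k b * W i m) \<approx>\<^sub>I (if k = m then 1 else 0)"
proof (cases b)
  case True
  then show ?thesis using rel2 by (intro exI[of _ "\<lambda>i m. gen i m False"]) auto
next
  case False
  \<comment> \<open>This is the matrix \<open>N u^c M\<close>: the fourth relation turns
    \<open>u^T N u^c\<close> into \<open>N\<close>, and \<open>N M = 1\<close>.\<close>
  let ?W = "\<lambda>i m. \<Sum>l\<in>UNIV. \<Sum>j\<in>UNIV. gen l j True * C (N $ i $ l * M $ j $ m)"
  have "(\<Sum>i\<in>UNIV. gen i k False * ?W i m) \<approx>\<^sub>I (if k = m then 1 else 0)" for k m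
  proof -
    have "(\<Sum>i\<in>UNIV. gen i k False * ?W i m)
        = (\<Sum>j\<in>UNIV. C (M $ j $ m) * (\<Sum>i\<in>UNIV. \<Sum>l\<in>UNIV. gen i k False * gen l j True * C (N $ i $ l)))"
      (is "?l = ?r")
    proof -
      have "?l = (\<Sum>i\<in>UNIV. \<Sum>l\<in>UNIV. \<Sum>j\<in>UNIV. C (M $ j $ m) * (gen i k False * gen l j True * C (N $ i $ l)))"
        by (simp add: sum_distrib_left C_simps mult.assoc C_commute[of "M $ _ $ _"])
      also have "\<dots> = (\<Sum>i\<in>UNIV. \<Sum>j\<in>UNIV. \<Sum>l\<in>UNIV. C (M $ j $ m) * (gen i k False * gen l j True * C (N $ i $ l)))"
        by (rule sum.cong[OF refl], rule sum.swap)
      also have "\<dots> = ?r"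
        by (subst sum.swap) (simp add: sum_distrib_left)
      finally show ?thesis .
    qed
    also have "\<dots> \<approx>\<^sub>I (\<Sum>j\<in>UNIV. C (M $ j $ m) * C (N $ k $ j))"
      by (intro eqv_sum eqv_mult_left rel4)
    also have "\<dots> = C ((N ** M) $ k $ m)"
      by (simp add: matrix_matrix_mult_def C_sum mult.commute flip: C_simps(4))
    also have "\<dots> = (if k = m then 1 else 0)"
      by (simp add: NM mat_def C_simps)
    finally show ?thesis .
  qed
  then show ?thesis using False by (intro exI[of _ ?W]) auto
qed

text \<open>Entries do not commute, so the inverse of the tail has to precede that of the head: the
  sum over the tail then collapses to a scalar, and the head meets its own inverse.\<close>

lemma word_right_inverse:
  "\<exists>W. \<forall>k\<in>Lw \<epsilon>. \<forall>m\<in>Lw \<epsilon>.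
     (\<Sum>i\<in>Lw \<epsilon>. co \<epsilon> i k * W i m) \<approx>\<^sub>I (if k = m then 1 else 0)"
proof (induction \<epsilon>)
  case Nil
  show ?case by (intro exI[of _ "\<lambda>i m. 1"]) simp
next
  case (Cons b \<epsilon>)
  obtain W where W: "\<And>k m. k \<in> Lw \<epsilon> \<Longrightarrow> m \<in> Lw \<epsilon> \<Longrightarrow>
     (\<Sum>i\<in>Lw \<epsilon>. co \<epsilon> i k * W i m) \<approx>\<^sub>I (if k = m then 1 else 0)" using Cons by blast
  obtain V where V: "\<And>k m. (\<Sum>i\<in>UNIV. gen i k b * V i m) \<approx>\<^sub>I (if k = m then 1 else 0)"
    using letter_right_inverse by blast
  have *: "(\<Sum>i\<in>L (Suc (length \<epsilon>)). co (b # \<epsilon>) i (k # K) * (W (tl i) M * V (hd i) m))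
      \<approx>\<^sub>I (if k # K = m # M then 1 else 0)"
    if "K \<in> Lw \<epsilon>" "M \<in> Lw \<epsilon>" for k K m M
  proof -
    have *: "(\<Sum>i\<in>L (Suc (length \<epsilon>)). co (b # \<epsilon>) i (k # K) * (W (tl i) M * V (hd i) m))
        = (\<Sum>i\<in>UNIV. gen i k b * (\<Sum>I\<in>Lw \<epsilon>. co \<epsilon> I K * W I M) * V i m)"
      by (simp add: sum_L_Suc sum_distrib_left sum_distrib_right mult.assoc)
    also have "\<dots> \<approx>\<^sub>I (\<Sum>i\<in>UNIV. gen i k b * (if K = M then 1 else 0) * V i m)"
      by (intro eqv_sum eqv_mult_left eqv_mult_right W that)
    also have "\<dots> = (if K = M then 1 else 0) * (\<Sum>i\<in>UNIV. gen i k b * V i m)"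
      by simp
    also have "\<dots> \<approx>\<^sub>I (if K = M then 1 else 0) * (if k = m then 1 else 0)"
      by (intro eqv_mult_left V)
    finally show ?thesis by (simp split: if_splits)
  qed
  show ?case
  proof (intro exI[of _ "\<lambda>i m. W (tl i) (tl m) * V (hd i) (hd m)"] ballI)
    fix k m :: "'n list" assume "k \<in> L (length (b # \<epsilon>))" "m \<in> L (length (b # \<epsilon>))"
    then obtain k1 K m1 M where "k = k1 # K" "m = m1 # M" "K \<in> Lw \<epsilon>" "M \<in> Lw \<epsilon>"
      by (auto elim!: L_SucE)
    then show "(\<Sum>i\<in>L (length (b # \<epsilon>)). co (b # \<epsilon>) i k * (W (tl i) (tl m) * V (hd i) (hd m)))
        \<approx>\<^sub>I (if k = m then 1 else 0)"
      using *[of K M k1 m1] by simp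
  qed
qed

end

section \<open>Noncrossing vectors\<close>

text \<open>\<open>nc M \<epsilon> s\<close> lists the vectors attached to the noncrossing pairings of the word
  \<open>map Not (rev s) @ \<epsilon>\<close> in which the first \<open>length s\<close> letters all open a pair: the word is read from
  left to right with the stack \<open>s\<close> of colours that close the pending pairs.\<close>

primrec nc :: "complex^'n^'n \<Rightarrow> bool list \<Rightarrow> bool list \<Rightarrow> ('n list \<Rightarrow> complex) list" where
  "nc M [] = (\<lambda>s. if s = [] then [\<lambda>_. 1] else [])"
| "nc M (c # \<epsilon>) = (\<lambda>s. nc M \<epsilon> ((\<not> c) # s) @
     (case s of [] \<Rightarrow> [] | c' # s' \<Rightarrow>
        if c' = c then map (ins M (\<not> c) (length s')) (nc M \<epsilon> s') else []))"

text \<open>Opening a pair moves the letter \<open>c\<close> from the unread word to the open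
  letters and leaves the whole word unchanged. Closing one places the cup \<open>\<not> c\<close>,
  \<open>c\<close> right behind the \<open>length s'\<close> letters that remain open, which is the
  situation of \<open>ins_fixed\<close>.\<close>

lemma (in rel_ideal) nc_fixed: "\<xi> \<in> set (nc M \<epsilon> s) \<Longrightarrow> fixv (map Not (rev s) @ \<epsilon>) \<xi>"
proof (induction \<epsilon> arbitrary: s \<xi>)
  case Nil
  then show ?case by (auto simp: fixed_vec_def C_simps split: if_splits)
next
  case (Cons c \<epsilon>)
  from Cons.prems consider "\<xi> \<in> set (nc M \<epsilon> ((\<not> c) # s))"
    | s' \<zeta> where "s = c # s'" "\<zeta> \<in> set (nc M \<epsilon> s')" "\<xi> = ins M (\<not> c) (length s') \<zeta>"
    by (auto split: list.splits if_splits)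
  then show ?case
  proof cases
    case 1
    then show ?thesis using Cons.IH[of \<xi> "(\<not> c) # s"] by simp
  next
    case 2
    then show ?thesis
      using ins_fixed[OF Cons.IH[OF 2(2)], of "\<not> c"] by simp
  qed
qed

subsection \<open>Linear independence\<close>

text \<open>The pairing of the tensor \<open>\<xi>\<close> with the elementary tensor of the
  covectors \<open>ys\<close>.\<close>

primrec ev :: "('n::finite \<Rightarrow> complex) list \<Rightarrow> ('n list \<Rightarrow> complex) \<Rightarrow> complex" where
  "ev [] \<xi> = \<xi> []"
| "ev (y # ys) \<xi> = (\<Sum>j\<in>UNIV. y j * ev ys (\<lambda>J. \<xi> (j # J)))"

lemma ev_cong: "(\<And>J. length J = length ys \<Longrightarrow> \<xi> J = \<zeta> J) \<Longrightarrow> ev ys \<xi> = ev ys \<zeta>"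
proof (induction ys arbitrary: \<xi> \<zeta>)
  case (Cons y ys)
  have "ev ys (\<lambda>J. \<xi> (j # J)) = ev ys (\<lambda>J. \<zeta> (j # J))" for j
    by (rule Cons.IH) (simp add: Cons.prems)
  then show ?case by simp
qed simp

lemma ev_add: "ev ys (\<lambda>J. \<xi> J + \<zeta> J) = ev ys \<xi> + ev ys \<zeta>"
  by (induction ys arbitrary: \<xi> \<zeta>) (simp_all add: distrib_left sum.distrib)

lemma ev_scale: "ev ys (\<lambda>J. c * \<xi> J) = c * ev ys \<xi>"
  by (induction ys arbitrary: \<xi>) (simp_all add: sum_distrib_left mult.left_commute)

lemma ev_zero: "ev ys (\<lambda>J. 0) = 0"
  using ev_scale[of ys 0] by simp

definition cup_form :: "complex^'n^'n \<Rightarrow> bool \<Rightarrow> ('n::finite \<Rightarrow> complex) \<Rightarrow> ('n \<Rightarrow> complex) \<Rightarrow> complex" where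
  "cup_form M c y z = (\<Sum>j\<in>UNIV. \<Sum>k\<in>UNIV. y j * z k * cup M c j k)"

lemma ev_ins: "ev (xs @ [y, z] @ ys) (ins M c (length xs) \<xi>) = cup_form M c y z * ev (xs @ ys) \<xi>"
proof (induction xs arbitrary: \<xi>)
  case Nil
  show ?case
    by (simp add: cup_form_def ev_scale sum_distrib_left sum_distrib_right mult.assoc)
next
  case (Cons x xs)
  then show ?case
    by (simp add: sum_distrib_left mult.left_commute)
qed

text \<open>Lists in place of sets: a priori two pairings might yield the same vector, and
  independence has to count them separately.\<close>

definition comb :: "complex list \<Rightarrow> ('b \<Rightarrow> complex) list \<Rightarrow> 'b \<Rightarrow> complex" where
  "comb ls vs J = (\<Sum>(l, v)\<leftarrow>zip ls vs. l * v J)"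

lemma comb_Nil [simp]: "comb [] vs J = 0"
  and comb_Cons [simp]: "comb (l # ls) (v # vs) J = l * v J + comb ls vs J"
  by (simp_all add: comb_def)

lemma ev_comb: "length ls = length vs \<Longrightarrow> ev ys (comb ls vs) = (\<Sum>(l, v)\<leftarrow>zip ls vs. l * ev ys v)"
proof (induction ls vs rule: list_induct2)
  case Nil
  show ?case using ev_zero[of ys] by (simp add: comb_def)
next
  case (Cons l ls v vs)
  have "ev ys (comb (l # ls) (v # vs)) = ev ys (\<lambda>J. l * v J + comb ls vs J)"
    by (rule ev_cong) simp
  then show ?case using Cons by (simp add: ev_add ev_scale)
qed

lemma ev_comb_append:
  assumes "length ls = length vs" "length ls' = length vs'"
  shows "ev ys (comb (ls @ ls') (vs @ vs')) = ev ys (comb ls vs) + ev ys (comb ls' vs')"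
  using assms by (simp add: ev_comb)

lemma ev_comb_ins:
  assumes "length ls = length vs"
  shows "ev (xs @ [y, z] @ ys) (comb ls (map (ins M c (length xs)) vs))
    = cup_form M c y z * ev (xs @ ys) (comb ls vs)"
proof -
  have "(\<Sum>(l, v)\<leftarrow>zip ls (map (ins M c (length xs)) vs). l * ev (xs @ [y, z] @ ys) v)
      = cup_form M c y z * (\<Sum>(l, v)\<leftarrow>zip ls vs. l * ev (xs @ ys) v)"
    using assms
  proof (induction ls vs rule: list_induct2)
    case (Cons l ls v vs)
    then show ?case by (simp add: ev_ins[simplified] algebra_simps)
  qed simp
  then show ?thesis using assms by (simp add: ev_comb)
qed

text \<open>Contracting the pending letters with the covectors \<open>\<alpha>\<close>, the vectors in which the next letter
  opens a pair are separated by contracting it with \<open>\<alpha>\<close> again, which kills all closing vectors; any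
  covector not killed by the cup then separates the closing ones.\<close>

lemma nc_independent:
  assumes iso: "\<And>c. cup_form M c (\<alpha> c) (\<alpha> (\<not> c)) = 0"
    and nz: "\<And>c. \<exists>z. cup_form M c (\<alpha> c) z \<noteq> 0"
    and len: "length ls = length (nc M \<epsilon> s)"
    and ev0: "\<And>ys. length ys = length \<epsilon> \<Longrightarrow> ev (map \<alpha> (map Not (rev s)) @ ys) (comb ls (nc M \<epsilon> s)) = 0"
  shows "set ls \<subseteq> {0}"
  using len ev0
proof (induction \<epsilon> arbitrary: s ls)
  case Nil
  show ?case
  proof (cases "s = []")
    case True
    then obtain l where "ls = [l]" using Nil by (auto simp: length_Suc_conv)
    then show ?thesis using Nil(2)[of "[]"] True by simp
  qed (use Nil in simp)
next
  case (Cons c \<epsilon>)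
  define vs where "vs = nc M \<epsilon> ((\<not> c) # s)"
  define ls1 ls2 where "ls1 = take (length vs) ls" and "ls2 = drop (length vs) ls"
  have ls: "ls = ls1 @ ls2" and len1: "length ls1 = length vs"
    using Cons.prems(1) by (auto simp: ls1_def ls2_def vs_def)
  let ?xs = "map \<alpha> (map Not (rev s))"
  show ?case
  proof (cases "\<exists>s'. s = c # s'")
    case False
    then have nc: "nc M (c # \<epsilon>) s = vs"
      by (auto simp: vs_def split: list.splits)
    then have "ls2 = []" using Cons.prems(1) by (simp add: ls2_def)
    have "ev (map \<alpha> (map Not (rev ((\<not> c) # s))) @ ys) (comb ls1 vs) = 0" if "length ys = length \<epsilon>" for ys
      using Cons.prems(2)[of "\<alpha> c # ys"] that nc ls \<open>ls2 = []\<close> by simp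
    then have "set ls1 \<subseteq> {0}"
      using Cons.IH[of ls1 "(\<not> c) # s"] len1 by (simp add: vs_def)
    then show ?thesis using ls \<open>ls2 = []\<close> by simp
  next
    case True
    then obtain s' where s: "s = c # s'" by blast
    define ws where "ws = nc M \<epsilon> s'"
    have nc: "nc M (c # \<epsilon>) s = vs @ map (ins M (\<not> c) (length s')) ws"
      by (simp add: s vs_def ws_def)
    then have len2: "length ls2 = length ws"
      using Cons.prems(1) by (simp add: ls2_def)
    let ?xs' = "map \<alpha> (map Not (rev s'))"
    have eq: "ev (?xs @ z # ys) (comb ls (nc M (c # \<epsilon>) s)) =
        ev (?xs @ z # ys) (comb ls1 vs) + cup_form M (\<not> c) (\<alpha> (\<not> c)) z * ev (?xs' @ ys) (comb ls2 ws)" for z ys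
    proof -
      have "ev (?xs @ z # ys) (comb ls2 (map (ins M (\<not> c) (length s')) ws))
          = cup_form M (\<not> c) (\<alpha> (\<not> c)) z * ev (?xs' @ ys) (comb ls2 ws)"
        using ev_comb_ins[OF len2, of ?xs' "\<alpha> (\<not> c)" z ys M "\<not> c"] by (simp add: s)
      then show ?thesis
        unfolding ls nc by (subst ev_comb_append) (simp_all add: len1 len2)
    qed
    have "ev (map \<alpha> (map Not (rev ((\<not> c) # s))) @ ys) (comb ls1 vs) = 0" if "length ys = length \<epsilon>" for ys
      using Cons.prems(2)[of "\<alpha> c # ys"] that eq[of "\<alpha> c" ys] iso[of "\<not> c"] by simp
    then have z1: "set ls1 \<subseteq> {0}"
      using Cons.IH[of ls1 "(\<not> c) # s"] len1 by (simp add: vs_def)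
    have "ev ys (comb ls1 vs) = 0" for ys
    proof -
      have "(\<Sum>(l, v)\<leftarrow>zip ls1 vs. l * ev ys v) = (\<Sum>_\<leftarrow>zip ls1 vs. 0)"
        using z1 by (intro arg_cong[where f = sum_list] map_cong) (auto dest: set_zip_leftD)
      then show ?thesis using len1 by (simp add: ev_comb)
    qed
    moreover obtain z where z: "cup_form M (\<not> c) (\<alpha> (\<not> c)) z \<noteq> 0"
      using nz by blast
    ultimately have "ev (?xs' @ ys) (comb ls2 ws) = 0" if "length ys = length \<epsilon>" for ys
      using Cons.prems(2)[of "z # ys"] that eq[of z ys] z by simp
    then have "set ls2 \<subseteq> {0}"
      using Cons.IH[of ls2 s'] len2 by (simp add: ws_def)
    then show ?thesis using z1 ls by simp
  qed
qed

subsection \<open>Counting\<close>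

text \<open>\<open>dyck k h\<close> counts the paths with \<open>k\<close> steps \<open>\<plusminus>1\<close> from height \<open>h\<close> to \<open>0\<close> that stay nonnegative,
  every up step carrying one of two colours.\<close>

fun dyck :: "nat \<Rightarrow> nat \<Rightarrow> nat" where
  "dyck 0 h = (if h = 0 then 1 else 0)"
| "dyck (Suc k) h = 2 * dyck k (Suc h) + (if h = 0 then 0 else dyck k (h - 1))"

lemma finite_bool_lists [simp]: "finite {\<epsilon> :: bool list. length \<epsilon> = k}"
  using finite_lists_length_eq[of "UNIV :: bool set" k] by simp

lemma sum_bool_lists_Suc:
  "(\<Sum>\<epsilon> | length \<epsilon> = Suc k. f \<epsilon>) = (\<Sum>\<epsilon> | length \<epsilon> = k. f (True # \<epsilon>) + f (False # \<epsilon>))"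
  for f :: "bool list \<Rightarrow> 'b::comm_monoid_add"
proof -
  have "{\<epsilon>. length \<epsilon> = Suc k} = (#) True ` {\<epsilon>. length \<epsilon> = k} \<union> (#) False ` {\<epsilon>. length \<epsilon> = k}"
    by (auto simp: length_Suc_conv image_iff)
  then have "(\<Sum>\<epsilon> | length \<epsilon> = Suc k. f \<epsilon>)
      = (\<Sum>\<epsilon>\<in>(#) True ` {\<epsilon>. length \<epsilon> = k}. f \<epsilon>) + (\<Sum>\<epsilon>\<in>(#) False ` {\<epsilon>. length \<epsilon> = k}. f \<epsilon>)"
    by (simp only:) (rule sum.union_disjoint; auto)
  then show ?thesis
    by (simp add: sum.reindex inj_on_def sum.distrib)
qed

text \<open>Both colours of the next letter may open a pair, but only the colour on top of the stack
  may close one; hence the factor two on up steps alone.\<close>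

lemma sum_length_nc: "(\<Sum>\<epsilon> | length \<epsilon> = k. length (nc M \<epsilon> s)) = dyck k (length s)"
proof (induction k arbitrary: s)
  case (Suc k)
  show ?case
  proof (cases s)
    case Nil
    then show ?thesis by (simp add: sum_bool_lists_Suc sum.distrib Suc)
  next
    case (Cons c s')
    then show ?thesis by (cases c) (simp_all add: sum_bool_lists_Suc sum.distrib Suc)
  qed
qed simp

lemma dyck_odd: "odd (k + h) \<Longrightarrow> dyck k h = 0"
  by (induction k arbitrary: h) (auto simp: odd_pos)

lemma dyck_eq_0: "k < h \<Longrightarrow> dyck k h = 0"
  by (induction k arbitrary: h) auto

lemma dyck_diag: "dyck h h = 1"
  by (induction h) (simp_all add: dyck_eq_0)

text \<open>The ballot formula weighted by two per up step, where \<open>m\<close> is the number of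
  up steps and \<open>m + h\<close> that of down steps. It is multiplied out to avoid fractions, and
  proved by matching the recursion of \<open>dyck\<close> with Pascal's rule.\<close>

lemma dyck_closed:
  "k = 2 * m + h \<Longrightarrow> (m + h + 1) * dyck k h = 2 ^ m * (h + 1) * (k choose m)"
proof (induction k arbitrary: m h)
  case (Suc k)
  show ?case
  proof (cases m)
    case 0
    then have "h = Suc k" using Suc.prems by simp
    then show ?thesis using 0 dyck_diag[of h] by simp
  next
    case (Suc m')
    define x y D1 D2 where "x = int (k choose m)" and "y = int (k choose m')"
      and "D1 = int (dyck k (Suc h))" and "D2 = int (if h = 0 then 0 else dyck k (h - 1))"
    define a b p where "a = int m" and "b = int h" and "p = (2 ^ m' :: int)"
    have "Suc m' * (k choose Suc m') = (k - m') * (k choose m')"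
      by (simp only: binomial_absorption binomial_absorb_comp)
    moreover have "k - m' = m + h" using Suc.prems Suc by simp
    ultimately have 1: "a * x = (a + b) * y"
      using Suc by (simp add: x_def y_def a_def b_def flip: of_nat_mult of_nat_add del: of_nat_Suc)
    have "(m' + Suc h + 1) * dyck k (Suc h) = 2 ^ m' * (Suc h + 1) * (k choose m')"
      by (rule Suc.IH) (use Suc.prems Suc in simp)
    from arg_cong[where f = int, OF this] have 2: "(a + b + 1) * D1 = p * (b + 2) * y"
      using Suc by (simp add: a_def b_def p_def D1_def y_def algebra_simps)
    have 3: "(a + b) * D2 = 2 * p * b * x"
    proof (cases h)
      case 0
      then show ?thesis by (simp add: D2_def b_def)
    next
      case (Suc h')
      have "(m + h' + 1) * dyck k h' = 2 ^ m * (h' + 1) * (k choose m)"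
        by (rule Suc.IH) (use Suc.prems Suc in simp)
      from arg_cong[where f = int, OF this] show ?thesis
        using Suc \<open>m = Suc m'\<close> by (simp add: a_def b_def p_def D2_def x_def algebra_simps)
    qed
    \<comment> \<open>The two branches carry the different denominators \<open>a + b + 1\<close> and
      \<open>a + b\<close>. The additional factor \<open>a + b\<close> clears both at once and is
      cancelled afterwards; \<open>1\<close> is the absorption identity that relates the two
      binomials.\<close>
    have "(a + b) * ((a + b + 1) * (2 * D1 + D2)) = (a + b) * (2 * p * (b + 1) * (x + y))"
    proof -
      have "(a + b) * ((a + b + 1) * (2 * D1 + D2))
          = 2 * (a + b) * ((a + b + 1) * D1) + (a + b + 1) * ((a + b) * D2)"
        by (simp add: algebra_simps)
      also have "\<dots> = 2 * p * (b + 2) * ((a + b) * y) + (a + b + 1) * (2 * p * b * x)"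
        unfolding 2 3 by (simp add: algebra_simps)
      also have "\<dots> = 2 * p * (b + 1) * ((a + b) * x + a * x)"
        unfolding 1[symmetric] by (simp add: algebra_simps)
      also have "\<dots> = (a + b) * (2 * p * (b + 1) * (x + y))"
        unfolding 1 by (simp add: algebra_simps)
      finally show ?thesis .
    qed
    moreover have "a + b \<noteq> 0" using Suc by (simp add: a_def b_def)
    ultimately have 4: "(a + b + 1) * (2 * D1 + D2) = 2 * p * (b + 1) * (x + y)"
      by simp
    have 5: "int (dyck (Suc k) h) = 2 * D1 + D2" "int (Suc k choose m) = x + y"
      using Suc by (simp_all add: D1_def D2_def x_def y_def)
    have 6: "int (m + h + 1) = a + b + 1" by (simp add: a_def b_def)
    have 7: "int (2 ^ m * (h + 1)) = 2 * p * (b + 1)" by (simp add: b_def p_def Suc distrib_left)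
    have "int ((m + h + 1) * dyck (Suc k) h) = int (m + h + 1) * int (dyck (Suc k) h)"
      by (rule of_nat_mult)
    also have "\<dots> = int (2 ^ m * (h + 1)) * int (Suc k choose m)"
      unfolding 5 6 7 by (rule 4)
    also have "\<dots> = int (2 ^ m * (h + 1) * (Suc k choose m))"
      by (rule of_nat_mult[symmetric])
    finally have "int ((m + h + 1) * dyck (Suc k) h) = int (2 ^ m * (h + 1) * (Suc k choose m))" .
    then show ?thesis by (simp only: of_nat_eq_iff)
  qed
qed simp

lemma dyck_catalan: "of_nat (dyck (2 * m) 0) = (2 ^ m * catalan m :: complex)"
proof -
  have "of_nat ((m + 1) * dyck (2 * m) 0) = (of_nat (2 ^ m * ((2 * m) choose m)) :: complex)"
    using dyck_closed[of "2 * m" m 0] by simp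
  then have "(of_nat m + 1) * of_nat (dyck (2 * m) 0) = (2 ^ m * of_nat ((2 * m) choose m) :: complex)"
    by (simp add: algebra_simps)
  moreover have "(of_nat m + 1 :: complex) \<noteq> 0"
    using of_nat_neq_0[of m, where 'a = complex] by (simp add: add.commute)
  ultimately show ?thesis
    by (simp add: catalan_def field_simps)
qed

section \<open>Linear algebra\<close>

lemma sum_rank_one:
  fixes P :: "'b \<Rightarrow> 'b \<Rightarrow> complex"
  shows "(\<Sum>k\<in>B. (P i k - v i * \<eta> k) * x k) = (\<Sum>k\<in>B. P i k * x k) - v i * (\<Sum>k\<in>B. \<eta> k * x k)"
  by (simp add: left_diff_distrib sum_subtractf sum_distrib_left mult.assoc)

text \<open>Each step splits off a rank-one idempotent \<open>v \<otimes> \<eta>\<close> from \<open>P\<close>, where \<open>\<eta>\<close> is a multiple of a row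
  of \<open>P\<close> that vanishes afterwards.\<close>

lemma idempotent_trace:
  fixes P :: "'b \<Rightarrow> 'b \<Rightarrow> complex" and w :: "'t \<Rightarrow> 'b \<Rightarrow> complex"
  assumes "finite B" "finite T"
    and "\<And>i j. \<lbrakk>i \<in> B; j \<in> B\<rbrakk> \<Longrightarrow> (\<Sum>k\<in>B. P i k * P k j) = P i j"
    and "\<And>t i. \<lbrakk>t \<in> T; i \<in> B\<rbrakk> \<Longrightarrow> (\<Sum>j\<in>B. P i j * w t j) = w t i"
    and "\<And>l. (\<And>i. i \<in> B \<Longrightarrow> (\<Sum>t\<in>T. l t * w t i) = 0) \<Longrightarrow> (\<And>t. t \<in> T \<Longrightarrow> l t = 0)"
  shows "\<exists>r. (\<Sum>i\<in>B. P i i) = of_nat r \<and> card T \<le> r \<and> (r = card T \<longrightarrow>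
     (\<forall>x. (\<forall>i\<in>B. (\<Sum>j\<in>B. P i j * x j) = x i) \<longrightarrow>
        (\<exists>l. \<forall>i\<in>B. x i = (\<Sum>t\<in>T. l t * w t i))))"
  using assms(2-)
proof (induction "card {i \<in> B. \<exists>j\<in>B. P i j \<noteq> 0}" arbitrary: P T w rule: less_induct)
  case less
  note idem = less.prems(2) and fix_w = less.prems(3) and indep = less.prems(4)
  show ?case
  proof (cases "\<forall>i\<in>B. \<forall>j\<in>B. P i j = 0")
    case True
    have "T = {}"
    proof (rule ccontr)
      assume "T \<noteq> {}"
      then obtain t where t: "t \<in> T" by blast
      have "w s i = 0" if "s \<in> T" "i \<in> B" for s i
        using fix_w[OF that] True that by simp
      then have "(\<Sum>s\<in>T. 1 * w s i) = 0" if "i \<in> B" for i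
        using that by simp
      from indep[of "\<lambda>_. 1", OF this t] show False by simp
    qed
    with True show ?thesis by (intro exI[of _ 0]) auto
  next
    case False
    then obtain a b where ab: "a \<in> B" "b \<in> B" "P a b \<noteq> 0" by blast
    \<comment> \<open>The vector to split off is one of the given fixed vectors as long as there are
      any, and a nonzero column of \<open>P\<close> otherwise. Every step adds one to the trace, and
      only those of the second kind push it above \<open>card T\<close>.\<close>
    have "\<exists>t v. \<forall>i\<in>B. (\<Sum>j\<in>B. P i j * v j) = v i \<and> (T \<noteq> {} \<longrightarrow> t \<in> T \<and> v = w t) \<and> (\<exists>b\<in>B. v b \<noteq> 0)"
    proof (cases "T = {}")
      case True
      then show ?thesis using idem ab by (intro exI[of _ undefined] exI[of _ "\<lambda>i. P i b"]) auto
    next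
      case False
      then obtain t where t: "t \<in> T" by blast
      have "\<exists>b\<in>B. w t b \<noteq> 0"
      proof (rule ccontr)
        assume "\<not> ?thesis"
        then have "(\<Sum>s\<in>T. (if s = t then 1 else 0) * w s i) = 0" if "i \<in> B" for i
          using that less.prems(1) t by (simp add: if_distrib[of "\<lambda>x. x * _"] cong: if_cong)
        from indep[of "\<lambda>s. if s = t then 1 else 0", OF this t] show False by simp
      qed
      then show ?thesis using t fix_w by (intro exI[of _ t] exI[of _ "w t"]) auto
    qed
    then obtain t v b where v: "\<And>i. i \<in> B \<Longrightarrow> (\<Sum>j\<in>B. P i j * v j) = v i"
      and t: "T \<noteq> {} \<Longrightarrow> t \<in> T" "T \<noteq> {} \<Longrightarrow> v = w t" and b: "b \<in> B" "v b \<noteq> 0"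
      using ab by blast
    \<comment> \<open>Division by \<open>v b\<close> normalises the functional to
      \<open>\<phi> v = 1\<close>, which makes the rank-one matrix of \<open>v\<close> and
      \<open>\<eta>\<close> idempotent.\<close>
    define \<eta> where "\<eta> j = P b j / v b" for j
    define \<phi> where "\<phi> x = (\<Sum>j\<in>B. \<eta> j * x j)" for x
    have \<phi>v: "\<phi> v = 1"
      using v[OF b(1)] b(2) by (simp add: \<phi>_def \<eta>_def flip: sum_divide_distrib)
    have \<phi>P: "\<phi> (\<lambda>k. P k j) = \<eta> j" if "j \<in> B" for j
      using idem[OF b(1) that] by (simp add: \<phi>_def \<eta>_def flip: sum_divide_distrib)
    have \<phi>_fix: "\<phi> (\<lambda>k. \<Sum>j\<in>B. P k j * x j) = \<phi> x" for x
    proof -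
      have "\<phi> (\<lambda>k. \<Sum>j\<in>B. P k j * x j) = (\<Sum>k\<in>B. \<Sum>j\<in>B. \<eta> k * P k j * x j)"
        by (simp add: \<phi>_def sum_distrib_left mult.assoc)
      also have "\<dots> = (\<Sum>j\<in>B. \<phi> (\<lambda>k. P k j) * x j)"
        by (subst sum.swap) (simp add: \<phi>_def sum_distrib_right)
      also have "\<dots> = \<phi> x" using \<phi>P by (simp add: \<phi>_def)
      finally show ?thesis .
    qed
    define P' where "P' i j = P i j - v i * \<eta> j" for i j
    have app: "(\<Sum>k\<in>B. P' i k * x k) = (\<Sum>k\<in>B. P i k * x k) - v i * \<phi> x" for i x
      by (simp add: P'_def \<phi>_def sum_rank_one)
    \<comment> \<open>For empty \<open>T\<close> the element \<open>t\<close> is arbitrary and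
      nothing is removed. The remaining vectors are shifted along \<open>v\<close> into the kernel
      of \<open>\<phi>\<close>, where \<open>P'\<close> acts like \<open>P\<close>.\<close>
    define T' where "T' = T - {t}"
    define w' where "w' s i = w s i - \<phi> (w s) * v i" for s i
    have \<phi>_diff: "\<phi> (\<lambda>i. x i - c * y i) = \<phi> x - c * \<phi> y" for x y c
      by (simp add: \<phi>_def right_diff_distrib sum_subtractf sum_distrib_left mult.left_commute)
    have defl: "(\<Sum>j\<in>B. P' i j * (x j - \<phi> x * v j)) = x i - \<phi> x * v i"
      if x: "\<And>i. i \<in> B \<Longrightarrow> (\<Sum>j\<in>B. P i j * x j) = x i" and i: "i \<in> B" for x i
    proof -
      have "(\<Sum>j\<in>B. P i j * (x j - \<phi> x * v j)) = x i - \<phi> x * v i"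
        using x[OF i] v[OF i]
        by (simp add: right_diff_distrib sum_subtractf mult.left_commute flip: sum_distrib_left)
      then show ?thesis by (simp add: app \<phi>_diff \<phi>v)
    qed
    \<comment> \<open>The induction runs on the number of nonzero rows. A zero row of
      \<open>P\<close> forces \<open>v i = 0\<close> and therefore stays zero, while row
      \<open>b\<close> joins the zero rows.\<close>
    have card_less: "card {i \<in> B. \<exists>j\<in>B. P' i j \<noteq> 0} < card {i \<in> B. \<exists>j\<in>B. P i j \<noteq> 0}"
    proof (rule psubset_card_mono)
      have "v i = 0" if "i \<in> B" "\<forall>j\<in>B. P i j = 0" for i
        using v[OF that(1)] that by simp
      then have "{i \<in> B. \<exists>j\<in>B. P' i j \<noteq> 0} \<subseteq> {i \<in> B. \<exists>j\<in>B. P i j \<noteq> 0}"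
        by (auto simp: P'_def) (metis mult_zero_left)
      moreover have "\<forall>j\<in>B. P' b j = 0"
        using b by (simp add: P'_def \<eta>_def)
      moreover have "\<exists>j\<in>B. P b j \<noteq> 0"
        using v[OF b(1)] b(2) by (metis (no_types, lifting) mult_zero_left sum.neutral)
      ultimately show "{i \<in> B. \<exists>j\<in>B. P' i j \<noteq> 0} \<subset> {i \<in> B. \<exists>j\<in>B. P i j \<noteq> 0}"
        using b(1) by blast
    qed (use \<open>finite B\<close> in simp)
    obtain r where r: "(\<Sum>i\<in>B. P' i i) = of_nat r" "card T' \<le> r"
      "r = card T' \<Longrightarrow> (\<forall>i\<in>B. (\<Sum>j\<in>B. P' i j * x j) = x i) \<Longrightarrow>
        \<exists>l. \<forall>i\<in>B. x i = (\<Sum>t\<in>T'. l t * w' t i)" for x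
    proof atomize_elim
      have fT: "finite T'" using less.prems(1) by (simp add: T'_def)
      have idem': "(\<Sum>k\<in>B. P' i k * P' k j) = P' i j" if "i \<in> B" "j \<in> B" for i j
        using defl[of "\<lambda>k. P k j", OF _ that(1)] idem that \<phi>P[OF that(2)]
        by (simp add: P'_def mult.commute)
      have fix': "(\<Sum>j\<in>B. P' i j * w' s j) = w' s i" if "s \<in> T'" "i \<in> B" for s i
        unfolding w'_def using defl[of "w s", OF _ that(2)] fix_w that by (simp add: T'_def)
      have indep': "l s = 0" if l: "\<And>i. i \<in> B \<Longrightarrow> (\<Sum>s\<in>T'. l s * w' s i) = 0" and s: "s \<in> T'" for l s
      proof -
        have T: "T \<noteq> {}" using s by (auto simp: T'_def)
        \<comment> \<open>The coefficient at \<open>t\<close> collects all the shifts, so that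
          combining the \<open>w s\<close> with \<open>l'\<close> gives the same as combining the
          \<open>w' s\<close> with \<open>l\<close>.\<close>
        define l' where "l' = (\<lambda>s. if s = t then - (\<Sum>s\<in>T'. l s * \<phi> (w s)) else l s)"
        have "(\<Sum>s\<in>T. l' s * w s i) = 0" if i: "i \<in> B" for i
        proof -
          have "(\<Sum>s\<in>T. l' s * w s i) = l' t * w t i + (\<Sum>s\<in>T'. l' s * w s i)"
            unfolding T'_def by (rule sum.remove[OF less.prems(1) t(1)[OF T]])
          also have "(\<Sum>s\<in>T'. l' s * w s i) = (\<Sum>s\<in>T'. l s * w s i)"
            by (rule sum.cong) (auto simp: l'_def T'_def)
          also have "l' t * w t i = - (\<Sum>s\<in>T'. l s * \<phi> (w s) * v i)"
            using t(2)[OF T] by (simp add: l'_def sum_distrib_right)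
          also have "- (\<Sum>s\<in>T'. l s * \<phi> (w s) * v i) + (\<Sum>s\<in>T'. l s * w s i) = (\<Sum>s\<in>T'. l s * w' s i)"
            by (simp add: w'_def right_diff_distrib sum_subtractf mult.assoc)
          finally show ?thesis using l[OF i] by simp
        qed
        from indep[of l', OF this, of s] s show ?thesis by (simp add: l'_def T'_def split: if_splits)
      qed
      have "\<exists>r. (\<Sum>i\<in>B. P' i i) = of_nat r \<and> card T' \<le> r \<and> (r = card T' \<longrightarrow>
          (\<forall>x. (\<forall>i\<in>B. (\<Sum>j\<in>B. P' i j * x j) = x i) \<longrightarrow>
            (\<exists>l. \<forall>i\<in>B. x i = (\<Sum>t\<in>T'. l t * w' t i))))"
        by (intro less.hyps[of P' T' w', OF card_less fT] idem' fix')
          (assumption | (rule indep'; force))+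
      then show "\<exists>r. (\<Sum>i\<in>B. P' i i) = of_nat r \<and> card T' \<le> r \<and>
        (\<forall>x. r = card T' \<longrightarrow> (\<forall>i\<in>B. (\<Sum>j\<in>B. P' i j * x j) = x i) \<longrightarrow>
          (\<exists>l. \<forall>i\<in>B. x i = (\<Sum>t\<in>T'. l t * w' t i)))"
        by blast
    qed
    have tr: "(\<Sum>i\<in>B. P i i) = of_nat (Suc r)"
    proof -
      have "(\<Sum>i\<in>B. P' i i) = (\<Sum>i\<in>B. P i i) - \<phi> v"
        by (simp add: P'_def \<phi>_def sum_subtractf mult.commute)
      then show ?thesis using r(1) \<phi>v by (simp add: algebra_simps)
    qed
    have card: "card T \<le> Suc (card T')"
      unfolding T'_def by (metis card_Suc_Diff1 diff_le_self le_SucI Diff_empty Diff_insert0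
          card.infinite less.prems(1) order_refl)
    have "\<exists>l. \<forall>i\<in>B. x i = (\<Sum>t\<in>T. l t * w t i)"
      if Suc_r: "Suc r = card T" and x: "\<forall>i\<in>B. (\<Sum>j\<in>B. P i j * x j) = x i" for x
    proof -
      have T: "T \<noteq> {}" using Suc_r by auto
      have "card T = Suc (card T')"
        unfolding T'_def using t(1)[OF T] less.prems(1) by (metis card_Suc_Diff1)
      then have "r = card T'" using Suc_r by simp
      from r(3)[OF this, of "\<lambda>j. x j - \<phi> x * v j"] defl[of x] x
      obtain l where l: "\<And>i. i \<in> B \<Longrightarrow> x i - \<phi> x * v i = (\<Sum>s\<in>T'. l s * w' s i)" by auto
      define l' where "l' = (\<lambda>s. if s = t then \<phi> x - (\<Sum>s\<in>T'. l s * \<phi> (w s)) else l s)"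
      have "x i = (\<Sum>s\<in>T. l' s * w s i)" if i: "i \<in> B" for i
      proof -
        have "(\<Sum>s\<in>T. l' s * w s i) = l' t * w t i + (\<Sum>s\<in>T'. l' s * w s i)"
          unfolding T'_def by (rule sum.remove[OF less.prems(1) t(1)[OF T]])
        also have "(\<Sum>s\<in>T'. l' s * w s i) = (\<Sum>s\<in>T'. l s * w s i)"
          by (rule sum.cong) (auto simp: l'_def T'_def)
        also have "l' t * w t i = \<phi> x * v i - (\<Sum>s\<in>T'. l s * \<phi> (w s) * v i)"
          using t(2)[OF T] by (simp add: l'_def sum_distrib_right left_diff_distrib)
        also have "\<phi> x * v i - (\<Sum>s\<in>T'. l s * \<phi> (w s) * v i) + (\<Sum>s\<in>T'. l s * w s i)
            = \<phi> x * v i + (\<Sum>s\<in>T'. l s * w' s i)"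
          by (simp add: w'_def right_diff_distrib sum_subtractf mult.assoc)
        finally show ?thesis unfolding l[OF i, symmetric] by simp
      qed
      then show ?thesis by blast
    qed
    moreover have "card T \<le> Suc r" using card r(2) by simp
    ultimately show ?thesis using tr by blast
  qed
qed

text \<open>An affine function that is nonnegative on the whole real line is constant; real
  \<open>t\<close> gives \<open>z + w = 0\<close> and imaginary \<open>t\<close> gives
  \<open>z - w = 0\<close>. This serves in place of the Cauchy-Schwarz inequality at null vectors of
  a nonnegative form.\<close>

lemma form_null:
  fixes p z w :: complex
  assumes "\<And>t::complex. 0 \<le> p + t * z + cnj t * w"
  shows "z = 0"
proof -
  have lin0: "b = 0" if "\<And>s::real. 0 \<le> a + s * b" for a b :: real
  proof (rule ccontr)
    assume b: "b \<noteq> 0"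
    have "0 \<le> a + (- (a + 1) / b) * b" by (rule that)
    then show False using b by simp
  qed
  have lin: "b = 0" if "\<And>s::real. 0 \<le> p + of_real s * b" for b :: complex
  proof -
    have "Re b = 0"
      by (rule lin0[of "Re p"]) (use that in \<open>auto simp: less_eq_complex_def\<close>)
    moreover have "Im p + s * Im b = 0" for s
      using that[of s] by (simp add: less_eq_complex_def)
    from this[of 0] this[of 1] have "Im b = 0" by simp
    ultimately show ?thesis by (simp add: complex_eq_iff)
  qed
  have "z + w = 0"
  proof (rule lin)
    fix s :: real
    show "0 \<le> p + of_real s * (z + w)"
      using assms[of "of_real s"] by (simp add: algebra_simps)
  qed
  moreover have "\<i> * (z - w) = 0"
  proof (rule lin)
    fix s :: real
    show "0 \<le> p + of_real s * (\<i> * (z - w))"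
      using assms[of "of_real s * \<i>"] by (simp add: algebra_simps)
  qed
  ultimately show ?thesis by simp
qed

section \<open>Positive definite matrices: eigenvectors, inverses and factorisation\<close>

definition herm :: "complex^'n^'n \<Rightarrow> complex^'n \<Rightarrow> complex^'n \<Rightarrow> complex" where
  "herm M x y = (\<Sum>i\<in>UNIV. \<Sum>j\<in>UNIV. cnj (x $ i) * M $ i $ j * y $ j)"

definition pos_def :: "complex^'n^'n \<Rightarrow> bool" where
  "pos_def M \<longleftrightarrow> (\<forall>x. 0 \<le> herm M x x \<and> (herm M x x = 0 \<longrightarrow> x = 0))"

lemma herm_add_left: "herm M (x + y) z = herm M x z + herm M y z"
  and herm_add_right: "herm M z (x + y) = herm M z x + herm M z y"
  and herm_scale_left: "herm M (c *s x) z = cnj c * herm M x z"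
  and herm_scale_right: "herm M z (c *s x) = c * herm M z x"
  by (simp_all add: herm_def distrib_left distrib_right sum.distrib sum_distrib_left algebra_simps)

lemma herm_axis_left: "herm M (axis i 1) y = (M *v y) $ i"
proof -
  have "cnj (axis i 1 $ k) * M $ k $ j * y $ j = (if k = i then M $ i $ j * y $ j else 0)" for k j
    by (simp add: axis_def)
  then show ?thesis
    by (simp add: herm_def matrix_vector_mult_def sum.swap[of _ UNIV UNIV])
qed

text \<open>Over the complex numbers, real values on the diagonal already force hermitian symmetry:
  polarise with \<open>x + y\<close> and with \<open>x + \<i> *s y\<close>.\<close>

lemma herm_cnj: assumes "pos_def M" shows "cnj (herm M x y) = herm M y x"
proof -
  have im: "Im (herm M v v) = 0" for v
    using assms by (simp add: pos_def_def less_eq_complex_def)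
  have "Im (herm M x y + herm M y x) = 0"
    using im[of "x + y"] im[of x] im[of y] by (simp add: herm_add_left herm_add_right)
  moreover have "Im (\<i> * herm M x y - \<i> * herm M y x) = 0"
    using im[of "x + \<i> *s y"] im[of x] im[of y]
    by (simp add: herm_add_left herm_add_right herm_scale_left herm_scale_right algebra_simps)
  ultimately show ?thesis by (simp add: complex_eq_iff)
qed

lemma pos_def_real: "pos_def M \<Longrightarrow> herm M x x = of_real (Re (herm M x x))"
  by (simp add: pos_def_def less_eq_complex_def complex_eq_iff)

lemma herm_diff_right: "herm M z (x - y) = herm M z x - herm M z y"
  using herm_add_right[of M z "x - y" y] by simp

lemma herm_sum_right: "herm M z (\<Sum>i\<in>S. f i) = (\<Sum>i\<in>S. herm M z (f i))"
proof (induction S rule: infinite_finite_induct)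
  have "herm M z 0 = 0" using herm_diff_right[of M z 0 0] by simp
  then show "herm M z (\<Sum>i\<in>{}. f i) = (\<Sum>i\<in>{}. herm M z (f i))"
    and "infinite A \<Longrightarrow> herm M z (\<Sum>i\<in>A. f i) = (\<Sum>i\<in>A. herm M z (f i))" for A by simp_all
qed (simp add: herm_add_right)

text \<open>A maximiser of the Rayleigh quotient is an eigenvector.\<close>

lemma pos_def_eigenvector:
  fixes M :: "complex^'n^'n"
  assumes M: "pos_def M"
  shows "\<exists>a \<rho>. a \<noteq> 0 \<and> M *v a = \<rho> *s a"
proof -
  let ?q = "\<lambda>x. Re (herm M x x)"
  have "continuous_on (sphere 0 1) ?q"
    unfolding herm_def by (intro continuous_intros)
  moreover have "sphere (0 :: complex^'n) 1 \<noteq> {}" by simp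
  ultimately obtain a where a: "norm a = 1" and max: "\<And>y. norm y = 1 \<Longrightarrow> ?q y \<le> ?q a"
    using continuous_attains_sup[OF compact_sphere, of "0 :: complex^'n" 1 ?q] by auto
  have bound: "?q x \<le> ?q a * (norm x)\<^sup>2" for x
  proof (cases "x = 0")
    case True
    have "herm M 0 0 = 0" by (simp add: herm_def)
    then show ?thesis using True by simp
  next
    case False
    define c where "c = complex_of_real (inverse (norm x))"
    have cx: "c *s x = inverse (norm x) *\<^sub>R x"
      by (simp add: vec_eq_iff c_def) (simp add: scaleR_conv_of_real)
    then have "?q (c *s x) \<le> ?q a" using False by (intro max) simp
    also have "?q (c *s x) = (inverse (norm x))\<^sup>2 * ?q x"
      by (simp add: herm_scale_left herm_scale_right c_def power2_eq_square inverse_eq_divide)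
    finally show ?thesis using False by (simp add: inverse_eq_divide power_divide pos_divide_le_eq)
  qed
  define \<rho> where "\<rho> = complex_of_real (?q a)"
  \<comment> \<open>The form of \<open>\<rho> - M\<close> is nonnegative by \<open>bound\<close> and
    vanishes at the maximiser \<open>a\<close>, so \<open>form_null\<close> puts \<open>a\<close>
    into its kernel.\<close>
  define D where "D x y = \<rho> * herm (mat 1) x y - herm M x y" for x y
  have one: "herm (mat 1) x y = (\<Sum>i\<in>UNIV. cnj (x $ i) * y $ i)" for x y :: "complex^'n"
  proof -
    have "cnj (x $ i) * mat 1 $ i $ j * y $ j = (if j = i then cnj (x $ i) * y $ i else 0)" for i j
      by (simp add: mat_def)
    then show ?thesis by (simp add: herm_def)
  qed
  have norm: "herm (mat 1) x x = of_real ((norm x)\<^sup>2)" for x :: "complex^'n"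
    by (simp add: one norm_vec_def L2_set_def sum_nonneg mult.commute[of "cnj _"] complex_mult_cnj cmod_power2)
  have "D y a = 0" for y
  proof (rule form_null)
    fix t :: complex
    have "D (y + t *s a) (y + t *s a) = D y y + t * D y a + cnj t * D a y + t * cnj t * D a a"
      by (simp add: D_def herm_add_left herm_add_right herm_scale_left herm_scale_right algebra_simps)
    moreover have "D a a = 0"
      using pos_def_real[OF M, of a] by (simp add: D_def norm a \<rho>_def)
    moreover have "0 \<le> D x x" for x
    proof -
      have "D x x = of_real (?q a * (norm x)\<^sup>2 - ?q x)"
        by (subst pos_def_real[OF M, of x, symmetric, THEN sym])
          (use pos_def_real[OF M, of x] in \<open>simp add: D_def norm \<rho>_def\<close>)
      then show ?thesis using bound[of x] by (simp add: less_eq_complex_def)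
    qed
    ultimately show "0 \<le> D y y + t * D y a + cnj t * D a y" by (metis add.right_neutral mult_zero_right)
  qed
  from this[of "axis _ 1"] have "(M *v a) $ i = \<rho> * a $ i" for i
    by (simp add: D_def herm_axis_left)
  then have "M *v a = \<rho> *s a" by (simp add: vec_eq_iff)
  moreover have "a \<noteq> 0" using a by auto
  ultimately show ?thesis by blast
qed

lemma pos_def_inverse:
  fixes M :: "complex^'n^'n"
  assumes "pos_def M"
  obtains N where "M ** N = mat 1" "N ** M = mat 1"
proof -
  have "x = 0" if "M *v x = 0" for x
  proof -
    have "herm M x x = (\<Sum>i\<in>UNIV. cnj (x $ i) * (M *v x) $ i)"
      by (simp add: herm_def matrix_vector_mult_def sum_distrib_left mult.assoc)
    then show ?thesis using assms that by (simp add: pos_def_def)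
  qed
  then obtain N where "N ** M = mat 1"
    using matrix_left_invertible_ker[of M] by blast
  then show ?thesis using that matrix_left_right_inverse by blast
qed

text \<open>Any eigenvector \<open>a\<close> of \<open>M\<close> and any \<open>b \<noteq> 0\<close> with \<open>\<Sum>\<^sub>k b\<^sub>k a\<^sub>k = 0\<close> will do; such a \<open>b\<close> exists only
  in dimension at least two.\<close>

lemma isotropic_covectors:
  fixes M :: "complex^'n^'n"
  assumes M: "pos_def M" and card: "CARD('n) \<ge> 2"
  obtains \<alpha> where "\<And>c. cup_form M c (\<alpha> c) (\<alpha> (\<not> c)) = 0" "\<And>c. \<exists>z. cup_form M c (\<alpha> c) z \<noteq> 0"
proof -
  obtain a \<rho> where a: "a \<noteq> 0" "M *v a = \<rho> *s a"
    using pos_def_eigenvector[OF M] by blast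
  obtain N where N: "M ** N = mat 1" using pos_def_inverse[OF M] by blast
  obtain i where i: "a $ i \<noteq> 0" using a(1) by (auto simp: vec_eq_iff)
  have "\<exists>j. j \<noteq> i"
  proof (rule ccontr)
    assume "\<not> ?thesis"
    then have "(UNIV :: 'n set) = {i}" by auto
    then have "CARD('n) = 1" by (metis card_1_singleton_iff One_nat_def)
    then show False using card by simp
  qed
  then obtain j where j: "j \<noteq> i" by blast
  define b where "b k = (if k = i then - a $ j else 0) + (if k = j then a $ i else 0)" for k
  have ab: "(\<Sum>k\<in>UNIV. b k * a $ k) = 0"
    by (simp add: b_def distrib_right sum.distrib if_distrib[of "\<lambda>x. x * _"] cong: if_cong)
  have F: "cup_form M False y z = (\<Sum>j\<in>UNIV. y j * z j)" for y z
  proof -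
    have "y j * z k * cup M False j k = (if k = j then y j * z j else 0)" for j k
      by (simp add: cup_def)
    then show ?thesis by (simp add: cup_form_def)
  qed
  have T: "cup_form M True y z = (\<Sum>j\<in>UNIV. y j * (M *v (\<chi> k. z k)) $ j)" for y z
    by (simp add: cup_form_def cup_def matrix_vector_mult_def sum_distrib_left mult_ac)
  \<comment> \<open>Pairing \<open>b\<close> with \<open>a\<close> kills the identity cup by the
    choice of \<open>b\<close>, and the cup of \<open>M\<close> because \<open>M\<close> multiplies
    \<open>a\<close> by \<open>\<rho>\<close>. In the latter \<open>a\<close> has to stand on the
    right, where it meets \<open>M\<close> as an eigenvector.\<close>
  define \<alpha> where "\<alpha> c = (if c then b else (\<lambda>k. a $ k))" for c
  have 1: "cup_form M c (\<alpha> c) (\<alpha> (\<not> c)) = 0" for c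
  proof (cases c)
    case True
    have "(\<Sum>j\<in>UNIV. b j * (\<rho> * a $ j)) = \<rho> * (\<Sum>j\<in>UNIV. b j * a $ j)"
      by (simp add: sum_distrib_left mult.left_commute)
    then show ?thesis using True ab by (simp add: \<alpha>_def T a(2))
  next
    case False
    then show ?thesis using ab by (simp add: \<alpha>_def F mult.commute)
  qed
  have 2: "\<exists>z. cup_form M c (\<alpha> c) z \<noteq> 0" for c
  proof (cases c)
    case True
    \<comment> \<open>As \<open>M\<close> is onto, some \<open>z\<close> is mapped to the unit
      vector at \<open>j\<close>, and there \<open>b j = a $ i\<close> is nonzero.\<close>
    have "M *v (N *v axis j 1) = axis j 1"
      by (simp add: matrix_vector_mul_assoc N)
    then have "cup_form M c (\<alpha> c) (\<lambda>k. (N *v axis j 1) $ k) = (\<Sum>k\<in>UNIV. b k * axis j 1 $ k)"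
      using True by (simp add: \<alpha>_def T)
    also have "\<dots> = a $ i"
      using j by (simp add: axis_def b_def if_distrib[of "\<lambda>x. _ * x"] cong: if_cong)
    finally show ?thesis using i by metis
  next
    case False
    have "cup_form M c (\<alpha> c) (\<lambda>k. if k = i then 1 else 0) = a $ i"
      using False by (simp add: \<alpha>_def F if_distrib[of "\<lambda>x. _ * x"] cong: if_cong)
    then show ?thesis using i by metis
  qed
  from 1 2 show thesis by (rule that)
qed

definition cadj :: "complex^'n^'m \<Rightarrow> complex^'m^'n" where
  "cadj X = (\<chi> i j. cnj (X $ j $ i))"

lemma cadj_mult: "cadj (X ** Y) = cadj Y ** cadj X"
  by (simp add: cadj_def matrix_matrix_mult_def vec_eq_iff mult.commute)

text \<open>The support condition keeps the next vector from vanishing: the earlier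
  \<open>p j\<close> are zero at the new index \<open>s\<close>, so after the projections are
  subtracted coordinate \<open>s\<close> is still one.\<close>

lemma gram_schmidt:
  fixes M :: "complex^'n^'n" and S :: "'n set"
  assumes M: "pos_def M"
  shows "\<exists>p. (\<forall>i\<in>S. \<forall>j\<in>S. herm M (p i) (p j) = (if i = j then 1 else 0)) \<and>
    (\<forall>i\<in>S. \<forall>k. k \<notin> S \<longrightarrow> p i $ k = 0)"
  using finite[of S]
proof (induction S rule: finite_induct)
  case (insert s S)
  then obtain p where p: "\<And>i j. i \<in> S \<Longrightarrow> j \<in> S \<Longrightarrow> herm M (p i) (p j) = (if i = j then 1 else 0)"
    and supp: "\<And>i k. i \<in> S \<Longrightarrow> k \<notin> S \<Longrightarrow> p i $ k = 0" by blast
  define v where "v = axis s 1 - (\<Sum>j\<in>S. herm M (p j) (axis s 1) *s p j)"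
  have orth: "herm M (p k) v = 0" if "k \<in> S" for k
  proof -
    have "(\<Sum>j\<in>S. herm M (p j) (axis s 1) * herm M (p k) (p j)) = herm M (p k) (axis s 1)"
      using that p by (simp add: if_distrib[of "\<lambda>x. _ * x"] cong: if_cong)
    then show ?thesis by (simp add: v_def herm_diff_right herm_sum_right herm_scale_right)
  qed
  have vs: "v $ s = 1"
    using supp insert by (simp add: v_def sum_component)
  have vk: "v $ k = 0" if "k \<notin> insert s S" for k
    using supp that by (simp add: v_def sum_component axis_def)
  have "v \<noteq> 0" using vs by auto
  then have pos: "0 < Re (herm M v v)"
    using M pos_def_real[OF M, of v] unfolding pos_def_def less_eq_complex_def
    by (metis less_eq_real_def of_real_0 zero_complex.simps(1))
  define c where "c = complex_of_real (1 / sqrt (Re (herm M v v)))"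
  have "c * c * herm M v v = of_real (1 / sqrt (Re (herm M v v)) * (1 / sqrt (Re (herm M v v))) * Re (herm M v v))"
    by (subst pos_def_real[OF M, of v]) (simp only: c_def of_real_mult)
  also have "1 / sqrt (Re (herm M v v)) * (1 / sqrt (Re (herm M v v))) * Re (herm M v v) = 1"
    using pos by simp
  finally have "c * c * herm M v v = 1" by simp
  moreover have "cnj c = c" by (simp add: c_def)
  ultimately have "herm M (c *s v) (c *s v) = 1"
    by (simp add: herm_scale_left herm_scale_right mult.assoc)
  moreover have "herm M v (p k) = 0" if "k \<in> S" for k
    using orth[OF that] herm_cnj[OF M, of "p k" v] by simp
  ultimately show ?case
    using p orth supp vk insert
    by (intro exI[of _ "p(s := c *s v)"]) (auto simp: herm_scale_left herm_scale_right)
qed simp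

text \<open>Let the columns of \<open>P\<close> be an orthonormal basis for the form
  \<open>M\<close>, so that \<open>cadj P ** (M ** P)\<close> is the identity. Then
  \<open>Q = cadj P\<close> and \<open>R = M ** P\<close> work.\<close>

lemma pos_def_factor:
  fixes M :: "complex^'n^'n"
  assumes M: "pos_def M"
  obtains Q R :: "complex^'n^'n" where "Q ** R = mat 1" "R ** Q = mat 1" "M = R ** cadj R"
proof -
  obtain p :: "'n \<Rightarrow> complex^'n" where p: "\<And>i j. herm M (p i) (p j) = (if i = j then 1 else 0)"
    using gram_schmidt[OF M, of UNIV] by (metis UNIV_I)
  define P :: "complex^'n^'n" where "P = (\<chi> k i. p i $ k)"
  have "(cadj P ** (M ** P)) $ i $ j = herm M (p i) (p j)" for i j
    by (simp add: matrix_matrix_mult_def P_def cadj_def herm_def sum_distrib_left mult.assoc)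
  then have QR: "cadj P ** (M ** P) = mat 1"
    by (simp add: vec_eq_iff p mat_def)
  then have "P ** (cadj P ** M) = mat 1"
    using matrix_left_right_inverse[of "cadj P ** M" P] by (simp add: matrix_mul_assoc)
  moreover have "cadj M = M"
  proof -
    have "M $ i $ j = herm M (axis i 1) (axis j 1)" for i j
      by (simp only: herm_axis_left) (simp add: matrix_vector_mult_def axis_def if_distrib[of "\<lambda>x. _ * x"] cong: if_cong)
    then show ?thesis using herm_cnj[OF M] by (simp add: cadj_def vec_eq_iff)
  qed
  ultimately have "M = (M ** P) ** cadj (M ** P)"
    by (simp add: cadj_mult flip: matrix_mul_assoc)
  moreover have "(M ** P) ** cadj P = mat 1"
    using QR by (simp only: matrix_left_right_inverse)
  ultimately show thesis using that[OF QR] by blast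
qed

section \<open>The free star-algebra\<close>

definition flip :: "('n \<times> 'n \<times> bool) list \<Rightarrow> ('n \<times> 'n \<times> bool) list" where
  "flip w = rev (map (\<lambda>(i, j, b). (i, j, \<not> b)) w)"

interpretation W: star_monoid "word_monoid :: ('n \<times> 'n \<times> bool) list monoid" flip
proof (intro star_monoid.intro monoidI star_monoid_axioms.intro)
  fix p :: "('n \<times> 'n \<times> bool) list"
  show "flip (flip p) = p"
    by (simp add: flip_def rev_map comp_def split_def)
qed (auto simp: word_monoid_def flip_def)

lemma free_star_alg_eq: "free_star_alg = W.R"
  unfolding free_star_alg_def flip_def[abs_def] ..

interpretation FS: star_algebra free_star_alg
  unfolding free_star_alg_eq by (rule W.star_algebra_R)

definition adj :: "'n free_elt \<Rightarrow> 'n free_elt" where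
  "adj = star free_star_alg"

lemma free_carrier [simp]: "carrier free_star_alg = UNIV"
  unfolding free_star_alg_eq W.carrier_R by (simp add: word_monoid_def)

lemma free_mult [simp]: "x \<otimes>\<^bsub>free_star_alg\<^esub> y = x * y"
proof -
  have "psingle p c \<otimes>\<^bsub>W.R\<^esub> y = psingle p c * y" for p c
    using subset_UNIV[of "pkeys y"]
    by (induction y rule: keys_add_single_induct)
      (simp_all add: W.R_simps distrib_left Poly_Mapping.mult_single, simp add: word_monoid_def plus_list_def)
  with subset_UNIV[of "pkeys x"] show ?thesis unfolding free_star_alg_eq
    by (induction x rule: keys_add_single_induct) (simp_all add: W.R_simps distrib_right)
qed

lemma free_simps [simp]: "\<one>\<^bsub>free_star_alg\<^esub> = 1" "\<zero>\<^bsub>free_star_alg\<^esub> = 0"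
  "x \<oplus>\<^bsub>free_star_alg\<^esub> y = x + y" "c \<odot>\<^bsub>free_star_alg\<^esub> x = C c * x"
  "star free_star_alg x = adj x" "x \<ominus>\<^bsub>free_star_alg\<^esub> y = x - y"
proof -
  show "x \<ominus>\<^bsub>free_star_alg\<^esub> y = x - y"
    unfolding free_star_alg_eq
    by (rule W.a_minus_R) (simp_all only: free_carrier[unfolded free_star_alg_eq] UNIV_I)
  show "\<one>\<^bsub>free_star_alg\<^esub> = (1 :: 'n free_elt)"
    unfolding free_star_alg_eq W.simps_R by (simp add: word_monoid_def flip: zero_list_def)
qed (simp_all add: free_star_alg_eq W.simps_R scale_eq_C adj_def)

lemma free_finsum [simp]: "(\<Oplus>\<^bsub>free_star_alg\<^esub>i\<in>S. f i) = (\<Sum>i\<in>S. f i)"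
  by (induction S rule: infinite_finite_induct) (simp_all add: FS.M.finsum_infinite)

lemma adj_simps: "adj (x + y) = adj x + adj y" "adj (C c * x) = C (cnj c) * adj x"
  "adj (x * y) = adj y * adj x" "adj (adj x) = x"
  using FS.star_add[of x y] FS.star_smult[of x c] FS.star_mult[of x y] FS.star_star[of x] by simp_all

lemma adj_single: "adj (psingle w c) = psingle (flip w) (cnj c)"
  by (simp add: adj_def free_star_alg_eq W.star_single)

lemma adj_gen: "adj (gen i j b) = gen i j (\<not> b)"
  by (simp add: gen_def adj_single flip_def)

lemma adj_C: "adj (C c) = C (cnj c)"
  by (simp add: C_def adj_single flip_def zero_list_def)

lemma adj_0: "adj 0 = 0"
  using adj_C[of 0] by (simp add: C_simps)

lemma adj_diff: "adj (x - y) = adj x - adj y"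
  using adj_simps(1)[of "x - y" y] by simp

lemma adj_sum: "adj (\<Sum>i\<in>S. f i) = (\<Sum>i\<in>S. adj (f i))"
  by (induction S rule: infinite_finite_induct) (simp_all add: adj_simps adj_0)

section \<open>Matrices over the free algebra\<close>

abbreviation (input) "tr \<equiv> Finite_Cartesian_Product.transpose"

definition Um :: "bool \<Rightarrow> ('n free_elt)^'n^'n" where
  "Um b = (\<chi> i j. gen i j b)"

definition CM :: "complex^'n^'n \<Rightarrow> ('n free_elt)^'n^'n" where
  "CM M = (\<chi> i j. C (M $ i $ j))"

definition madj :: "('n free_elt)^'n^'n \<Rightarrow> ('n free_elt)^'n^'n" where
  "madj X = (\<chi> i j. adj (X $ j $ i))"

lemma CM_mult: "CM (X ** Y) = CM X ** CM Y"
  by (simp add: CM_def matrix_matrix_mult_def vec_eq_iff C_sum C_simps)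

lemma CM_one: "CM (mat 1) = mat 1"
  by (simp add: CM_def mat_def vec_eq_iff C_simps)

lemma madj_mult: "madj (X ** Y) = madj Y ** madj X"
  by (simp add: madj_def matrix_matrix_mult_def vec_eq_iff adj_sum adj_simps)

lemma madj_CM: "madj (CM X) = CM (cadj X)"
  by (simp add: madj_def CM_def cadj_def vec_eq_iff adj_C)

lemma madj_Um: "madj (Um b) = tr (Um (\<not> b))"
  by (simp add: madj_def Um_def Finite_Cartesian_Product.transpose_def vec_eq_iff adj_gen)

lemma free_mat: "mat_mult free_star_alg X Y = X ** Y" "mat_adj free_star_alg X = madj X"
  "mat_one free_star_alg = mat 1" "mat_scalar free_star_alg Q = CM Q" "free_gen = Um False"
  "mat_conj free_star_alg (Um False) = Um True"
  by (simp_all add: mat_mult_def matrix_matrix_mult_def mat_adj_def madj_def mat_one_def mat_def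
      mat_scalar_def CM_def free_gen_def Um_def gen_def mat_conj_def vec_eq_iff)
    (simp add: adj_gen[unfolded gen_def])

lemma twisted_conj_eq: "twisted_conj Q = CM Q ** Um True ** CM (matrix_inv Q)"
  by (simp add: twisted_conj_def free_mat)

context alg_ideal begin

definition meqv :: "'r^'n^'m \<Rightarrow> 'r^'n^'m \<Rightarrow> bool" (infix "\<approx>\<^sub>M" 50) where
  "X \<approx>\<^sub>M Y \<longleftrightarrow> (\<forall>i j. X $ i $ j \<approx>\<^sub>I Y $ i $ j)"

lemma meqv_refl: "X \<approx>\<^sub>M X"
  by (simp add: meqv_def)

lemma meqv_sym: "X \<approx>\<^sub>M Y \<Longrightarrow> Y \<approx>\<^sub>M X"
  by (simp add: meqv_def eqv_sym)

lemma meqv_trans [trans]: "\<lbrakk>X \<approx>\<^sub>M Y; Y \<approx>\<^sub>M Z\<rbrakk> \<Longrightarrow> X \<approx>\<^sub>M Z"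
  unfolding meqv_def by (blast intro: eqv_trans)

lemma meqv_mult: "\<lbrakk>X \<approx>\<^sub>M X'; Y \<approx>\<^sub>M Y'\<rbrakk> \<Longrightarrow> X ** Y \<approx>\<^sub>M X' ** Y'"
  for X X' :: "'r^'n^'m" and Y Y' :: "'r^'k^'n"
  by (simp add: meqv_def matrix_matrix_mult_def eqv_sum eqv_mult)

lemma meqv_sandwich: "Y \<approx>\<^sub>M Y' \<Longrightarrow> X ** Y ** Z \<approx>\<^sub>M X ** Y' ** Z"
  for X :: "'r^'n^'m" and Y Y' :: "'r^'k^'n" and Z :: "'r^'l^'k"
  by (intro meqv_mult meqv_refl)

end

lemma rel_entries:
  "(Um False ** tr (Um True)) $ i $ j = (\<Sum>k\<in>UNIV. gen i k False * gen j k True)"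
  "(tr (Um True) ** Um False) $ i $ j = (\<Sum>k\<in>UNIV. gen k i True * gen k j False)"
  "(Um True ** CM M ** tr (Um False)) $ i $ j
    = (\<Sum>k\<in>UNIV. \<Sum>l\<in>UNIV. gen i k True * gen j l False * C (M $ k $ l))"
  "(tr (Um False) ** CM N ** Um True) $ i $ j
    = (\<Sum>k\<in>UNIV. \<Sum>l\<in>UNIV. gen k i False * gen l j True * C (N $ k $ l))"
proof -
  have c: "x * C a * y = x * y * C a" for x y :: "'n free_elt" and a
    by (simp add: mult.assoc C_commute)
  show "(Um True ** CM M ** tr (Um False)) $ i $ j
    = (\<Sum>k\<in>UNIV. \<Sum>l\<in>UNIV. gen i k True * gen j l False * C (M $ k $ l))"
    by (subst sum.swap)
      (simp add: Um_def CM_def Finite_Cartesian_Product.transpose_def matrix_matrix_mult_def sum_distrib_right c)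
  show "(tr (Um False) ** CM N ** Um True) $ i $ j
    = (\<Sum>k\<in>UNIV. \<Sum>l\<in>UNIV. gen k i False * gen l j True * C (N $ k $ l))"
    by (subst sum.swap)
      (simp add: Um_def CM_def Finite_Cartesian_Product.transpose_def matrix_matrix_mult_def sum_distrib_right c)
qed (simp_all add: Um_def Finite_Cartesian_Product.transpose_def matrix_matrix_mult_def)

lemma unitarity_relators_subset:
  fixes X :: "('n::finite free_elt)^'n^'n"
  assumes "alg_ideal K"
  shows "unitarity_relators free_star_alg X \<subseteq> K \<longleftrightarrow>
     alg_ideal.meqv K (X ** madj X) (mat 1) \<and> alg_ideal.meqv K (madj X ** X) (mat 1)"
  unfolding unitarity_relators_def
  by (auto simp: free_mat alg_ideal.meqv_def[OF assms] alg_ideal.eqv_def[OF assms])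

text \<open>For \<open>X = Q u^c R\<close>, the product \<open>X ** madj X\<close> is
  \<open>u^c M u^T\<close> between \<open>Q\<close> and \<open>cadj Q\<close>, and
  \<open>madj X ** X\<close> is \<open>u^T N u^c\<close> between \<open>cadj R\<close> and
  \<open>R\<close>. These outer factors are invertible scalar matrices that carry \<open>M\<close>
  and \<open>N\<close> to the identity.\<close>

lemma rel_ideal_iff:
  fixes K :: "'n::finite free_elt set" and Q R :: "complex^'n^'n"
  assumes K: "alg_ideal K" and QR: "Q ** R = mat 1" "R ** Q = mat 1"
  shows "rel_ideal K (R ** cadj R) (cadj Q ** Q) \<longleftrightarrow>
    unitarity_relators free_star_alg (Um False) \<subseteq> K \<and>
    unitarity_relators free_star_alg (CM Q ** Um True ** CM R) \<subseteq> K"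
proof -
  interpret alg_ideal K by (rule K)
  let ?M = "R ** cadj R" and ?N = "cadj Q ** Q"
  have one: "cadj (mat 1 :: complex^'n^'n) = mat 1"
    by (auto simp: cadj_def mat_def vec_eq_iff)
  have QR': "cadj R ** cadj Q = mat 1" "cadj Q ** cadj R = mat 1"
    using QR by (simp_all add: one flip: cadj_mult)
  have inv: "?M ** ?N = mat 1" "?N ** ?M = mat 1"
    using QR QR' by (metis matrix_mul_assoc matrix_mul_rid)+
  have C: "CM Q ** CM R = mat 1" "CM R ** CM Q = mat 1"
    "CM (cadj R) ** CM (cadj Q) = mat 1" "CM (cadj Q) ** CM (cadj R) = mat 1"
    using QR QR' by (simp_all add: CM_one flip: CM_mult)
  let ?X = "CM Q ** Um True ** CM R"
  let ?r3 = "Um True ** CM ?M ** tr (Um False)"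
  let ?r4 = "tr (Um False) ** CM ?N ** Um True"
  have X1: "?X ** madj ?X = CM Q ** ?r3 ** CM (cadj Q)"
    by (simp add: madj_mult madj_CM madj_Um CM_mult matrix_mul_assoc)
  have X2: "madj ?X ** ?X = CM (cadj R) ** ?r4 ** CM R"
    by (simp add: madj_mult madj_CM madj_Um CM_mult matrix_mul_assoc)
  have 3: "?X ** madj ?X \<approx>\<^sub>M mat 1 \<longleftrightarrow> ?r3 \<approx>\<^sub>M CM ?M"
  proof
    assume "?X ** madj ?X \<approx>\<^sub>M mat 1"
    then have "CM R ** (?X ** madj ?X) ** CM (cadj R) \<approx>\<^sub>M CM R ** mat 1 ** CM (cadj R)"
      by (rule meqv_sandwich)
    also have "CM R ** (?X ** madj ?X) ** CM (cadj R) = (CM R ** CM Q) ** ?r3 ** (CM (cadj Q) ** CM (cadj R))"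
      unfolding X1 by (simp only: matrix_mul_assoc)
    finally show "?r3 \<approx>\<^sub>M CM ?M" by (simp add: C CM_mult)
  next
    assume "?r3 \<approx>\<^sub>M CM ?M"
    then have "CM Q ** ?r3 ** CM (cadj Q) \<approx>\<^sub>M CM Q ** CM ?M ** CM (cadj Q)"
      by (rule meqv_sandwich)
    also have "CM Q ** CM ?M ** CM (cadj Q) = (CM Q ** CM R) ** (CM (cadj R) ** CM (cadj Q))"
      by (simp only: CM_mult matrix_mul_assoc)
    finally show "?X ** madj ?X \<approx>\<^sub>M mat 1" by (simp add: C X1)
  qed
  have 4: "madj ?X ** ?X \<approx>\<^sub>M mat 1 \<longleftrightarrow> ?r4 \<approx>\<^sub>M CM ?N"
  proof
    assume "madj ?X ** ?X \<approx>\<^sub>M mat 1"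
    then have "CM (cadj Q) ** (madj ?X ** ?X) ** CM Q \<approx>\<^sub>M CM (cadj Q) ** mat 1 ** CM Q"
      by (rule meqv_sandwich)
    also have "CM (cadj Q) ** (madj ?X ** ?X) ** CM Q = (CM (cadj Q) ** CM (cadj R)) ** ?r4 ** (CM R ** CM Q)"
      unfolding X2 by (simp only: matrix_mul_assoc)
    finally show "?r4 \<approx>\<^sub>M CM ?N" by (simp add: C CM_mult)
  next
    assume "?r4 \<approx>\<^sub>M CM ?N"
    then have "CM (cadj R) ** ?r4 ** CM R \<approx>\<^sub>M CM (cadj R) ** CM ?N ** CM R"
      by (rule meqv_sandwich)
    also have "CM (cadj R) ** CM ?N ** CM R = (CM (cadj R) ** CM (cadj Q)) ** (CM Q ** CM R)"
      by (simp only: CM_mult matrix_mul_assoc)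
    finally show "madj ?X ** ?X \<approx>\<^sub>M mat 1" by (simp add: C X2)
  qed
  have "rel_ideal K ?M ?N \<longleftrightarrow> Um False ** madj (Um False) \<approx>\<^sub>M mat 1 \<and> madj (Um False) ** Um False \<approx>\<^sub>M mat 1
      \<and> ?r3 \<approx>\<^sub>M CM ?M \<and> ?r4 \<approx>\<^sub>M CM ?N"
    unfolding rel_ideal_def rel_ideal_axioms_def meqv_def
    using K inv by (simp add: rel_entries madj_Um) (simp add: CM_def mat_def)
  then show ?thesis
    using 3 4 by (simp add: unitarity_relators_subset[OF K])
qed

lemma adj_1: "adj 1 = 1"
  using adj_C[of 1] by (simp add: C_simps)

section \<open>Invariant functionals\<close>

locale linear_functional =
  fixes H :: "'n::finite free_elt \<Rightarrow> complex"
  assumes H_add: "H (x + y) = H x + H y" and H_scale: "H (C c * x) = c * H x"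
begin

lemma H_0: "H 0 = 0"
  using H_add[of 0 0] by simp

lemma H_sum: "H (\<Sum>i\<in>S. f i) = (\<Sum>i\<in>S. H (f i))"
  by (induction S rule: infinite_finite_induct) (simp_all add: H_0 H_add)

lemma H_minus: "H (x - y) = H x - H y"
  using H_add[of "x - y" y] by simp

lemma H_scale_right: "H (x * C c) = c * H x"
  by (simp add: H_scale flip: C_commute)

end

text \<open>The two invariance conditions are those of the Haar state, written out on coefficients:
  the comultiplication of the entry \<open>(I, J)\<close> is the sum over \<open>k\<close> of the
  entries \<open>(I, k)\<close> tensor \<open>(k, J)\<close>. No comultiplication on the free
  algebra is involved.\<close>

locale haar_ideal = alg_ideal K + linear_functional H
  for K :: "'n::finite free_elt set" and H :: "'n free_elt \<Rightarrow> complex" +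
  assumes H_K: "x \<in> K \<Longrightarrow> H x = 0" and H_1: "H 1 = 1"
    and inv_left: "\<lbrakk>I \<in> Lw \<epsilon>; J \<in> Lw \<epsilon>\<rbrakk> \<Longrightarrow>
      (\<Sum>k\<in>Lw \<epsilon>. C (H (co \<epsilon> I k)) * co \<epsilon> k J) \<approx>\<^sub>I C (H (co \<epsilon> I J))"
    and inv_right: "\<lbrakk>I \<in> Lw \<epsilon>; J \<in> Lw \<epsilon>\<rbrakk> \<Longrightarrow>
      (\<Sum>k\<in>Lw \<epsilon>. co \<epsilon> I k * C (H (co \<epsilon> k J))) \<approx>\<^sub>I C (H (co \<epsilon> I J))"
begin

lemma H_C: "H (C c) = c"
  using H_scale[of c 1] H_1 by simp

lemma H_eqv: "x \<approx>\<^sub>I y \<Longrightarrow> H x = H y"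
  using H_K[of "x - y"] by (simp add: eqv_def H_minus)

lemma idempotent:
  assumes "I \<in> Lw \<epsilon>" "J \<in> Lw \<epsilon>"
  shows "(\<Sum>k\<in>Lw \<epsilon>. H (co \<epsilon> I k) * H (co \<epsilon> k J)) = H (co \<epsilon> I J)"
  using H_eqv[OF inv_left[OF assms]] by (simp add: H_sum H_scale H_C)

text \<open>Let \<open>P\<close> be the averaging matrix with entries
  \<open>H (co \<epsilon> I J)\<close>. Applying \<open>H\<close> to the congruence gives
  \<open>P \<xi> = \<xi>\<close>; conversely \<open>\<xi> = P \<xi>\<close> is fixed because right
  invariance says \<open>u^\<epsilon> P = P\<close>.\<close>

lemma fixed_iff:
  "fixed_vec K \<epsilon> \<xi> \<longleftrightarrow> (\<forall>I\<in>Lw \<epsilon>. (\<Sum>J\<in>Lw \<epsilon>. H (co \<epsilon> I J) * \<xi> J) = \<xi> I)"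
proof
  assume f: "fixed_vec K \<epsilon> \<xi>"
  show "\<forall>I\<in>Lw \<epsilon>. (\<Sum>J\<in>Lw \<epsilon>. H (co \<epsilon> I J) * \<xi> J) = \<xi> I"
  proof
    fix I :: "'n list" assume "I \<in> Lw \<epsilon>"
    then have "(\<Sum>J\<in>Lw \<epsilon>. co \<epsilon> I J * C (\<xi> J)) \<approx>\<^sub>I C (\<xi> I)"
      using f by (simp add: fixed_vec_def)
    from H_eqv[OF this] show "(\<Sum>J\<in>Lw \<epsilon>. H (co \<epsilon> I J) * \<xi> J) = \<xi> I"
      by (simp add: H_sum H_scale_right H_C mult.commute)
  qed
next
  assume p: "\<forall>I\<in>Lw \<epsilon>. (\<Sum>J\<in>Lw \<epsilon>. H (co \<epsilon> I J) * \<xi> J) = \<xi> I"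
  show "fixed_vec K \<epsilon> \<xi>"
    unfolding fixed_vec_def
  proof
    fix I :: "'n list" assume I: "I \<in> Lw \<epsilon>"
    have "(\<Sum>J\<in>Lw \<epsilon>. co \<epsilon> I J * C (\<xi> J))
        = (\<Sum>J\<in>Lw \<epsilon>. co \<epsilon> I J * C (\<Sum>k\<in>Lw \<epsilon>. H (co \<epsilon> J k) * \<xi> k))"
      using p by simp
    also have "\<dots> = (\<Sum>J\<in>Lw \<epsilon>. \<Sum>k\<in>Lw \<epsilon>. co \<epsilon> I J * C (H (co \<epsilon> J k)) * C (\<xi> k))"
      by (simp add: C_sum C_simps sum_distrib_left mult.assoc)
    also have "\<dots> = (\<Sum>k\<in>Lw \<epsilon>. (\<Sum>J\<in>Lw \<epsilon>. co \<epsilon> I J * C (H (co \<epsilon> J k))) * C (\<xi> k))"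
      by (subst sum.swap) (simp add: sum_distrib_right)
    also have "\<dots> \<approx>\<^sub>I (\<Sum>k\<in>Lw \<epsilon>. C (H (co \<epsilon> I k)) * C (\<xi> k))"
      by (intro eqv_sum eqv_mult_right inv_right I)
    also have "\<dots> = C (\<xi> I)"
      using p I by (simp flip: C_simps C_sum)
    finally show "(\<Sum>J\<in>Lw \<epsilon>. co \<epsilon> I J * C (\<xi> J)) \<approx>\<^sub>I C (\<xi> I)" .
  qed
qed

subsection \<open>The invariant form\<close>

definition form :: "complex^'n^'n" where
  "form = (\<chi> i j. \<Sum>k\<in>UNIV. H (gen i k True * gen j k False))"

text \<open>Right invariance for the two-letter word of \<open>u^c\<close> and \<open>u\<close> in
  the column \<open>(p, p)\<close>, summed over \<open>p\<close>.\<close>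

lemma form_rel3:
  "(\<Sum>k\<in>UNIV. \<Sum>l\<in>UNIV. gen i k True * gen j l False * C (form $ k $ l)) \<approx>\<^sub>I C (form $ i $ j)"
proof -
  have "(\<Sum>k\<in>UNIV. \<Sum>l\<in>UNIV. gen i k True * gen j l False * C (H (gen k p True * gen l p False)))
      \<approx>\<^sub>I C (H (gen i p True * gen j p False))" for p
    using inv_right[of "[i, j]" "[True, False]" "[p, p]"]
    by (simp add: in_L_iff sum_L_Suc)
  then have "(\<Sum>p\<in>UNIV. \<Sum>k\<in>UNIV. \<Sum>l\<in>UNIV. gen i k True * gen j l False * C (H (gen k p True * gen l p False)))
      \<approx>\<^sub>I (\<Sum>p\<in>UNIV. C (H (gen i p True * gen j p False)))"
    by (intro eqv_sum)
  also have "(\<Sum>p\<in>UNIV. \<Sum>k\<in>UNIV. \<Sum>l\<in>UNIV. gen i k True * gen j l False * C (H (gen k p True * gen l p False)))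
      = (\<Sum>k\<in>UNIV. \<Sum>p\<in>UNIV. \<Sum>l\<in>UNIV. gen i k True * gen j l False * C (H (gen k p True * gen l p False)))"
    by (rule sum.swap)
  also have "\<dots> = (\<Sum>k\<in>UNIV. \<Sum>l\<in>UNIV. \<Sum>p\<in>UNIV. gen i k True * gen j l False * C (H (gen k p True * gen l p False)))"
    by (intro sum.cong refl sum.swap)
  finally show ?thesis
    by (simp add: form_def C_sum sum_distrib_left)
qed

text \<open>Cancelling \<open>u^c\<close> in the third relation by its inverse gives
  \<open>M u^T = Y M\<close>. Hence
  \<open>u^T N u^c = N (M u^T) N u^c = N Y M N u^c = N Y u^c = N\<close>.\<close>

lemma form_rel4:
  assumes N: "form ** N = mat 1" "N ** form = mat 1"
    and Y: "Um True ** Y \<approx>\<^sub>M mat 1" "Y ** Um True \<approx>\<^sub>M mat 1"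
  shows "tr (Um False) ** CM N ** Um True \<approx>\<^sub>M CM N"
proof -
  let ?M = "CM form"
  have MN: "?M ** CM N = mat 1" "CM N ** ?M = mat 1"
    using N by (simp_all add: CM_one flip: CM_mult)
  have r3: "Um True ** ?M ** tr (Um False) \<approx>\<^sub>M ?M"
    unfolding meqv_def using form_rel3 by (simp add: rel_entries) (simp add: CM_def)
  have "Y ** Um True ** (?M ** tr (Um False)) \<approx>\<^sub>M mat 1 ** (?M ** tr (Um False))"
    by (intro meqv_mult meqv_refl Y)
  then have "?M ** tr (Um False) \<approx>\<^sub>M Y ** (Um True ** ?M ** tr (Um False))"
    by (simp add: matrix_mul_assoc meqv_sym)
  also have "\<dots> \<approx>\<^sub>M Y ** ?M"
    by (intro meqv_mult meqv_refl r3)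
  finally have 1: "?M ** tr (Um False) \<approx>\<^sub>M Y ** ?M" .
  have "CM N ** (?M ** tr (Um False)) ** (CM N ** Um True) \<approx>\<^sub>M CM N ** (Y ** ?M) ** (CM N ** Um True)"
    by (rule meqv_sandwich[OF 1])
  also have "CM N ** (?M ** tr (Um False)) ** (CM N ** Um True) = tr (Um False) ** CM N ** Um True"
    by (metis MN(2) matrix_mul_assoc matrix_mul_lid)
  also have "CM N ** (Y ** ?M) ** (CM N ** Um True) = CM N ** (Y ** Um True)"
    by (metis MN(1) matrix_mul_assoc matrix_mul_lid)
  also have "\<dots> \<approx>\<^sub>M CM N ** mat 1"
    by (intro meqv_mult meqv_refl Y)
  finally show ?thesis by simp
qed

text \<open>By Cauchy--Schwarz a null vector of the form is annihilated by \<open>H\<close> even after multiplication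
  by the inverse of \<open>u\<^sup>T\<close>.\<close>

lemma form_pos_def:
  assumes pos: "\<And>x. 0 \<le> H (adj x * x)" and adjK: "\<And>x. x \<in> K \<Longrightarrow> adj x \<in> K"
    and Y: "Um True ** Y \<approx>\<^sub>M mat 1"
  shows "pos_def form"
  unfolding pos_def_def
proof (intro allI conjI impI)
  fix x :: "complex^'n"
  \<comment> \<open>In terms of these elements the value \<open>herm form x x\<close> becomes the
    sum of squares \<open>H (adj (y k) * y k)\<close>.\<close>
  define y where "y k = (\<Sum>j\<in>UNIV. C (x $ j) * gen j k False)" for k
  have "H (adj (y k) * y k) = (\<Sum>i\<in>UNIV. \<Sum>j\<in>UNIV. cnj (x $ i) * H (gen i k True * gen j k False) * x $ j)" for k
  proof -
    have "adj (y k) * y k = (\<Sum>i\<in>UNIV. \<Sum>j\<in>UNIV. C (cnj (x $ i)) * (C (x $ j) * (gen i k True * gen j k False)))"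
      by (simp add: y_def adj_sum adj_simps adj_gen adj_C sum_product mult.assoc C_left_commute[of "gen _ _ _"])
    then show ?thesis by (simp add: H_sum H_scale mult_ac)
  qed
  note y = this
  let ?a = "\<lambda>i j k. cnj (x $ i) * H (gen i k True * gen j k False) * x $ j"
  have "herm form x x = (\<Sum>i\<in>UNIV. \<Sum>j\<in>UNIV. \<Sum>k\<in>UNIV. ?a i j k)"
    by (simp add: herm_def form_def sum_distrib_left sum_distrib_right)
  also have "\<dots> = (\<Sum>i\<in>UNIV. \<Sum>k\<in>UNIV. \<Sum>j\<in>UNIV. ?a i j k)"
    by (intro sum.cong refl sum.swap)
  also have "\<dots> = (\<Sum>k\<in>UNIV. \<Sum>i\<in>UNIV. \<Sum>j\<in>UNIV. ?a i j k)"
    by (rule sum.swap)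
  finally have herm: "herm form x x = (\<Sum>k\<in>UNIV. H (adj (y k) * y k))"
    by (simp only: y)
  then show "0 \<le> herm form x x"
    using pos by (simp add: sum_nonneg)
  assume "herm form x x = 0"
  then have null: "H (adj (y k) * y k) = 0" for k
    using herm pos sum_nonneg_eq_0_iff[of UNIV "\<lambda>k. H (adj (y k) * y k)"] by simp
  have CS: "H (adj z * y k) = 0" for z k
  proof (rule form_null)
    fix t
    have "adj (z + C t * y k) * (z + C t * y k)
        = adj z * z + C t * (adj z * y k) + C (cnj t) * (adj (y k) * z) + C (cnj t) * (C t * (adj (y k) * y k))"
      by (simp add: adj_simps adj_C distrib_left distrib_right mult.assoc C_left_commute[of "adj _"]
          C_left_commute[of "C t" "cnj t"])
    then have "H (adj (z + C t * y k) * (z + C t * y k))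
        = H (adj z * z) + t * H (adj z * y k) + cnj t * H (adj (y k) * z)"
      by (simp add: H_add H_scale null)
    then show "0 \<le> H (adj z * z) + t * H (adj z * y k) + cnj t * H (adj (y k) * z)"
      using pos by metis
  qed
  have "x $ i = 0" for i
  proof -
    \<comment> \<open>The adjoint of the entry \<open>(j, i)\<close> of \<open>u^c Y = 1\<close>. It
      allows \<open>H\<close> to read off the coordinate \<open>x $ i\<close> from the elements
      \<open>y k\<close>.\<close>
    have e: "H (\<Sum>k\<in>UNIV. adj (Y $ k $ i) * gen j k False) = (if i = j then 1 else 0)" for j
    proof -
      have "(Um True ** Y) $ j $ i - mat 1 $ j $ i \<in> K"
        using Y by (simp add: meqv_def eqv_def)
      from H_K[OF adjK[OF this]] show ?thesis
        by (simp add: adj_diff H_minus matrix_matrix_mult_def Um_def adj_sum adj_simps adj_gen mat_def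
            adj_0 adj_1 H_0 H_1 eq_commute[of i j] split: if_splits)
    qed
    have "0 = (\<Sum>k\<in>UNIV. H (adj (Y $ k $ i) * y k))"
      by (simp add: CS)
    also have "\<dots> = (\<Sum>k\<in>UNIV. \<Sum>j\<in>UNIV. x $ j * H (adj (Y $ k $ i) * gen j k False))"
      by (simp add: y_def sum_distrib_left C_left_commute[of "adj _"] H_sum H_scale)
    also have "\<dots> = (\<Sum>j\<in>UNIV. x $ j * H (\<Sum>k\<in>UNIV. adj (Y $ k $ i) * gen j k False))"
      by (subst sum.swap) (simp add: H_sum sum_distrib_left)
    also have "\<dots> = x $ i"
      by (simp add: e if_distrib[of "\<lambda>x. _ * x"] cong: if_cong)
    finally show ?thesis by simp
  qed
  then show "x = 0" by (simp add: vec_eq_iff)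
qed

end

subsection \<open>Moments\<close>

definition nc_spanned :: "complex^'n::finite^'n \<Rightarrow> bool list \<Rightarrow> ('n list \<Rightarrow> complex) \<Rightarrow> bool" where
  "nc_spanned M \<epsilon> \<xi> \<longleftrightarrow> (\<exists>ls. length ls = length (nc M \<epsilon> []) \<and>
     (\<forall>J\<in>Lw \<epsilon>. \<xi> J = comb ls (nc M \<epsilon> []) J))"

lemma comb_nth: "length ls = length vs \<Longrightarrow> comb ls vs J = (\<Sum>t<length vs. ls ! t * (vs ! t) J)"
  by (simp add: comb_def sum_list_sum_nth split_def lessThan_atLeast0)

locale haar_rel = haar_ideal K H + rel_ideal K M N
  for K :: "'n::finite free_elt set" and H M N +
  fixes \<alpha> :: "bool \<Rightarrow> 'n \<Rightarrow> complex"
  assumes iso: "\<And>c. cup_form M c (\<alpha> c) (\<alpha> (\<not> c)) = 0"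
    and nz: "\<And>c. \<exists>z. cup_form M c (\<alpha> c) z \<noteq> 0"
begin

text \<open>The trace of the averaging idempotent is the dimension of the space of fixed vectors.\<close>

lemma trace_bound:
  "\<exists>r. (\<Sum>I\<in>Lw \<epsilon>. H (co \<epsilon> I I)) = of_nat r \<and> length (nc M \<epsilon> []) \<le> r \<and>
     (r = length (nc M \<epsilon> []) \<longrightarrow> (\<forall>\<xi>. fixv \<epsilon> \<xi> \<longrightarrow>
       nc_spanned M \<epsilon> \<xi>))"
proof -
  let ?vs = "nc M \<epsilon> []"
  have 1: "(\<Sum>J\<in>Lw \<epsilon>. H (co \<epsilon> I J) * (?vs ! t) J) = (?vs ! t) I"
    if "t \<in> {..<length ?vs}" "I \<in> Lw \<epsilon>" for t I
    using nc_fixed[of "?vs ! t" \<epsilon> "[]"] that by (simp add: fixed_iff)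
  have 2: "l t = 0"
    if l: "\<And>J. J \<in> Lw \<epsilon> \<Longrightarrow> (\<Sum>t\<in>{..<length ?vs}. l t * (?vs ! t) J) = 0"
      and t: "t \<in> {..<length ?vs}" for l t
  proof -
    define ls where "ls = map l [0..<length ?vs]"
    have c: "comb ls ?vs J = (\<Sum>t<length ?vs. l t * (?vs ! t) J)" for J
      by (subst comb_nth) (auto simp: ls_def)
    have "ev ys (comb ls ?vs) = 0" if "length ys = length \<epsilon>" for ys
    proof -
      have "ev ys (comb ls ?vs) = ev ys (\<lambda>_. 0)"
        by (rule ev_cong) (use that l c in \<open>simp add: in_L_iff\<close>)
      then show ?thesis by (simp add: ev_zero)
    qed
    then have "set ls \<subseteq> {0}"
      by (intro nc_independent[of M \<alpha> ls \<epsilon> "[]"] iso nz) (simp_all add: ls_def)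
    then show ?thesis using t by (simp add: ls_def image_subset_iff)
  qed
  have "\<exists>r. (\<Sum>I\<in>Lw \<epsilon>. H (co \<epsilon> I I)) = of_nat r \<and> card {..<length ?vs} \<le> r \<and>
     (r = card {..<length ?vs} \<longrightarrow>
     (\<forall>x. (\<forall>i\<in>Lw \<epsilon>. (\<Sum>j\<in>Lw \<epsilon>. H (co \<epsilon> i j) * x j) = x i) \<longrightarrow>
        (\<exists>l. \<forall>i\<in>Lw \<epsilon>. x i = (\<Sum>t\<in>{..<length ?vs}. l t * (?vs ! t) i))))"
    by (intro idempotent_trace finite_L finite_lessThan idempotent 1)
      (assumption | (rule 2; force))+
  then obtain r where r: "(\<Sum>I\<in>Lw \<epsilon>. H (co \<epsilon> I I)) = of_nat r" "length ?vs \<le> r"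
    "\<And>x. \<lbrakk>r = length ?vs; \<forall>i\<in>Lw \<epsilon>. (\<Sum>j\<in>Lw \<epsilon>. H (co \<epsilon> i j) * x j) = x i\<rbrakk> \<Longrightarrow>
        \<exists>l. \<forall>i\<in>Lw \<epsilon>. x i = (\<Sum>t<length ?vs. l t * (?vs ! t) i)"
    by auto
  have "nc_spanned M \<epsilon> \<xi>"
    if rl: "r = length ?vs" and fx: "fixv \<epsilon> \<xi>" for \<xi>
  proof -
    obtain l where l: "\<forall>i\<in>Lw \<epsilon>. \<xi> i = (\<Sum>t<length ?vs. l t * (?vs ! t) i)"
      using r(3)[OF rl, of \<xi>] fx fixed_iff by blast
    have "comb (map l [0..<length ?vs]) ?vs J = (\<Sum>t<length ?vs. l t * (?vs ! t) J)" for J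
      by (subst comb_nth) auto
    with l show ?thesis
      unfolding nc_spanned_def by (intro exI[of _ "map l [0..<length ?vs]"]) simp
  qed
  with r(1,2) show ?thesis by blast
qed

lemma power_expand:
  fixes a :: "bool \<Rightarrow> 'r::semiring_1"
  shows "(a True + a False) ^ k = (\<Sum>\<epsilon> | length \<epsilon> = k. prod_list (map a \<epsilon>))"
proof (induction k)
  case (Suc k)
  show ?case
    by (simp add: Suc sum_bool_lists_Suc sum.distrib distrib_right sum_distrib_left)
qed simp

lemma prod_list_trace:
  "prod_list (map (\<lambda>b. \<Sum>i\<in>UNIV. gen i i b) \<epsilon>) = (\<Sum>I\<in>Lw \<epsilon>. co \<epsilon> I I)"
  by (induction \<epsilon>) (simp_all add: sum_L_Suc sum_product)

lemma moment_expand: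
  "H (((\<Sum>i\<in>UNIV. gen i i False) + (\<Sum>i\<in>UNIV. gen i i True)) ^ k)
    = (\<Sum>\<epsilon> | length \<epsilon> = k. \<Sum>I\<in>Lw \<epsilon>. H (co \<epsilon> I I))"
  by (subst add.commute, subst power_expand[of "\<lambda>b. \<Sum>i\<in>UNIV. gen i i b"])
    (simp add: H_sum prod_list_trace)

text \<open>A sum of termwise inequalities is an equality only if every term is one, so an extremal
  \<open>k\<close>-th moment determines the fixed vectors of each single word of length
  \<open>k\<close>.\<close>

lemma moments:
  "\<exists>R. H (((\<Sum>i\<in>UNIV. gen i i False) + (\<Sum>i\<in>UNIV. gen i i True)) ^ k) = of_nat R \<and> dyck k 0 \<le> R \<and>
     (R = dyck k 0 \<longrightarrow> (\<forall>\<epsilon> \<xi>. length \<epsilon> = k \<longrightarrow> fixv \<epsilon> \<xi> \<longrightarrow>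
       nc_spanned M \<epsilon> \<xi>))"
proof -
  have "\<exists>r. \<forall>\<epsilon>. (\<Sum>I\<in>Lw \<epsilon>. H (co \<epsilon> I I)) = of_nat (r \<epsilon>) \<and> length (nc M \<epsilon> []) \<le> r \<epsilon> \<and>
     (r \<epsilon> = length (nc M \<epsilon> []) \<longrightarrow> (\<forall>\<xi>. fixv \<epsilon> \<xi> \<longrightarrow>
       nc_spanned M \<epsilon> \<xi>))"
    by (rule choice, rule allI, rule trace_bound)
  then obtain r where all: "\<forall>\<epsilon>. (\<Sum>I\<in>Lw \<epsilon>. H (co \<epsilon> I I)) = of_nat (r \<epsilon>) \<and> length (nc M \<epsilon> []) \<le> r \<epsilon> \<and>
     (r \<epsilon> = length (nc M \<epsilon> []) \<longrightarrow> (\<forall>\<xi>. fixv \<epsilon> \<xi> \<longrightarrow>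
       nc_spanned M \<epsilon> \<xi>))" ..
  then have r: "(\<Sum>I\<in>Lw \<epsilon>. H (co \<epsilon> I I)) = of_nat (r \<epsilon>)" "length (nc M \<epsilon> []) \<le> r \<epsilon>" for \<epsilon>
    by simp_all
  have eq: "nc_spanned M \<epsilon> \<xi>"
    if "r \<epsilon> = length (nc M \<epsilon> [])" "fixv \<epsilon> \<xi>" for \<epsilon> \<xi>
    using all that by blast
  let ?E = "{\<epsilon> :: bool list. length \<epsilon> = k}"
  have "(\<Sum>\<epsilon>\<in>?E. length (nc M \<epsilon> [])) = dyck k 0"
    using sum_length_nc[where s = "[]"] by simp
  moreover have "H (((\<Sum>i\<in>UNIV. gen i i False) + (\<Sum>i\<in>UNIV. gen i i True)) ^ k) = of_nat (\<Sum>\<epsilon>\<in>?E. r \<epsilon>)"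
    by (simp only: moment_expand r(1) of_nat_sum)
  moreover have "(\<Sum>\<epsilon>\<in>?E. length (nc M \<epsilon> [])) \<le> (\<Sum>\<epsilon>\<in>?E. r \<epsilon>)"
    by (intro sum_mono r(2))
  moreover have "r \<epsilon> = length (nc M \<epsilon> [])"
    if "(\<Sum>\<epsilon>\<in>?E. r \<epsilon>) = (\<Sum>\<epsilon>\<in>?E. length (nc M \<epsilon> []))" "length \<epsilon> = k" for \<epsilon>
  proof (rule ccontr)
    assume "r \<epsilon> \<noteq> length (nc M \<epsilon> [])"
    then have "(\<Sum>\<epsilon>\<in>?E. length (nc M \<epsilon> [])) < (\<Sum>\<epsilon>\<in>?E. r \<epsilon>)"
      using that(2) r(2) by (intro sum_strict_mono_ex1) (auto intro!: bexI[of _ \<epsilon>] simp: le_neq_implies_less)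
    then show False using that(1) by simp
  qed
  ultimately show ?thesis using eq by (intro exI[of _ "\<Sum>\<epsilon>\<in>?E. r \<epsilon>"]) auto
qed

end

section \<open>Comparison of two ideals\<close>

text \<open>On coefficients, \<open>Phi H y\<close> is the map \<open>x \<mapsto> x\<^sub>(\<^sub>1\<^sub>) H(x\<^sub>(\<^sub>2\<^sub>) y)\<close> in Sweedler notation.\<close>

definition phi :: "('n::finite free_elt \<Rightarrow> complex) \<Rightarrow> 'n free_elt \<Rightarrow> ('n \<times> 'n \<times> bool) list \<Rightarrow> 'n free_elt" where
  "phi H y w = (\<Sum>m\<in>L (length w). co (map (snd \<circ> snd) w) (map fst w) m *
     C (H (co (map (snd \<circ> snd) w) m (map (fst \<circ> snd) w) * y)))"

abbreviation "Phi H y \<equiv> ext (phi H y)"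

lemma ext_fun_add: "ext (\<lambda>p. \<psi> p + \<psi>' p) f = ext \<psi> f + ext \<psi>' f"
  by (simp add: ext_def lin_fun_add distrib_left)

lemma ext_fun_scale: "ext (\<lambda>p. C c * \<psi> p) f = C c * ext \<psi> f"
  by (simp add: ext_def lin_def sum_distrib_left C_left_commute[where c = c])

context linear_functional begin

lemma Phi_add: "Phi H (y + z) x = Phi H y x + Phi H z x"
proof -
  have "phi H (y + z) = (\<lambda>w. phi H y w + phi H z w)"
    by (simp add: phi_def fun_eq_iff distrib_left H_add C_simps sum.distrib)
  then show ?thesis by (simp add: ext_fun_add)
qed

lemma Phi_scale: "Phi H (C c * y) x = C c * Phi H y x"
proof -
  have "phi H (C c * y) = (\<lambda>w. C c * phi H y w)"
    by (simp add: phi_def fun_eq_iff C_left_commute[of "co _ _ _"] H_scale C_simps sum_distrib_left)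
  then show ?thesis by (simp add: ext_fun_scale)
qed

lemma Phi_0: "Phi H 0 x = 0"
  using Phi_scale[of 0 0 x] by (simp add: C_simps)

lemma Phi_co:
  assumes "I \<in> Lw \<epsilon>" "J \<in> Lw \<epsilon>"
  shows "Phi H y (co \<epsilon> I J) = (\<Sum>m\<in>Lw \<epsilon>. co \<epsilon> I m * C (H (co \<epsilon> m J * y)))"
proof -
  have "map fst (zip I (zip J \<epsilon>)) = I" "map (fst \<circ> snd) (zip I (zip J \<epsilon>)) = J"
    "map (snd \<circ> snd) (zip I (zip J \<epsilon>)) = \<epsilon>"
    using assms by (simp_all add: in_L_iff flip: map_map)
  then show ?thesis
    using assms by (simp add: co_def[of \<epsilon> I J] ext_simps phi_def C_simps in_L_iff)
qed

end

locale two_ideals = K: haar_ideal K H + I: rel_ideal I M N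
  for K I :: "'n::finite free_elt set" and H M N +
  assumes fixed_imp: "fixed_vec K \<epsilon> \<xi> \<Longrightarrow> fixed_vec I \<epsilon> \<xi>"
begin

text \<open>The point of the right-hand side is that \<open>w\<close> occurs there only inside
  \<open>H\<close>, as a left factor; extended linearly to elements of \<open>K\<close>, it
  vanishes.\<close>

lemma phi_eqv:
  fixes w :: "('n \<times> 'n \<times> bool) list"
  assumes q: "q \<in> Lw \<delta>" and p: "p \<in> Lw \<delta>"
    and W: "\<And>k. k \<in> Lw \<delta> \<Longrightarrow>
      I.eqv (\<Sum>i\<in>Lw \<delta>. co \<delta> i k * W i) (if k = p then 1 else 0)"
  shows "I.eqv (phi H (co \<delta> p q) w)
    (\<Sum>i\<in>Lw \<delta>. C (H (psingle w 1 * co \<delta> i q)) * W i)"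
proof -
  define \<epsilon> a b where "\<epsilon> = map (snd \<circ> snd) w" and "a = map fst w" and "b = map (fst \<circ> snd) w"
  have len: "length w = length \<epsilon>" and a: "a \<in> Lw \<epsilon>" and b: "b \<in> Lw \<epsilon>"
    by (simp_all add: \<epsilon>_def a_def b_def in_L_iff)
  have w: "psingle w 1 = co \<epsilon> a b"
    by (simp add: single_eq_co \<epsilon>_def a_def b_def)
  let ?c = "\<lambda>m k. C (H (co \<epsilon> m b * co \<delta> k q))"
  have fixd: "I.eqv (\<Sum>m\<in>Lw \<epsilon>. \<Sum>k\<in>Lw \<delta>. co \<epsilon> a m * co \<delta> i k * ?c m k) (?c a i)"
    if i: "i \<in> Lw \<delta>" for i
  proof -
    \<comment> \<open>By right invariance the columns of the averaging matrix are fixed vectors;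
      this is the column \<open>b @ q\<close>.\<close>
    have "fixed_vec K (\<epsilon> @ \<delta>) (\<lambda>X. H (co (\<epsilon> @ \<delta>) X (b @ q)))"
      unfolding fixed_vec_def using b q by (intro ballI K.inv_right) (auto simp: in_L_iff)
    then have "fixed_vec I (\<epsilon> @ \<delta>) (\<lambda>X. H (co (\<epsilon> @ \<delta>) X (b @ q)))"
      by (rule fixed_imp)
    then have "I.eqv (\<Sum>X\<in>L (length \<epsilon> + length \<delta>). co (\<epsilon> @ \<delta>) (a @ i) X * C (H (co (\<epsilon> @ \<delta>) X (b @ q))))
        (C (H (co (\<epsilon> @ \<delta>) (a @ i) (b @ q))))"
      using a i unfolding fixed_vec_def by (simp add: in_L_iff)
    then show ?thesis
      using a b i q by (simp add: sum_L_append co_append in_L_iff)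
  qed
  have "phi H (co \<delta> p q) w = (\<Sum>m\<in>Lw \<epsilon>. co \<epsilon> a m * ?c m p)"
    by (simp add: phi_def \<epsilon>_def a_def b_def)
  also have "\<dots> = (\<Sum>m\<in>Lw \<epsilon>. \<Sum>k\<in>Lw \<delta>. co \<epsilon> a m * (if k = p then 1 else 0) * ?c m k)"
  proof (rule sum.cong[OF refl])
    fix m
    have "(\<Sum>k\<in>Lw \<delta>. co \<epsilon> a m * (if k = p then 1 else 0) * ?c m k)
        = (\<Sum>k\<in>Lw \<delta>. if k = p then co \<epsilon> a m * ?c m k else 0)"
      by (rule sum.cong) auto
    then show "co \<epsilon> a m * ?c m p = (\<Sum>k\<in>Lw \<delta>. co \<epsilon> a m * (if k = p then 1 else 0) * ?c m k)"
      using p by simp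
  qed
  finally have 1: "phi H (co \<delta> p q) w
      = (\<Sum>m\<in>Lw \<epsilon>. \<Sum>k\<in>Lw \<delta>. co \<epsilon> a m * (if k = p then 1 else 0) * ?c m k)" .
  \<comment> \<open>Writing the delta as coefficients of \<open>\<delta>\<close> times
    \<open>W\<close> supplies the factor that completes \<open>co \<epsilon> a m\<close> to a
    coefficient of the concatenated word.\<close>
  have 2: "I.eqv (phi H (co \<delta> p q) w) (\<Sum>m\<in>Lw \<epsilon>. \<Sum>k\<in>Lw \<delta>.
      co \<epsilon> a m * (\<Sum>i\<in>Lw \<delta>. co \<delta> i k * W i) * ?c m k)"
    unfolding 1
    by (intro I.eqv_sum I.eqv_mult_left I.eqv_mult_right I.eqv_sym[OF W])
  have 3: "(\<Sum>m\<in>Lw \<epsilon>. \<Sum>k\<in>Lw \<delta>. co \<epsilon> a m * (\<Sum>i\<in>Lw \<delta>. co \<delta> i k * W i) * ?c m k)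
      = (\<Sum>i\<in>Lw \<delta>. (\<Sum>m\<in>Lw \<epsilon>. \<Sum>k\<in>Lw \<delta>. co \<epsilon> a m * co \<delta> i k * ?c m k) * W i)"
  proof -
    have "(\<Sum>m\<in>Lw \<epsilon>. \<Sum>k\<in>Lw \<delta>. co \<epsilon> a m * (\<Sum>i\<in>Lw \<delta>. co \<delta> i k * W i) * ?c m k)
        = (\<Sum>m\<in>Lw \<epsilon>. \<Sum>k\<in>Lw \<delta>. \<Sum>i\<in>Lw \<delta>. co \<epsilon> a m * co \<delta> i k * ?c m k * W i)"
      by (simp add: sum_distrib_left sum_distrib_right mult.assoc C_commute[of _ "W _"])
    also have "\<dots> = (\<Sum>m\<in>Lw \<epsilon>. \<Sum>i\<in>Lw \<delta>. \<Sum>k\<in>Lw \<delta>. co \<epsilon> a m * co \<delta> i k * ?c m k * W i)"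
      by (intro sum.cong refl sum.swap)
    also have "\<dots> = (\<Sum>i\<in>Lw \<delta>. \<Sum>m\<in>Lw \<epsilon>. \<Sum>k\<in>Lw \<delta>. co \<epsilon> a m * co \<delta> i k * ?c m k * W i)"
      by (rule sum.swap)
    finally show ?thesis by (simp only: sum_distrib_right)
  qed
  have "I.eqv (\<Sum>i\<in>Lw \<delta>. (\<Sum>m\<in>Lw \<epsilon>. \<Sum>k\<in>Lw \<delta>. co \<epsilon> a m * co \<delta> i k * ?c m k) * W i)
      (\<Sum>i\<in>Lw \<delta>. ?c a i * W i)"
    by (intro I.eqv_sum I.eqv_mult_right fixd)
  then show ?thesis
    using I.eqv_trans[OF 2] unfolding 3 w by blast
qed

text \<open>By linearity \<open>y\<close> may be taken to be a single word, hence a coefficient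
  \<open>co \<delta> p q\<close>. Then \<open>phi_eqv\<close> leaves only values of \<open>H\<close>
  on products \<open>x * co \<delta> i q\<close>, which lie in \<open>K\<close>.\<close>

lemma Phi_in:
  assumes x: "x \<in> K"
  shows "Phi H y x \<in> I"
  using subset_UNIV[of "pkeys y"]
proof (induction y rule: keys_add_single_induct)
  case (single w' c)
  define \<delta> p q where "\<delta> = map (snd \<circ> snd) w'" and "p = map fst w'" and "q = map (fst \<circ> snd) w'"
  have p: "p \<in> Lw \<delta>" and q: "q \<in> Lw \<delta>"
    by (simp_all add: \<delta>_def p_def q_def in_L_iff)
  obtain W' where W': "\<forall>k\<in>Lw \<delta>. \<forall>m\<in>Lw \<delta>.
     I.eqv (\<Sum>i\<in>Lw \<delta>. co \<delta> i k * W' i m) (if k = m then 1 else 0)"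
    using I.word_right_inverse[of \<delta>] by blast
  define W where "W i = W' i p" for i
  have W: "I.eqv (\<Sum>i\<in>Lw \<delta>. co \<delta> i k * W i) (if k = p then 1 else 0)"
    if "k \<in> Lw \<delta>" for k
    using W' p that by (simp add: W_def)
  let ?r = "\<lambda>z. \<Sum>i\<in>Lw \<delta>. C (H (z * co \<delta> i q)) * W i"
  have "I.eqv (Phi H (co \<delta> p q) z) (?r z)" for z
    using subset_UNIV[of "pkeys z"]
  proof (induction z rule: keys_add_single_induct)
    case zero
    then show ?case by (simp add: ext_simps K.H_0 C_simps)
  next
    case (single w a)
    have "psingle w a = C a * psingle w 1"
      by (rule single_eq_C)
    then have "?r (psingle w a) = C a * ?r (psingle w 1)"
      by (simp add: mult.assoc K.H_scale C_simps sum_distrib_left)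
    then show ?case
      using I.eqv_mult_left[OF phi_eqv[OF q p W, where w = w], where a = "C a"] by (simp add: ext_simps)
  next
    case (add f g)
    have "?r (f + g) = ?r f + ?r g"
      by (simp add: distrib_right K.H_add C_simps sum.distrib)
    then show ?case using add by (simp add: ext_simps I.eqv_add)
  qed
  from this[of x] have "I.eqv (Phi H (co \<delta> p q) x) 0"
    using x by (simp add: K.H_K K.right_in C_simps)
  then have "Phi H (co \<delta> p q) x \<in> I"
    by (simp add: I.eqv_0)
  moreover have "psingle w' c = C c * co \<delta> p q"
    unfolding \<delta>_def p_def q_def single_eq_co[symmetric] by (rule single_eq_C)
  ultimately show ?case by (simp add: K.Phi_scale I.left_in)
qed (simp_all add: K.Phi_0 K.Phi_add I.zero_in I.add_in)

text \<open>In Sweedler notation, with counit \<open>e\<close>: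
  \<open>x_1 H(x_2 S(x_3)) = x_1 e(x_2) H(1) = x\<close>.\<close>

lemma Phi_antipode:
  fixes S :: "'n free_elt \<Rightarrow> 'n free_elt"
  assumes S: "\<And>n J. \<lbrakk>n \<in> Lw \<epsilon>; J \<in> Lw \<epsilon>\<rbrakk> \<Longrightarrow>
      K.eqv (\<Sum>m\<in>Lw \<epsilon>. co \<epsilon> n m * S (co \<epsilon> m J)) (if n = J then 1 else 0)"
    and a: "a \<in> Lw \<epsilon>" and b: "b \<in> Lw \<epsilon>"
  shows "(\<Sum>m\<in>Lw \<epsilon>. Phi H (S (co \<epsilon> m b)) (co \<epsilon> a m)) = co \<epsilon> a b"
proof -
  have "(\<Sum>m\<in>Lw \<epsilon>. Phi H (S (co \<epsilon> m b)) (co \<epsilon> a m))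
      = (\<Sum>m\<in>Lw \<epsilon>. \<Sum>n\<in>Lw \<epsilon>. co \<epsilon> a n * C (H (co \<epsilon> n m * S (co \<epsilon> m b))))"
    by (rule sum.cong[OF refl]) (rule K.Phi_co[OF a])
  also have "\<dots> = (\<Sum>n\<in>Lw \<epsilon>. co \<epsilon> a n * C (H (\<Sum>m\<in>Lw \<epsilon>. co \<epsilon> n m * S (co \<epsilon> m b))))"
    by (subst sum.swap) (simp add: K.H_sum C_sum sum_distrib_left)
  also have "\<dots> = (\<Sum>n\<in>Lw \<epsilon>. co \<epsilon> a n * C (H (if n = b then 1 else 0)))"
    by (intro sum.cong refl arg_cong2[where f = "(*)"] arg_cong[where f = C] K.H_eqv S b)
  also have "\<dots> = (\<Sum>n\<in>Lw \<epsilon>. if n = b then co \<epsilon> a n else 0)"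
    by (rule sum.cong) (auto simp: K.H_1 K.H_0 C_simps)
  also have "\<dots> = co \<epsilon> a b"
    using b by simp
  finally show ?thesis .
qed

end

section \<open>Evaluation of the free algebra in a star-algebra\<close>

definition letter :: "'a star_alg \<Rightarrow> 'a^'n^'n \<Rightarrow> 'n \<times> 'n \<times> bool \<Rightarrow> 'a" where
  "letter A u = (\<lambda>(i, j, b). if b then star A (u $ i $ j) else u $ i $ j)"

primrec wd :: "'a star_alg \<Rightarrow> 'a^'n^'n \<Rightarrow> ('n \<times> 'n \<times> bool) list \<Rightarrow> 'a" where
  "wd A u [] = \<one>\<^bsub>A\<^esub>"
| "wd A u (l # w) = letter A u l \<otimes>\<^bsub>A\<^esub> wd A u w"

locale star_rep = star_algebra A for A :: "'a star_alg" (structure) +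
  fixes u :: "'a^'n::finite^'n"
  assumes u_closed: "u $ i $ j \<in> carrier A"
begin

definition rep :: "'n free_elt \<Rightarrow> 'a" where
  "rep x = (\<Oplus>w\<in>pkeys x. plookup x w \<odot> wd A u w)"

lemma letter_closed: "letter A u l \<in> carrier A"
  by (cases l) (simp add: letter_def u_closed star_closed)

lemma wd_closed: "wd A u w \<in> carrier A"
  by (induction w) (simp_all add: letter_closed)

lemma rep_closed: "rep x \<in> carrier A"
  unfolding rep_def by (rule M.finsum_closed) (simp add: wd_closed)

lemma zero_smult: "x \<in> carrier A \<Longrightarrow> 0 \<odot> x = \<zero>"
  using smult_l_null[of x] by simp

lemma smult_add: "x \<in> carrier A \<Longrightarrow> (a + b) \<odot> x = a \<odot> x \<oplus> b \<odot> x"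
  using smult_l_distr[of a b x] by simp

lemma smult_smult: "x \<in> carrier A \<Longrightarrow> (a * b) \<odot> x = a \<odot> (b \<odot> x)"
  using smult_assoc1[of a b x] by simp

lemma smult_commute: "x \<in> carrier A \<Longrightarrow> a \<odot> (b \<odot> x) = b \<odot> (a \<odot> x)"
  by (simp add: mult.commute flip: smult_smult)

lemma one_smult: "x \<in> carrier A \<Longrightarrow> 1 \<odot> x = x"
  using smult_one[of x] by simp

lemma rep_superset:
  assumes "finite S" "pkeys x \<subseteq> S"
  shows "rep x = (\<Oplus>w\<in>S. plookup x w \<odot> wd A u w)"
  unfolding rep_def using assms
  by (intro M.add.finprod_mono_neutral_cong_left)
    (auto simp: wd_closed zero_smult in_keys_iff)

lemma rep_add: "rep (x + y) = rep x \<oplus> rep y"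
proof -
  let ?S = "pkeys x \<union> pkeys y"
  have "rep (x + y) = (\<Oplus>w\<in>?S. plookup x w \<odot> wd A u w \<oplus> plookup y w \<odot> wd A u w)"
    by (subst rep_superset[of ?S])
      (auto simp: lookup_add smult_add wd_closed Poly_Mapping.keys_add intro!: M.finsum_cong')
  also have "\<dots> = rep x \<oplus> rep y"
    by (simp add: rep_superset[of ?S] M.finsum_addf wd_closed)
  finally show ?thesis .
qed

lemma rep_single: "rep (psingle w c) = c \<odot> wd A u w"
  by (subst rep_superset[of "{w}"]) (simp_all add: wd_closed)

lemma rep_0: "rep 0 = \<zero>"
  by (simp add: rep_def)

lemma rep_sum: "finite S \<Longrightarrow> rep (\<Sum>i\<in>S. f i) = (\<Oplus>i\<in>S. rep (f i))"
  by (induction S rule: finite_induct) (simp_all add: rep_0 rep_add rep_closed Pi_iff)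

lemma wd_append: "wd A u (v @ w) = wd A u v \<otimes> wd A u w"
  by (induction v) (simp_all add: wd_closed letter_closed m_assoc)

lemma rep_scale: "rep (C c * x) = c \<odot> rep x"
  using subset_UNIV[of "pkeys x"]
proof (induction x rule: keys_add_single_induct)
  case (single w a)
  have "C c * psingle w a = psingle w (c * a)"
    by (simp add: C_def Poly_Mapping.mult_single)
  then show ?case by (simp add: rep_single smult_smult wd_closed)
qed (simp_all add: rep_0 rep_add distrib_left smult_r_distr rep_closed)

lemma rep_mult: "rep (x * y) = rep x \<otimes> rep y"
  using subset_UNIV[of "pkeys x"]
proof (induction x rule: keys_add_single_induct)
  case (single w a)
  show ?case
    using subset_UNIV[of "pkeys y"]
    by (induction y rule: keys_add_single_induct)
      (simp_all add: rep_0 rep_add distrib_left r_distr rep_closed rep_single Poly_Mapping.mult_single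
        plus_list_def wd_append smult_smult smult_commute smult_mult_left smult_mult_right wd_closed)
qed (simp_all add: rep_0 rep_add distrib_right l_distr rep_closed)

lemma rep_1: "rep 1 = \<one>"
  unfolding single_one[symmetric] by (simp only: rep_single) (simp add: zero_list_def one_smult)

lemma rep_C: "rep (C c) = c \<odot> \<one>"
  using rep_scale[of c 1] by (simp add: rep_1)

lemma rep_minus: "rep (x - y) = rep x \<ominus> rep y"
proof -
  have "rep (x - y) \<oplus> rep y = rep x"
    using rep_add[of "x - y" y] by simp
  then show ?thesis
    by (metis rep_closed M.add.inv_solve_right' a_minus_def)
qed

lemma rep_gen: "rep (gen i j b) = letter A u (i, j, b)"
  by (simp add: gen_def rep_single one_smult letter_closed)

lemma rep_power: "rep (x ^ k) = rep x [^] k"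
  by (induction k) (simp_all add: rep_1 rep_mult power_Suc2 rep_closed del: power_Suc)

lemma star_zero: "star A \<zero> = \<zero>"
  by (metis M.zero_closed M.r_zero M.add.r_cancel_one' star_add star_closed)

lemma star_one: "star A \<one> = \<one>"
  by (metis one_closed star_closed star_mult star_star r_one l_one)

lemma star_letter: "star A (letter A u (i, j, b)) = letter A u (i, j, \<not> b)"
  by (simp add: letter_def star_star u_closed)

lemma wd_flip: "wd A u (flip w) = star A (wd A u w)"
proof (induction w)
  case (Cons l w)
  obtain i j b where "l = (i, j, b)" by (cases l)
  then show ?case
    using Cons by (simp add: flip_def wd_append star_mult letter_closed wd_closed star_letter)
qed (simp add: flip_def star_one)

lemma rep_adj: "rep (adj x) = star A (rep x)"
  using subset_UNIV[of "pkeys x"]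
  by (induction x rule: keys_add_single_induct)
    (simp_all add: adj_0 rep_0 star_zero adj_single rep_single wd_flip star_smult wd_closed
      adj_simps rep_add star_add rep_closed)

definition ker :: "'n free_elt set" where
  "ker = {x. rep x = \<zero>}"

sublocale K: alg_ideal ker
  by unfold_locales (simp_all add: ker_def rep_0 rep_add rep_mult rep_closed)

lemma eqv_iff: "K.eqv x y \<longleftrightarrow> rep x = rep y"
proof
  assume "K.eqv x y"
  then have "x - y \<in> ker" by (simp only: K.eqv_def)
  then have "rep (x - y) = \<zero>" by (simp add: ker_def)
  then show "rep x = rep y"
    using rep_add[of "x - y" y] rep_closed[of y] by simp
next
  assume "rep x = rep y"
  then show "K.eqv x y"
    using rep_closed[of y] unfolding K.eqv_def by (simp add: ker_def rep_minus a_minus_def M.r_neg)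
qed

lemma diff_in_ker: "x - y \<in> ker \<longleftrightarrow> rep x = rep y"
  using eqv_iff by (simp add: K.eqv_def)

lemma diff_diff_in_ker: "x - y - z \<in> ker \<longleftrightarrow> rep x = rep y \<oplus> rep z"
  using diff_in_ker[of x "y + z"] by (simp add: diff_diff_eq rep_add)

lemma adj_ker: "x \<in> ker \<Longrightarrow> adj x \<in> ker"
  by (simp add: ker_def rep_adj star_zero)

lemma rep_surj:
  assumes gen: "star_generated A {u $ i $ j | i j. True} = carrier A" and a: "a \<in> carrier A"
  shows "a \<in> range rep"
proof -
  have "a \<in> star_generated A {u $ i $ j | i j. True}"
    using gen a by simp
  then show ?thesis
  proof induction
    case (gen x)
    then obtain i j where "x = u $ i $ j" by blast
    then have "x = rep (gen i j False)" by (simp add: rep_gen letter_def)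
    then show ?case by blast
  next
    case one
    show ?case by (simp flip: rep_1)
  next
    case (add x y)
    then show ?case by (auto simp flip: rep_add)
  next
    case (smult x c)
    then show ?case by (auto simp flip: rep_scale)
  next
    case (mult x y)
    then show ?case by (auto simp flip: rep_mult)
  next
    case (star x)
    then show ?case by (auto simp flip: rep_adj)
  qed
qed

end

lemma (in star_monoid) finsum_R:
  assumes "f \<in> S \<rightarrow> carrier R" "finite S"
  shows "(\<Oplus>\<^bsub>R\<^esub>i\<in>S. f i) = (\<Sum>i\<in>S. f i)"
proof -
  interpret R: ring R by (rule ring_R)
  show ?thesis using assms(2,1)
    by (induction S rule: finite_induct) (simp_all add: simps_R)
qed

section \<open>The polynomial algebra of a discrete quantum group\<close>

locale discrete_qgroup =
  fixes \<Gamma> :: "('a, 'n::finite) qgroup"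
  assumes fg: "fg_discrete_quantum_group \<Gamma>"
begin

abbreviation "A \<equiv> pol \<Gamma>"
abbreviation "u \<equiv> fund \<Gamma>"
abbreviation "\<Delta> \<equiv> comult \<Gamma>"

lemma cqg: "compact_quantum_group A \<Delta>" and unitary: "mat_unitary A u"
  and comult_fund: "\<Delta> (u $ i $ j) = (\<Oplus>\<^bsub>tensor_alg A A\<^esub>k\<in>UNIV. tensor_elt A A (u $ i $ k) (u $ k $ j))"
  and generated: "star_generated A {u $ i $ j | i j. True} = carrier A"
  and conj_invertible: "mat_invertible A (mat_conj A u)"
  using fg by (simp_all add: fg_discrete_quantum_group_def)

lemma hopf: "hopf_star_algebra A \<Delta>"
  using cqg by (simp add: compact_quantum_group_def)

sublocale star_rep A u
proof -
  have "star_algebra A" using hopf by (simp add: hopf_star_algebra_def)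
  then show "star_rep A u"
    using unitary by (simp add: star_rep_def star_rep_axioms_def mat_unitary_def mat_carrier_def)
qed

sublocale TP: tensor_pair A A
  by unfold_locales

text \<open>An arbitrary choice of preimages, linear only modulo \<open>ker\<close>; this is what
  the subgroup \<open>W\<close> in \<open>bilinear_mod\<close> makes room for.\<close>

definition sec :: "'a \<Rightarrow> 'n free_elt" where
  "sec a = (SOME x. rep x = a)"

lemma rep_sec: "a \<in> carrier A \<Longrightarrow> rep (sec a) = a"
  using rep_surj[OF generated] unfolding sec_def by (metis (mono_tags) image_iff someI_ex)

definition haar :: "'a \<Rightarrow> complex" where
  "haar = haar_state A \<Delta>"

definition H :: "'n free_elt \<Rightarrow> complex" where
  "H x = haar (rep x)"

lemma haar: "is_haar_state A \<Delta> haar"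
  using cqg unfolding haar_def haar_state_def compact_quantum_group_def by (metis someI_ex)

lemma complex_alg_simps: "x \<oplus>\<^bsub>complex_alg\<^esub> y = x + y" "x \<otimes>\<^bsub>complex_alg\<^esub> y = x * y"
  "c \<odot>\<^bsub>complex_alg\<^esub> x = c * x" "\<one>\<^bsub>complex_alg\<^esub> = 1"
  by (simp_all add: complex_alg_def)

sublocale H: linear_functional H
  using haar by unfold_locales
    (simp_all add: is_haar_state_def linear_maps_def H_def rep_add rep_scale rep_closed complex_alg_simps)

lemma H_one: "H 1 = 1"
  using haar by (simp add: H_def rep_1 is_haar_state_def)

lemma H_ker: "x \<in> ker \<Longrightarrow> H x = 0"
  using H.H_0 by (simp add: H_def ker_def rep_0)

lemma H_pos: "0 \<le> H (adj x * x)"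
  using haar by (simp add: H_def is_haar_state_def rep_mult rep_adj rep_closed)

subsection \<open>The comultiplication\<close>

text \<open>A representative of the comultiplication among formal sums of pairs, additive in its
  argument on the nose; \<open>comult_rep\<close> identifies its class.\<close>

definition D :: "'n free_elt \<Rightarrow> 'a \<times> 'a \<Rightarrow>\<^sub>0 complex" where
  "D = lin (\<lambda>w c. \<Sum>m\<in>L (length w). psingle
     (rep (co (map (snd \<circ> snd) w) (map fst w) m), rep (co (map (snd \<circ> snd) w) m (map (fst \<circ> snd) w))) c)"

lemma D_simps: "D 0 = 0" "D (x + y) = D x + D y"
  by (simp_all add: D_def lin_add single_add sum.distrib)

lemma D_single:
  "D (psingle w c) = (\<Sum>m\<in>L (length w). psingle
     (rep (co (map (snd \<circ> snd) w) (map fst w) m), rep (co (map (snd \<circ> snd) w) m (map (fst \<circ> snd) w))) c)"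
  by (simp add: D_def lin_single)

lemma single_closed: "psingle (rep x, rep y) c \<in> carrier TP.P.R"
  by (rule TP.single_pair_in_R) (simp_all add: rep_closed)

lemma sum_closed: "(\<And>i. i \<in> S \<Longrightarrow> f i \<in> carrier TP.P.R) \<Longrightarrow> (\<Sum>i\<in>S. f i) \<in> carrier TP.P.R"
  by (induction S rule: infinite_finite_induct) (simp_all add: TP.P.zero_in_R TP.P.add_in_R)

lemma D_closed: "D x \<in> carrier TP.P.R"
  using subset_UNIV[of "pkeys x"]
  by (induction x rule: keys_add_single_induct)
    (auto simp: D_simps D_single TP.P.zero_in_R intro!: TP.P.add_in_R sum_closed single_closed)

lemma comult_hom: "\<Delta> \<in> star_hom A (tensor_alg A A)"
  using hopf by (simp add: hopf_star_algebra_def)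

lemma comult_simps:
  assumes "a \<in> carrier A" "b \<in> carrier A"
  shows "\<Delta> (a \<otimes>\<^bsub>A\<^esub> b) = \<Delta> a \<otimes>\<^bsub>tensor_alg A A\<^esub> \<Delta> b" "\<Delta> (a \<oplus>\<^bsub>A\<^esub> b) = \<Delta> a \<oplus>\<^bsub>tensor_alg A A\<^esub> \<Delta> b"
  using comult_hom assms by (auto simp: star_hom_def ring_hom_def linear_maps_def)

lemma comult_smult: "a \<in> carrier A \<Longrightarrow> \<Delta> (c \<odot>\<^bsub>A\<^esub> a) = c \<odot>\<^bsub>tensor_alg A A\<^esub> \<Delta> a"
  and comult_one: "\<Delta> \<one>\<^bsub>A\<^esub> = \<one>\<^bsub>tensor_alg A A\<^esub>"
  and comult_star: "a \<in> carrier A \<Longrightarrow> \<Delta> (star A a) = star (tensor_alg A A) (\<Delta> a)"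
  using comult_hom by (auto simp: star_hom_def ring_hom_def linear_maps_def)

text \<open>The axioms give the formula for the entries of \<open>u\<close> only; for
  \<open>u^c\<close> it follows since the comultiplication respects the star.\<close>

lemma comult_letter:
  "\<Delta> (rep (gen i j b)) = TP.TQ.cl (\<Sum>k\<in>UNIV. psingle (rep (gen i k b), rep (gen k j b)) 1)"
proof -
  let ?e = "\<lambda>i j k. psingle (rep (gen i k False), rep (gen k j False)) (1 :: complex)"
  have F: "\<Delta> (rep (gen i j False)) = TP.TQ.cl (\<Sum>k\<in>UNIV. ?e i j k)" for i j
  proof -
    have "\<Delta> (rep (gen i j False)) = (\<Oplus>\<^bsub>TP.TQ.T\<^esub>k\<in>UNIV. TP.TQ.cl (?e i j k))"
      by (simp add: rep_gen letter_def comult_fund TP.tensor_elt_eq TP.tensor_alg_eq)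
    also have "\<dots> = TP.TQ.cl (\<Oplus>\<^bsub>TP.P.R\<^esub>k\<in>UNIV. ?e i j k)"
      by (rule TP.TQ.cl_finsum) (auto simp: single_closed)
    finally show ?thesis
      by (subst (asm) TP.P.finsum_R) (auto simp: single_closed)
  qed
  show ?thesis
  proof (cases b)
    case True
    have "rep (gen i j True) = star A (rep (gen i j False))" for i j
      by (simp add: rep_gen letter_def)
    then have "\<Delta> (rep (gen i j True))
        = star TP.TQ.T (TP.TQ.cl (\<Sum>k\<in>UNIV. ?e i j k))"
      by (simp add: comult_star rep_closed F TP.tensor_alg_eq)
    also have "\<dots> = TP.TQ.cl (star TP.P.R (\<Sum>k\<in>UNIV. ?e i j k))"
      by (intro TP.TQ.cl_star sum_closed single_closed TP.star_tensor_ideal)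
    also have "star TP.P.R (\<Sum>k\<in>S. ?e i j k)
        = (\<Sum>k\<in>S. psingle (rep (gen i k True), rep (gen k j True)) 1)" for S :: "'n set"
      by (induction S rule: infinite_finite_induct)
        (simp_all add: TP.P.star_0 TP.P.star_add TP.P.star_single rep_gen letter_def)
    finally show ?thesis using True by simp
  qed (simp add: F)
qed

lemma mult_sum_R:
  "(\<Sum>i\<in>S. f i) \<otimes>\<^bsub>TP.P.R\<^esub> (\<Sum>j\<in>T. g j) = (\<Sum>i\<in>S. \<Sum>j\<in>T. f i \<otimes>\<^bsub>TP.P.R\<^esub> g j)"
proof -
  have "x \<otimes>\<^bsub>TP.P.R\<^esub> (\<Sum>j\<in>T. g j) = (\<Sum>j\<in>T. x \<otimes>\<^bsub>TP.P.R\<^esub> g j)" for x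
    by (induction T rule: infinite_finite_induct) (simp_all add: TP.P.R_simps)
  then show ?thesis
    by (induction S rule: infinite_finite_induct) (simp_all add: TP.P.R_simps sum.distrib)
qed

lemma comult_co:
  "\<lbrakk>I \<in> Lw \<epsilon>; J \<in> Lw \<epsilon>\<rbrakk> \<Longrightarrow>
    \<Delta> (rep (co \<epsilon> I J)) = TP.TQ.cl (\<Sum>m\<in>Lw \<epsilon>. psingle (rep (co \<epsilon> I m), rep (co \<epsilon> m J)) 1)"
proof (induction \<epsilon> arbitrary: I J)
  case Nil
  then show ?case
    by (simp add: rep_1 comult_one TP.tensor_alg_eq TP.TQ.T_simps TP.P.simps_R)
next
  case (Cons b \<epsilon>)
  obtain i I' j J' where IJ: "I = i # I'" "J = j # J'" "I' \<in> Lw \<epsilon>" "J' \<in> Lw \<epsilon>"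
    using Cons.prems by (auto elim!: L_SucE)
  have "\<Delta> (rep (co (b # \<epsilon>) I J)) = \<Delta> (rep (gen i j b)) \<otimes>\<^bsub>TP.TQ.T\<^esub> \<Delta> (rep (co \<epsilon> I' J'))"
    using IJ by (simp add: rep_mult comult_simps rep_closed TP.tensor_alg_eq)
  also have "\<dots> = TP.TQ.cl ((\<Sum>k\<in>UNIV. psingle (rep (gen i k b), rep (gen k j b)) 1) \<otimes>\<^bsub>TP.P.R\<^esub>
      (\<Sum>m\<in>Lw \<epsilon>. psingle (rep (co \<epsilon> I' m), rep (co \<epsilon> m J')) 1))"
    unfolding comult_letter Cons.IH[OF IJ(3,4)]
    by (intro TP.TQ.cl_mult sum_closed single_closed)
  also have "(\<Sum>k\<in>UNIV. psingle (rep (gen i k b), rep (gen k j b)) 1) \<otimes>\<^bsub>TP.P.R\<^esub>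
      (\<Sum>m\<in>Lw \<epsilon>. psingle (rep (co \<epsilon> I' m), rep (co \<epsilon> m J')) 1)
    = (\<Sum>m\<in>L (length (b # \<epsilon>)). psingle (rep (co (b # \<epsilon>) I m), rep (co (b # \<epsilon>) m J)) 1)"
    using IJ by (simp add: mult_sum_R TP.P.mult_single sum_L_Suc rep_mult)
  finally show ?case .
qed

lemma comult_rep: "\<Delta> (rep x) = TP.TQ.cl (D x)"
  using subset_UNIV[of "pkeys x"]
proof (induction x rule: keys_add_single_induct)
  case zero
  have "\<Delta> \<zero>\<^bsub>A\<^esub> = 0 \<odot>\<^bsub>tensor_alg A A\<^esub> \<Delta> \<one>\<^bsub>A\<^esub>"
    using comult_smult[of "\<one>\<^bsub>A\<^esub>" 0] by (simp add: zero_smult)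
  also have "\<dots> = TP.TQ.cl (0 \<odot>\<^bsub>TP.P.R\<^esub> \<one>\<^bsub>TP.P.R\<^esub>)"
    by (simp add: comult_one TP.tensor_alg_eq TP.TQ.T_simps TP.TQ.cl_smult)
  also have "0 \<odot>\<^bsub>TP.P.R\<^esub> \<one>\<^bsub>TP.P.R\<^esub> = 0"
    by (simp add: TP.P.simps_R scale_single)
  finally show ?case by (simp add: rep_0 D_simps)
next
  case (single w c)
  define \<epsilon> I J where "\<epsilon> = map (snd \<circ> snd) w" and "I = map fst w" and "J = map (fst \<circ> snd) w"
  have IJ: "I \<in> Lw \<epsilon>" "J \<in> Lw \<epsilon>" and len: "length w = length \<epsilon>"
    by (simp_all add: \<epsilon>_def I_def J_def in_L_iff)
  have "psingle w c = C c * co \<epsilon> I J"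
    unfolding \<epsilon>_def I_def J_def single_eq_co[symmetric] by (rule single_eq_C)
  then have "\<Delta> (rep (psingle w c)) = c \<odot>\<^bsub>TP.TQ.T\<^esub> \<Delta> (rep (co \<epsilon> I J))"
    by (simp add: rep_scale comult_smult rep_closed TP.tensor_alg_eq)
  also have "\<dots> = TP.TQ.cl (c \<odot>\<^bsub>TP.P.R\<^esub> (\<Sum>m\<in>Lw \<epsilon>. psingle (rep (co \<epsilon> I m), rep (co \<epsilon> m J)) 1))"
    unfolding comult_co[OF IJ] by (intro TP.TQ.cl_smult sum_closed single_closed)
  also have "c \<odot>\<^bsub>TP.P.R\<^esub> (\<Sum>m\<in>S. psingle (rep (co \<epsilon> I m), rep (co \<epsilon> m J)) 1)
      = (\<Sum>m\<in>S. psingle (rep (co \<epsilon> I m), rep (co \<epsilon> m J)) c)" for S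
    by (induction S rule: infinite_finite_induct) (simp_all add: TP.P.simps_R scale_add scale_single)
  finally show ?case
    by (simp add: D_single len flip: \<epsilon>_def I_def J_def)
next
  case (add f g)
  then show ?case
    by (simp add: rep_add comult_simps rep_closed D_simps TP.tensor_alg_eq TP.TQ.cl_add D_closed TP.P.simps_R)
qed

subsection \<open>Bilinear maps on the tensor square\<close>

text \<open>This turns the Hopf and Haar axioms, phrased through \<open>tensor_lift\<close>, into
  identities between coefficients. The definite description is well defined because
  \<open>\<beta>\<close> followed by \<open>sec\<close> is bilinear modulo \<open>ker\<close>, so
  that by \<open>tensor_ideal_lin\<close> all representatives give the same value.\<close>

lemma tensor_lift_co:
  assumes cl: "\<And>x y. \<lbrakk>x \<in> carrier A; y \<in> carrier A\<rbrakk> \<Longrightarrow> \<beta> x y \<in> carrier A"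
    and a1: "\<And>x x' y. \<lbrakk>x \<in> carrier A; x' \<in> carrier A; y \<in> carrier A\<rbrakk> \<Longrightarrow> \<beta> (x \<oplus>\<^bsub>A\<^esub> x') y = \<beta> x y \<oplus>\<^bsub>A\<^esub> \<beta> x' y"
    and a2: "\<And>x y y'. \<lbrakk>x \<in> carrier A; y \<in> carrier A; y' \<in> carrier A\<rbrakk> \<Longrightarrow> \<beta> x (y \<oplus>\<^bsub>A\<^esub> y') = \<beta> x y \<oplus>\<^bsub>A\<^esub> \<beta> x y'"
    and s1: "\<And>c x y. \<lbrakk>x \<in> carrier A; y \<in> carrier A\<rbrakk> \<Longrightarrow> \<beta> (c \<odot>\<^bsub>A\<^esub> x) y = c \<odot>\<^bsub>A\<^esub> \<beta> x y"
    and s2: "\<And>c x y. \<lbrakk>x \<in> carrier A; y \<in> carrier A\<rbrakk> \<Longrightarrow> \<beta> x (c \<odot>\<^bsub>A\<^esub> y) = c \<odot>\<^bsub>A\<^esub> \<beta> x y"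
    and IJ: "I \<in> Lw \<epsilon>" "J \<in> Lw \<epsilon>"
  shows "tensor_lift A \<beta> (\<Delta> (rep (co \<epsilon> I J))) = rep (\<Sum>m\<in>Lw \<epsilon>. sec (\<beta> (rep (co \<epsilon> I m)) (rep (co \<epsilon> m J))))"
proof -
  let ?\<psi> = "\<lambda>p. sec (\<beta> (fst p) (snd p))"
  define f where "f = (\<Sum>m\<in>Lw \<epsilon>. psingle (rep (co \<epsilon> I m), rep (co \<epsilon> m J)) (1::complex))"
  have f: "f \<in> carrier TP.P.R"
    unfolding f_def by (intro sum_closed single_closed)
  have bil: "TP.bilinear_mod ker (\<lambda>p c. C c * ?\<psi> p)"
    unfolding TP.bilinear_mod_def
    by (intro conjI allI ballI; (subst diff_diff_in_ker | subst diff_in_ker)?)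
      (simp_all add: C_simps distrib_right rep_scale rep_sec cl a1 a2 s1 s2 smult_r_distr smult_smult
        mult.assoc)
  have val: "(\<Oplus>\<^bsub>A\<^esub>p\<in>pkeys g. plookup g p \<odot>\<^bsub>A\<^esub> \<beta> (fst p) (snd p)) = rep (ext ?\<psi> f)"
    if g: "g \<in> TP.TQ.cl f" for g
  proof -
    have gR: "g \<in> carrier TP.P.R" "g - f \<in> tensor_ideal A A"
      using TP.TQ.in_cl[OF f g] TP.P.a_minus_R[of g f] f by auto
    have "ext ?\<psi> (g - f) \<in> ker"
      unfolding ext_def
      by (rule TP.tensor_ideal_lin[OF K.zero_in K.add_in K.minus_in bil gR(2)])
    then have "rep (ext ?\<psi> g) = rep (ext ?\<psi> f)"
      by (simp add: ext_simps flip: eqv_iff) (simp add: K.eqv_def)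
    moreover have "rep (ext ?\<psi> g) = (\<Oplus>\<^bsub>A\<^esub>p\<in>pkeys g. plookup g p \<odot>\<^bsub>A\<^esub> \<beta> (fst p) (snd p))"
      using gR(1) unfolding ext_def lin_def
      by (subst rep_sum) (auto simp: rep_scale TP.P.carrier_R rep_sec cl subset_iff intro!: M.finsum_cong')
    ultimately show ?thesis by simp
  qed
  have "tensor_lift A \<beta> (TP.TQ.cl f) = rep (ext ?\<psi> f)"
    unfolding tensor_lift_def using val TP.TQ.self_in_cl[OF f] by (intro the_equality) auto
  then show ?thesis
    unfolding comult_co[OF IJ] f_def by (simp add: ext_simps C_simps)
qed

lemma haar_linear:
  assumes "a \<in> carrier A" "b \<in> carrier A"
  shows "haar (a \<oplus>\<^bsub>A\<^esub> b) = haar a + haar b" "haar (c \<odot>\<^bsub>A\<^esub> a) = c * haar a"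
  using haar assms by (auto simp: is_haar_state_def linear_maps_def complex_alg_simps)

sublocale H: haar_ideal ker H
proof unfold_locales
  fix \<epsilon> :: "bool list" and I J :: "'n list"
  assume IJ: "I \<in> Lw \<epsilon>" "J \<in> Lw \<epsilon>"
  have inv: "tensor_lift A (\<lambda>x y. haar x \<odot>\<^bsub>A\<^esub> y) (\<Delta> (rep z)) = rep (C (H z))"
    "tensor_lift A (\<lambda>x y. haar y \<odot>\<^bsub>A\<^esub> x) (\<Delta> (rep z)) = rep (C (H z))" for z
    using haar by (simp_all add: is_haar_state_def rep_closed rep_C H_def)
  have "rep (\<Sum>m\<in>Lw \<epsilon>. sec (haar (rep (co \<epsilon> I m)) \<odot>\<^bsub>A\<^esub> rep (co \<epsilon> m J))) = rep (C (H (co \<epsilon> I J)))"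
    by (subst tensor_lift_co[symmetric, where \<beta> = "\<lambda>x y. haar x \<odot>\<^bsub>A\<^esub> y"])
      (simp_all add: inv IJ haar_linear smult_add smult_r_distr smult_smult smult_commute)
  moreover have "K.eqv (\<Sum>m\<in>Lw \<epsilon>. C (H (co \<epsilon> I m)) * co \<epsilon> m J)
      (\<Sum>m\<in>Lw \<epsilon>. sec (haar (rep (co \<epsilon> I m)) \<odot>\<^bsub>A\<^esub> rep (co \<epsilon> m J)))"
    by (intro K.eqv_sum) (simp add: eqv_iff rep_sec rep_scale rep_closed H_def)
  ultimately show "K.eqv (\<Sum>k\<in>Lw \<epsilon>. C (H (co \<epsilon> I k)) * co \<epsilon> k J) (C (H (co \<epsilon> I J)))"
    by (simp add: eqv_iff)
  have "rep (\<Sum>m\<in>Lw \<epsilon>. sec (haar (rep (co \<epsilon> m J)) \<odot>\<^bsub>A\<^esub> rep (co \<epsilon> I m))) = rep (C (H (co \<epsilon> I J)))"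
    by (subst tensor_lift_co[symmetric, where \<beta> = "\<lambda>x y. haar y \<odot>\<^bsub>A\<^esub> x"])
      (simp_all add: inv IJ haar_linear smult_add smult_r_distr smult_smult smult_commute)
  moreover have "K.eqv (\<Sum>m\<in>Lw \<epsilon>. co \<epsilon> I m * C (H (co \<epsilon> m J)))
      (\<Sum>m\<in>Lw \<epsilon>. sec (haar (rep (co \<epsilon> m J)) \<odot>\<^bsub>A\<^esub> rep (co \<epsilon> I m)))"
    by (intro K.eqv_sum) (simp add: eqv_iff rep_sec rep_scale rep_closed H_def flip: C_commute)
  ultimately show "K.eqv (\<Sum>k\<in>Lw \<epsilon>. co \<epsilon> I k * C (H (co \<epsilon> k J))) (C (H (co \<epsilon> I J)))"
    by (simp add: eqv_iff)
qed (simp_all add: H_ker H_one)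

end

lemma (in rel_ideal) nc_spanned_fixed:
  assumes "nc_spanned M \<epsilon> \<xi>"
  shows "fixv \<epsilon> \<xi>"
  unfolding fixed_vec_def
proof
  obtain ls where len: "length ls = length (nc M \<epsilon> [])"
    and \<xi>: "\<And>J. J \<in> Lw \<epsilon> \<Longrightarrow> \<xi> J = comb ls (nc M \<epsilon> []) J"
    using assms by (auto simp: nc_spanned_def)
  fix I :: "'n list" assume I: "I \<in> Lw \<epsilon>"
  let ?vs = "nc M \<epsilon> []"
  have comb: "(C (\<xi> J) :: 'n free_elt) = (\<Sum>t<length ?vs. C ((?vs ! t) J) * C (ls ! t))" if "J \<in> Lw \<epsilon>" for J
    using \<xi>[OF that] comb_nth[OF len] by (simp add: C_sum mult.commute flip: C_simps(4))
  have "(\<Sum>J\<in>Lw \<epsilon>. co \<epsilon> I J * C (\<xi> J))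
      = (\<Sum>J\<in>Lw \<epsilon>. \<Sum>t<length ?vs. co \<epsilon> I J * C ((?vs ! t) J) * C (ls ! t))"
    by (intro sum.cong refl) (simp add: comb sum_distrib_left mult.assoc)
  also have "\<dots> = (\<Sum>t<length ?vs. (\<Sum>J\<in>Lw \<epsilon>. co \<epsilon> I J * C ((?vs ! t) J)) * C (ls ! t))"
    by (subst sum.swap) (simp only: sum_distrib_right)
  also have "\<dots> \<approx>\<^sub>I (\<Sum>t<length ?vs. C ((?vs ! t) I) * C (ls ! t))"
  proof (intro eqv_sum eqv_mult_right)
    fix t assume "t \<in> {..<length ?vs}"
    then have "fixv \<epsilon> (?vs ! t)" using nc_fixed[of "?vs ! t" \<epsilon> "[]"] by simp
    then show "(\<Sum>J\<in>Lw \<epsilon>. co \<epsilon> I J * C ((?vs ! t) J)) \<approx>\<^sub>I C ((?vs ! t) I)"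
      using I by (simp add: fixed_vec_def)
  qed
  also have "\<dots> = C (\<xi> I)" using comb[OF I] by simp
  finally show "(\<Sum>J\<in>Lw \<epsilon>. co \<epsilon> I J * C (\<xi> J)) \<approx>\<^sub>I C (\<xi> I)" .
qed

section \<open>The defining ideal of the free unitary quantum group\<close>

lemma ideal_free_iff: "ideal K free_star_alg \<longleftrightarrow> alg_ideal K"
proof
  assume "ideal K free_star_alg"
  then interpret ideal K free_star_alg .
  show "alg_ideal K"
  proof
    show "0 \<in> K" using zero_closed by simp
    show "x + y \<in> K" if "x \<in> K" "y \<in> K" for x y using a_closed[OF that] by simp
    show "a * x \<in> K" if "x \<in> K" for x a using I_l_closed[OF that, of a] by simp
    show "x * a \<in> K" if "x \<in> K" for x a using I_r_closed[OF that, of a] by simp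
  qed
next
  assume "alg_ideal K"
  then interpret alg_ideal K .
  show "ideal K free_star_alg"
  proof (rule idealI)
    show "subgroup K (add_monoid free_star_alg)"
    proof (rule FS.M.add.subgroupI)
      show "K \<noteq> {}" using zero_in by blast
      fix a assume a: "a \<in> K"
      have "\<ominus>\<^bsub>free_star_alg\<^esub> a = - a"
        using FS.M.minus_equality[of "- a" a] by simp
      then show "\<ominus>\<^bsub>free_star_alg\<^esub> a \<in> K" using a minus_in by simp
    qed (simp_all add: add_in)
  qed (simp_all add: FS.ring_axioms left_in right_in)
qed

lemma matrix_inv_eq:
  assumes "Q ** R = mat 1" "R ** Q = mat 1"
  shows "matrix_inv Q = R"
proof -
  have "Q ** matrix_inv Q = mat 1 \<and> matrix_inv Q ** Q = mat 1"
    unfolding matrix_inv_def by (rule someI[of _ R]) (simp add: assms)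
  then have "R ** (Q ** matrix_inv Q) = R" by simp
  then show ?thesis by (simp add: matrix_mul_assoc assms)
qed

lemma free_unitary_ideal_eq:
  fixes Q R :: "complex^'n^'n"
  assumes "Q ** R = mat 1" "R ** Q = mat 1"
  shows "free_unitary_ideal Q = Idl\<^bsub>free_star_alg\<^esub>
     (unitarity_relators free_star_alg (Um False) \<union>
      unitarity_relators free_star_alg (CM Q ** Um True ** CM R))"
  by (simp add: free_unitary_ideal_def free_mat twisted_conj_eq matrix_inv_eq[OF assms])

lemma free_unitary_rel_ideal:
  fixes Q R :: "complex^'n^'n"
  assumes QR: "Q ** R = mat 1" "R ** Q = mat 1"
  shows "rel_ideal (free_unitary_ideal Q) (R ** cadj R) (cadj Q ** Q)"
    and "rel_ideal K (R ** cadj R) (cadj Q ** Q) \<Longrightarrow> free_unitary_ideal Q \<subseteq> K"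
proof -
  let ?S = "unitarity_relators free_star_alg (Um False) \<union>
      unitarity_relators free_star_alg (CM Q ** Um True ** CM R)"
  have "ideal (Idl\<^bsub>free_star_alg\<^esub> ?S) free_star_alg" "?S \<subseteq> Idl\<^bsub>free_star_alg\<^esub> ?S"
    by (rule FS.genideal_ideal FS.genideal_self; simp)+
  then show "rel_ideal (free_unitary_ideal Q) (R ** cadj R) (cadj Q ** Q)"
    using rel_ideal_iff[OF _ QR, of "free_unitary_ideal Q"]
    by (simp add: free_unitary_ideal_eq[OF QR] ideal_free_iff)
  assume K: "rel_ideal K (R ** cadj R) (cadj Q ** Q)"
  then have "alg_ideal K" by (simp add: rel_ideal_def)
  with K show "free_unitary_ideal Q \<subseteq> K"
    using rel_ideal_iff[OF _ QR, of K] unfolding free_unitary_ideal_eq[OF QR] genideal_def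
    by (auto simp: ideal_free_iff)
qed

context discrete_qgroup begin

subsection \<open>The relations\<close>

lemma rep_matrix_mult: "rep ((X ** Y) $ i $ j) = (\<Oplus>\<^bsub>A\<^esub>k\<in>UNIV. rep (X $ i $ k) \<otimes>\<^bsub>A\<^esub> rep (Y $ k $ j))"
  by (simp add: matrix_matrix_mult_def rep_sum rep_mult)

lemma rep_mat_1: "rep (mat 1 $ i $ j) = mat_one A $ i $ j"
  by (simp add: mat_def mat_one_def rep_1 rep_0)

lemma rep_Um: "rep (Um False $ i $ j) = u $ i $ j" "rep (Um True $ i $ j) = star A (u $ i $ j)"
  by (simp_all add: Um_def rep_gen letter_def)

lemma unitary_eqv: "K.meqv (Um False ** tr (Um True)) (mat 1)" "K.meqv (tr (Um True) ** Um False) (mat 1)"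
  using unitary unfolding K.meqv_def eqv_iff rep_matrix_mult rep_mat_1 mat_unitary_def
  by (simp_all add: Finite_Cartesian_Product.transpose_def rep_Um mat_mult_def mat_adj_def vec_eq_iff)

lemma conj_inverse:
  obtains Y where "K.meqv (Um True ** Y) (mat 1)" "K.meqv (Y ** Um True) (mat 1)"
proof -
  obtain Y where Y: "\<And>i j. Y $ i $ j \<in> carrier A" "mat_mult A (mat_conj A u) Y = mat_one A"
      "mat_mult A Y (mat_conj A u) = mat_one A"
    using conj_invertible by (auto simp: mat_invertible_def mat_carrier_def)
  define Z where "Z = (\<chi> i j. sec (Y $ i $ j))"
  have Z: "rep (Z $ i $ j) = Y $ i $ j" for i j
    by (simp add: Z_def rep_sec Y)
  have "K.meqv (Um True ** Z) (mat 1)" "K.meqv (Z ** Um True) (mat 1)"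
    using Y unfolding K.meqv_def eqv_iff rep_matrix_mult rep_mat_1
    by (simp_all add: rep_Um Z mat_mult_def mat_conj_def vec_eq_iff)
  then show thesis by (rule that)
qed

lemma pos_def_form: "pos_def H.form"
proof -
  obtain Y where Y: "K.meqv (Um True ** Y) (mat 1)" by (rule conj_inverse)
  show ?thesis by (rule H.form_pos_def[OF _ _ Y]) (simp_all add: H_pos adj_ker)
qed

lemma rel_ideal_ker:
  assumes N: "H.form ** N = mat 1" "N ** H.form = mat 1"
  shows "rel_ideal ker H.form N"
proof -
  obtain Y where "K.meqv (Um True ** Y) (mat 1)" "K.meqv (Y ** Um True) (mat 1)" by (rule conj_inverse)
  from H.form_rel4[OF N this] unitary_eqv H.form_rel3 show ?thesis
    unfolding K.meqv_def rel_entries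
    by unfold_locales (simp_all add: N mat_def CM_def)
qed

lemma moment_eq:
  "moment \<Gamma> k = H (((\<Sum>i\<in>UNIV. gen i i False) + (\<Sum>i\<in>UNIV. gen i i True)) ^ k)"
proof -
  have "main_character \<Gamma> = rep (\<Sum>i\<in>UNIV. gen i i False)"
    by (simp add: main_character_def rep_sum rep_gen letter_def)
  moreover have "adj (\<Sum>i\<in>UNIV. gen i i False) = (\<Sum>i\<in>UNIV. gen i i True :: 'n free_elt)"
    by (simp add: adj_sum adj_gen)
  ultimately show ?thesis
    by (simp add: moment_def H_def haar_def rep_power rep_add flip: rep_adj)
qed

subsection \<open>Counit and antipode\<close>

text \<open>For a single letter, let \<open>E\<close> be the scalar matrix of counit values. The
  counit axiom reads \<open>u E = u\<close>, and a left inverse of \<open>u\<close> gives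
  \<open>E = 1\<close>; likewise for \<open>u^c\<close>, whose left inverse comes from its
  invertibility. Words follow by multiplicativity.\<close>

lemma counit_co:
  assumes counit: "is_counit A \<Delta> e"
    and IJ: "I \<in> Lw \<epsilon>" "J \<in> Lw \<epsilon>"
  shows "e (rep (co \<epsilon> I J)) = (if I = J then 1 else 0)"
proof -
  have e_add: "e (a \<oplus>\<^bsub>A\<^esub> b) = e a + e b" and e_mult: "e (a \<otimes>\<^bsub>A\<^esub> b) = e a * e b"
    and e_scale: "e (c \<odot>\<^bsub>A\<^esub> a) = c * e a" and e_one: "e \<one>\<^bsub>A\<^esub> = 1"
    if "a \<in> carrier A" "b \<in> carrier A" for a b c
    using counit that
    by (auto simp: is_counit_def ring_hom_def linear_maps_def complex_alg_simps)
  have e_letter: "e (rep (gen l j b)) = (if l = j then 1 else 0)" for l j b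
  proof -
    obtain V where V: "\<And>k. K.eqv (\<Sum>i\<in>UNIV. V i * gen i k b) (if l = k then 1 else 0)"
    proof (cases b)
      case False
      then show ?thesis
        using unitary_eqv(2) that[of "\<lambda>i. gen i l True"] by (simp add: K.meqv_def rel_entries mat_def)
    next
      case True
      obtain Y where "K.meqv (Y ** Um True) (mat 1)" by (rule conj_inverse)
      then show ?thesis
        using True that[of "\<lambda>i. Y $ l $ i"] by (simp add: K.meqv_def matrix_matrix_mult_def Um_def mat_def)
    qed
    have eqv: "K.eqv (\<Sum>k\<in>UNIV. C (e (rep (gen k j b))) * gen i k b) (gen i j b)" for i
    proof -
      have "tensor_lift A (\<lambda>x y. e y \<odot>\<^bsub>A\<^esub> x) (\<Delta> (rep (co [b] [i] [j]))) = rep (co [b] [i] [j])"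
        using counit by (simp add: is_counit_def rep_closed)
      also have "tensor_lift A (\<lambda>x y. e y \<odot>\<^bsub>A\<^esub> x) (\<Delta> (rep (co [b] [i] [j])))
          = rep (\<Sum>m\<in>L (length [b]). sec (e (rep (co [b] m [j])) \<odot>\<^bsub>A\<^esub> rep (co [b] [i] m)))"
        by (rule tensor_lift_co)
          (simp_all add: in_L_iff e_add e_scale smult_add smult_r_distr smult_smult smult_commute)
      finally have "rep (\<Sum>k\<in>UNIV. sec (e (rep (gen k j b)) \<odot>\<^bsub>A\<^esub> rep (gen i k b))) = rep (gen i j b)"
        by (simp add: sum_L_Suc)
      moreover have "K.eqv (\<Sum>k\<in>UNIV. C (e (rep (gen k j b))) * gen i k b)
          (\<Sum>k\<in>UNIV. sec (e (rep (gen k j b)) \<odot>\<^bsub>A\<^esub> rep (gen i k b)))"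
        by (intro K.eqv_sum) (simp add: eqv_iff rep_sec rep_scale rep_closed)
      ultimately show ?thesis by (simp add: eqv_iff)
    qed
    have "K.eqv (\<Sum>k\<in>UNIV. C (e (rep (gen k j b))) * (if l = k then 1 else 0))
        (\<Sum>k\<in>UNIV. C (e (rep (gen k j b))) * (\<Sum>i\<in>UNIV. V i * gen i k b))"
      by (intro K.eqv_sum K.eqv_mult_left K.eqv_sym[OF V])
    also have "(\<Sum>k\<in>UNIV. C (e (rep (gen k j b))) * (\<Sum>i\<in>UNIV. V i * gen i k b))
        = (\<Sum>i\<in>UNIV. V i * (\<Sum>k\<in>UNIV. C (e (rep (gen k j b))) * gen i k b))"
      by (simp add: sum_distrib_left C_left_commute[of "V _"]) (rule sum.swap)
    also have "K.eqv \<dots> (\<Sum>i\<in>UNIV. V i * gen i j b)"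
      by (intro K.eqv_sum K.eqv_mult_left eqv)
    also have "K.eqv \<dots> (if l = j then 1 else 0)" by (rule V)
    finally have "K.eqv (C (e (rep (gen l j b)))) (if l = j then 1 else 0)"
      by (simp add: if_distrib[of "\<lambda>x. _ * x"] cong: if_cong)
    \<comment> \<open>Congruent scalars are equal, since \<open>H\<close> vanishes on
      \<open>ker\<close> and is normalised.\<close>
    from H.H_eqv[OF this] show ?thesis
      by (simp add: H.H_C H.H_1 H.H_0 split: if_splits)
  qed
  show ?thesis
    using IJ
  proof (induction \<epsilon> arbitrary: I J)
    case Nil
    then show ?case using e_one[OF one_closed one_closed] by (simp add: rep_1)
  next
    case (Cons b \<epsilon>)
    then obtain i I' j J' where "I = i # I'" "J = j # J'" "I' \<in> Lw \<epsilon>" "J' \<in> Lw \<epsilon>"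
      by (auto elim!: L_SucE)
    then show ?case
      using Cons.IH by (simp add: rep_mult e_mult rep_closed e_letter)
  qed
qed

lemma antipode_co:
  assumes counit: "is_counit A \<Delta> e" and antipode: "is_antipode A \<Delta> e S"
    and IJ: "I \<in> Lw \<epsilon>" "J \<in> Lw \<epsilon>"
  shows "K.eqv (\<Sum>m\<in>Lw \<epsilon>. co \<epsilon> I m * sec (S (rep (co \<epsilon> m J)))) (if I = J then 1 else 0)"
proof -
  have S_closed: "S a \<in> carrier A" and S_add: "S (a \<oplus>\<^bsub>A\<^esub> b) = S a \<oplus>\<^bsub>A\<^esub> S b"
    and S_scale: "S (c \<odot>\<^bsub>A\<^esub> a) = c \<odot>\<^bsub>A\<^esub> S a"
    if "a \<in> carrier A" "b \<in> carrier A" for a b c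
    using antipode that by (auto simp: is_antipode_def linear_maps_def)
  note S_closed' = S_closed[OF _ rep_closed[of 0]] and S_scale' = S_scale[OF _ rep_closed[of 0]]
  have "tensor_lift A (\<lambda>x y. x \<otimes>\<^bsub>A\<^esub> S y) (\<Delta> (rep (co \<epsilon> I J))) = rep (if I = J then 1 else 0)"
    using antipode counit_co[OF counit IJ]
    by (simp add: is_antipode_def rep_closed rep_1 rep_0 one_smult zero_smult)
  also have "tensor_lift A (\<lambda>x y. x \<otimes>\<^bsub>A\<^esub> S y) (\<Delta> (rep (co \<epsilon> I J)))
      = rep (\<Sum>m\<in>Lw \<epsilon>. sec (rep (co \<epsilon> I m) \<otimes>\<^bsub>A\<^esub> S (rep (co \<epsilon> m J))))"
    by (rule tensor_lift_co[OF _ _ _ _ _ IJ])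
      (simp_all add: S_closed' S_add S_scale' l_distr r_distr smult_mult_left smult_mult_right)
  finally have "rep (\<Sum>m\<in>Lw \<epsilon>. sec (rep (co \<epsilon> I m) \<otimes>\<^bsub>A\<^esub> S (rep (co \<epsilon> m J)))) = rep (if I = J then 1 else 0)" .
  moreover have "K.eqv (\<Sum>m\<in>Lw \<epsilon>. co \<epsilon> I m * sec (S (rep (co \<epsilon> m J))))
      (\<Sum>m\<in>Lw \<epsilon>. sec (rep (co \<epsilon> I m) \<otimes>\<^bsub>A\<^esub> S (rep (co \<epsilon> m J))))"
    by (intro K.eqv_sum) (simp add: eqv_iff rep_sec rep_mult rep_closed S_closed')
  ultimately show ?thesis by (simp add: eqv_iff)
qed

text \<open>Applied to \<open>\<Delta>(x) = 0\<close>, the bilinear map \<open>(a, b) \<mapsto> Phi (S b) a\<close> returns \<open>x\<close> modulo \<open>I\<close>; it is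
  well defined on the quotient by the kernel because of \<open>Phi_in\<close>.\<close>

lemma ker_subset:
  assumes I: "rel_ideal I M N"
    and fixed_imp: "\<And>\<epsilon> \<xi>. fixed_vec ker \<epsilon> \<xi> \<Longrightarrow> fixed_vec I \<epsilon> \<xi>"
  shows "ker \<subseteq> I"
proof
  fix x assume x: "x \<in> ker"
  interpret I: rel_ideal I M N by (rule I)
  interpret two_ideals ker I H M N
    by unfold_locales (rule fixed_imp)
  obtain e S where e: "is_counit A \<Delta> e" and S: "is_antipode A \<Delta> e S"
    using hopf by (auto simp: hopf_star_algebra_def)
  have S_closed: "S a \<in> carrier A" if "a \<in> carrier A" for a
    using S that by (auto simp: is_antipode_def linear_maps_def)
  have S_add: "S (a \<oplus>\<^bsub>A\<^esub> b) = S a \<oplus>\<^bsub>A\<^esub> S b" if "a \<in> carrier A" "b \<in> carrier A" for a b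
    using S that by (auto simp: is_antipode_def linear_maps_def)
  have S_scale: "S (c \<odot>\<^bsub>A\<^esub> a) = c \<odot>\<^bsub>A\<^esub> S a" if "a \<in> carrier A" for a c
    using S that by (auto simp: is_antipode_def linear_maps_def)
  \<comment> \<open>Changing \<open>y\<close> within its class does not alter \<open>Phi\<close> at
    all, because \<open>H\<close> vanishes on \<open>ker\<close>; changing \<open>z\<close> alters
    it by an element of \<open>I\<close>, by \<open>Phi_in\<close>. Hence the choices made by
    \<open>sec\<close> do not matter modulo \<open>I\<close>.\<close>
  have cong: "I.eqv (Phi H y z) (Phi H y' z')" if "rep y = rep y'" "rep z = rep z'" for y y' z z'
  proof -
    have "Phi H (y - y') z = 0"
    proof -
      have "y - y' \<in> ker" using that by (simp add: diff_in_ker)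
      then have "phi H (y - y') = (\<lambda>_. 0)"
        by (simp add: phi_def fun_eq_iff H.H_K K.left_in C_simps)
      then show ?thesis by (simp add: ext_def lin_def)
    qed
    then have "Phi H y z = Phi H y' z"
      using H.Phi_add[of "y - y'" y' z] by simp
    moreover have "Phi H y' (z - z') \<in> I"
      by (rule Phi_in) (use that in \<open>simp add: diff_in_ker\<close>)
    ultimately show ?thesis by (simp add: I.eqv_def ext_simps)
  qed
  define \<beta> where "\<beta> p = Phi H (sec (S (snd p))) (sec (fst p))" for p
  have \<beta>_rep: "I.eqv (\<beta> (rep z, rep y)) (Phi H (sec (S (rep y))) z)" for y z
    unfolding \<beta>_def by (rule cong) (simp_all add: rep_sec rep_closed S_closed)
  have "TP.bilinear_mod I (\<lambda>p c. C c * \<beta> p)"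
  proof -
    have 1: "I.eqv (\<beta> (a \<oplus>\<^bsub>A\<^esub> a', b)) (\<beta> (a, b) + \<beta> (a', b))"
      if "a \<in> carrier A" "a' \<in> carrier A" "b \<in> carrier A" for a a' b
      unfolding \<beta>_def fst_conv snd_conv ext_simps(2)[symmetric]
      by (rule cong) (simp_all add: rep_sec rep_add that)
    have 2: "I.eqv (\<beta> (a, b \<oplus>\<^bsub>A\<^esub> b')) (\<beta> (a, b) + \<beta> (a, b'))"
      if "a \<in> carrier A" "b' \<in> carrier A" "b \<in> carrier A" for a b b'
      unfolding \<beta>_def fst_conv snd_conv H.Phi_add[symmetric]
      by (rule cong) (simp_all add: rep_sec rep_add S_closed S_add that)
    have 3: "I.eqv (\<beta> (d \<odot>\<^bsub>A\<^esub> a, b)) (C d * \<beta> (a, b))"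
      if "a \<in> carrier A" "b \<in> carrier A" for a b d
      unfolding \<beta>_def fst_conv snd_conv ext_scale[symmetric]
      by (rule cong) (simp_all add: rep_sec rep_scale that)
    have 4: "I.eqv (\<beta> (a, d \<odot>\<^bsub>A\<^esub> b)) (C d * \<beta> (a, b))"
      if "a \<in> carrier A" "b \<in> carrier A" for a b d
      unfolding \<beta>_def fst_conv snd_conv H.Phi_scale[symmetric]
      by (rule cong) (simp_all add: rep_sec rep_scale S_closed S_scale that)
    have m: "C c * x - C c * y - C c * z \<in> I" if "I.eqv x (y + z)" for c x y z
      using I.eqv_mult_left[OF that, of "C c"] by (simp add: I.eqv_def distrib_left diff_diff_eq)
    have n: "C c * x - C (c * d) * y \<in> I" if "I.eqv x (C d * y)" for c d x y
      using I.eqv_mult_left[OF that, of "C c"] by (simp add: I.eqv_def C_simps mult.assoc)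
    show ?thesis
      unfolding TP.bilinear_mod_def
      by (intro conjI allI ballI m n 1 2 3 4) (simp_all add: C_simps distrib_right)
  qed
  moreover have "D x \<in> tensor_ideal A A"
  proof -
    \<comment> \<open>Both sides are the comultiplication of the zero element of \<open>A\<close>,
      as \<open>x\<close> is in the kernel.\<close>
    have "TP.TQ.cl (D x) = TP.TQ.cl (D 0)"
      using x by (simp add: ker_def rep_0 flip: comult_rep)
    then have "D x \<ominus>\<^bsub>TP.P.R\<^esub> D 0 \<in> tensor_ideal A A"
      by (simp add: TP.TQ.cl_eq_iff D_closed)
    then show ?thesis
      by (simp add: TP.P.a_minus_R D_closed) (simp add: D_simps)
  qed
  ultimately have "ext \<beta> (D x) \<in> I"
    unfolding ext_def by (intro TP.tensor_ideal_lin) (auto simp: I.zero_in I.add_in I.minus_in)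
  moreover have "I.eqv (ext \<beta> (D z)) z" for z
    using subset_UNIV[of "pkeys z"]
  proof (induction z rule: keys_add_single_induct)
    case zero
    then show ?case by (simp add: D_simps ext_simps)
  next
    case (single w c)
    define \<epsilon> a b where "\<epsilon> = map (snd \<circ> snd) w" and "a = map fst w" and "b = map (fst \<circ> snd) w"
    have ab: "a \<in> Lw \<epsilon>" "b \<in> Lw \<epsilon>" and len: "length w = length \<epsilon>"
      by (simp_all add: \<epsilon>_def a_def b_def in_L_iff)
    have w: "psingle w c = C c * co \<epsilon> a b"
      unfolding \<epsilon>_def a_def b_def single_eq_co[symmetric] by (rule single_eq_C)
    have "ext \<beta> (D (psingle w c)) = C c * (\<Sum>m\<in>Lw \<epsilon>. \<beta> (rep (co \<epsilon> a m), rep (co \<epsilon> m b)))"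
      by (simp add: D_single len ext_simps sum_distrib_left flip: \<epsilon>_def a_def b_def)
    also have "I.eqv \<dots> (C c * (\<Sum>m\<in>Lw \<epsilon>. Phi H (sec (S (rep (co \<epsilon> m b)))) (co \<epsilon> a m)))"
      by (intro I.eqv_mult_left I.eqv_sum \<beta>_rep)
    also have "\<dots> = psingle w c"
      unfolding w using Phi_antipode[of \<epsilon> "\<lambda>z. sec (S (rep z))", OF antipode_co[OF e S] ab] by simp
    finally show ?case .
  next
    case (add f g)
    then show ?case by (simp add: D_simps ext_simps I.eqv_add)
  qed
  ultimately show "x \<in> I"
    using I.eqv_0 I.eqv_sym I.eqv_trans by blast
qed

text \<open>Both algebras are the quotient of the free star-algebra by the same ideal. Evaluation is
  constant on its cosets, so any representative may be evaluated, and it is onto because the entries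
  of \<open>u\<close> generate \<open>A\<close>.\<close>

lemma isomorphic_FU:
  assumes "free_unitary_ideal Q = ker"
  shows "qgroup_isomorphic \<Gamma> (FU Q)"
proof -
  have "alg_ideal ker" by unfold_locales
  then interpret I: ideal ker free_star_alg by (simp add: ideal_free_iff)
  interpret Q: star_quotient ker free_star_alg by unfold_locales
  have T: "pol (FU Q) = Q.T" and fundT: "fund (FU Q) $ i $ j = Q.cl (gen i j False)" for i j
    by (simp_all add: FU_def free_unitary_alg_def free_unitary_fund_def assms free_gen_def gen_def)
  define \<phi> where "\<phi> X = rep (SOME x. x \<in> X)" for X
  have \<phi>_cl: "\<phi> (Q.cl x) = rep x" for x
  proof -
    have "(SOME y. y \<in> Q.cl x) \<in> Q.cl x"
      by (rule someI[of _ x]) (simp add: Q.self_in_cl)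
    then show ?thesis
      using Q.in_cl[of x] by (simp add: \<phi>_def diff_in_ker)
  qed
  have carrier: "X \<in> carrier Q.T \<longleftrightarrow> (\<exists>x. X = Q.cl x)" for X
    by (auto simp: Q.T_simps)
  have star: "star Q.T (Q.cl x) = Q.cl (adj x)" for x
    using Q.cl_star[of x] by (simp add: adj_ker)
  have add: "Q.cl x \<oplus>\<^bsub>Q.T\<^esub> Q.cl y = Q.cl (x + y)" and mult: "Q.cl x \<otimes>\<^bsub>Q.T\<^esub> Q.cl y = Q.cl (x * y)"
    and smult: "c \<odot>\<^bsub>Q.T\<^esub> Q.cl x = Q.cl (C c * x)" for x y c
    using Q.cl_add[of x y] Q.cl_mult[of x y] Q.cl_smult[of x c] by simp_all
  have "\<phi> \<in> ring_hom Q.T A"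
    by (rule ring_hom_memI)
      (auto simp: carrier \<phi>_cl add mult rep_add rep_mult rep_closed Q.T_simps rep_1)
  moreover have "\<phi> \<in> linear_maps Q.T A"
    unfolding linear_maps_def by (auto simp: carrier \<phi>_cl add smult rep_add rep_scale rep_closed)
  moreover have "\<forall>X\<in>carrier Q.T. \<phi> (star Q.T X) = star A (\<phi> X)"
    by (auto simp: carrier \<phi>_cl star rep_adj)
  moreover have "bij_betw \<phi> (carrier Q.T) (carrier A)"
    unfolding bij_betw_def
  proof
    show "inj_on \<phi> (carrier Q.T)"
    proof (rule inj_onI)
      fix X Y assume "X \<in> carrier Q.T" "Y \<in> carrier Q.T" "\<phi> X = \<phi> Y"
      then obtain x y where "X = Q.cl x" "Y = Q.cl y" "rep x = rep y"
        by (auto simp: carrier \<phi>_cl)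
      then show "X = Y"
        by (simp only: Q.cl_eq_iff free_carrier UNIV_I) (simp add: diff_in_ker)
    qed
    show "\<phi> ` carrier Q.T = carrier A"
      using rep_surj[OF generated] rep_closed by (force simp: image_iff carrier \<phi>_cl)
  qed
  ultimately have "\<phi> \<in> star_iso (pol (FU Q)) A"
    by (simp add: star_iso_def star_hom_def T)
  moreover have "\<phi> (fund (FU Q) $ i $ j) = u $ i $ j" for i j
    by (simp add: fundT \<phi>_cl rep_gen letter_def)
  ultimately show ?thesis
    unfolding qgroup_isomorphic_def by blast
qed

end

theorem corollary3p5:
  fixes \<Gamma> :: "('a, 'n::finite) qgroup"
  assumes "fg_discrete_quantum_group \<Gamma>"
    and "CARD('n) \<ge> 2"
  shows "(\<forall>k. even k \<longrightarrow> moment \<Gamma> k \<ge> 2 ^ (k div 2) * catalan (k div 2)) \<and>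
    (\<forall>k. odd k \<longrightarrow> moment \<Gamma> k \<ge> 0) \<and>
    ((\<forall>k. (even k \<longrightarrow> moment \<Gamma> k = 2 ^ (k div 2) * catalan (k div 2)) \<and>
          (odd k \<longrightarrow> moment \<Gamma> k = 0)) \<longrightarrow>
     (\<exists>Q :: complex^'n^'n. invertible Q \<and> qgroup_isomorphic \<Gamma> (FU Q)))"
proof -
  interpret discrete_qgroup \<Gamma> by unfold_locales (rule assms(1))
  \<comment> \<open>\<open>Q\<close> depends only on the Haar state and is fixed before any moment
    is considered. The relations of the kernel and of \<open>free_unitary_ideal Q\<close> thus
    involve the same matrix \<open>M\<close>, and both have the same noncrossing vectors.\<close>
  obtain Q R :: "complex^'n^'n" where QR: "Q ** R = mat 1" "R ** Q = mat 1" "H.form = R ** cadj R"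
    by (rule pos_def_factor[OF pos_def_form])
  let ?M = "R ** cadj R" and ?N = "cadj Q ** Q"
  interpret F: rel_ideal "free_unitary_ideal Q" ?M ?N
    by (rule free_unitary_rel_ideal(1)[OF QR(1,2)])
  have ker_rel: "rel_ideal ker ?M ?N"
    using rel_ideal_ker[of ?N] F.MN F.NM QR(3) by simp
  obtain \<alpha> where \<alpha>: "\<And>c. cup_form ?M c (\<alpha> c) (\<alpha> (\<not> c)) = 0" "\<And>c. \<exists>z. cup_form ?M c (\<alpha> c) z \<noteq> 0"
    using isotropic_covectors[OF pos_def_form[unfolded QR(3)] assms(2)] by blast
  interpret B: rel_ideal ker ?M ?N by (rule ker_rel)
  interpret HR: haar_rel ker H ?M ?N \<alpha>
    by unfold_locales (rule \<alpha>)+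
  have count: "of_nat (dyck k 0) = (if even k then 2 ^ (k div 2) * catalan (k div 2) else (0 :: complex))" for k
    using dyck_catalan[of "k div 2"] dyck_odd[of k 0] by (cases "even k") simp_all
  have ge: "moment \<Gamma> k \<ge> of_nat (dyck k 0)" for k
  proof -
    obtain r where "moment \<Gamma> k = of_nat r" "dyck k 0 \<le> r"
      using HR.moments[of k] by (auto simp: moment_eq)
    then show ?thesis by (simp add: less_eq_complex_def)
  qed
  have "invertible Q \<and> qgroup_isomorphic \<Gamma> (FU Q)"
    if eq: "\<And>k. moment \<Gamma> k = of_nat (dyck k 0)"
  proof
    show "invertible Q" using QR unfolding invertible_def by blast
    \<comment> \<open>Equality at order \<open>length \<epsilon>\<close> makes the noncrossing
      vectors span the fixed vectors of \<open>\<epsilon>\<close> for \<open>\<Gamma>\<close>, and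
      noncrossing vectors are fixed modulo every ideal that satisfies the relations for this
      \<open>M\<close>.\<close>
    have "fixed_vec (free_unitary_ideal Q) \<epsilon> \<xi>" if fx: "fixed_vec ker \<epsilon> \<xi>" for \<epsilon> \<xi>
    proof -
      obtain r where "moment \<Gamma> (length \<epsilon>) = of_nat r"
        and r: "r = dyck (length \<epsilon>) 0 \<longrightarrow>
          (\<forall>\<delta> \<zeta>. length \<delta> = length \<epsilon> \<longrightarrow> B.fixv \<delta> \<zeta> \<longrightarrow> nc_spanned ?M \<delta> \<zeta>)"
        using HR.moments[of "length \<epsilon>"] unfolding moment_eq by blast
      then have "r = dyck (length \<epsilon>) 0" using eq by simp
      then show ?thesis using r fx by (intro F.nc_spanned_fixed) blast
    qed
    then have "ker \<subseteq> free_unitary_ideal Q"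
      by (rule ker_subset[OF free_unitary_rel_ideal(1)[OF QR(1,2)]])
    then show "qgroup_isomorphic \<Gamma> (FU Q)"
      using free_unitary_rel_ideal(2)[OF QR(1,2) ker_rel] by (intro isomorphic_FU) auto
  qed
  note iso = this
  show ?thesis
  proof (intro conjI allI impI)
    fix k :: nat
    show "moment \<Gamma> k \<ge> 2 ^ (k div 2) * catalan (k div 2)" if "even k"
      using ge[of k] count[of k] that by simp
    show "moment \<Gamma> k \<ge> 0" if "odd k"
      using ge[of k] count[of k] that by simp
  next
    assume eq: "\<forall>k. (even k \<longrightarrow> moment \<Gamma> k = 2 ^ (k div 2) * catalan (k div 2)) \<and> (odd k \<longrightarrow> moment \<Gamma> k = 0)"
    have "moment \<Gamma> k = of_nat (dyck k 0)" for k
      using eq count[of k] by simp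
    from iso[OF this] show "\<exists>Q :: complex^'n^'n. invertible Q \<and> qgroup_isomorphic \<Gamma> (FU Q)"
      by blast
  qed
qed

end
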